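(* Let $X$ be an Asplund space, $T$ a nonempty index set, $\{f_t:t\in T\}$ a family of proper convex lower semicontinuous functions $f_t:X\to\mathbb{R}\cup\{+\infty\}$, $f:=\sup_{t\in T}f_t$, and $\bar x\in X$. Assume there is a neighborhood $U$ of $\bar x$ such that: (a) for all $x\in U$, for all but at most one of the functions $f_t$, $t\in T$, the following holds: for every net $(\lambda_\nu,x_\nu,x_\nu^* )\in[0,+\infty)\times X\times X^*$ with $\lambda_\nu\to0$, $x_\nu\to x$, $f_t(x_\nu)\to f_t(x)$, $x_\nu^*\in\partial f_t(x_\nu)$ and $\lambda_\nu x_\nu^*\to0$ weak$^*$, one has $\|\lambda_\nu x_\nu^*\|_*\to0$; (b) for all $x\in U$ and all finite $F\subseteq T$: if $w_t^*\in N_{\mathrm{dom} f_t}(x)$ for $t\in F$ and $\sum_{t\in F}w_t^*=0$, then $w_t^*=0$ for all $t\in F$. Then $$\partial f(\bar x)\subseteq\bigcap_{\epsilon>0}\mathrm{cl}^{w^*}A(\bar x,\epsilon),\qquad A(\bar x,\epsilon):=\bigcup\Big\{\mathrm{co}\Big(\bigcup_{t\in F_1}\partial f_t(x')\Big)+\sum_{t\in F_2}N_{\mathrm{dom} f_t}(x')\Big\},$$ where the union is over all finite $F_1,F_2\subseteq T$ and $x'\in\mathbb{B}(\bar x,\epsilon)$ such that $|f_t(x')-f(\bar x)|\le\epsilon$ and $f_t(x')=\max_{s\in F_1\cup F_2}f_s(x')$ for all $t\in F_1$. Moreover, equality holds whenever $f$ is continuous at some point or $X$ is finite-dimensional.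
   Context: An Asplund space is a Banach space all of whose separable subspaces have separable dual. $\partial$ is the convex subdifferential: $\partial g(x)=\{x^*\in X^*:\langle x^*,y-x\rangle\le g(y)-g(x)\ \forall y\in X\}$ if $g(x)$ is finite, and $\emptyset$ otherwise. $\mathrm{dom}\,g=\{g<+\infty\}$ and $N_{\mathrm{dom} g}(x)=\{x^*\in X^*:\langle x^*,y-x\rangle\le0\ \forall y\in\mathrm{dom}\,g\}$. $\mathrm{co}$ is the convex hull, $\mathrm{cl}^{w^*}$ the weak$^*$ closure, $\mathbb{B}(\bar x,\epsilon)$ the closed ball. An empty sum is $\{0\}$. *)

theory Defs
  imports "HOL-Analysis.Analysis"
begin

type_synonym 'a dual = "'a \<Rightarrow>\<^sub>L real"

text \<open>For real-valued operators the strong operator topology (pointwise convergence on the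
  space) is the weak* topology of the dual.\<close>

abbreviation weak_star :: "('a::real_normed_vector) dual topology" where
  "weak_star \<equiv> strong_operator_topology"

text \<open>A linear subspace \<open>Y\<close> of \<open>'a\<close> is a set, not a type, so its dual is a set of
  functions; each bounded linear functional on \<open>Y\<close> is represented once, by the function that
  is \<open>undefined\<close> outside \<open>Y\<close>.\<close>

definition subspace_dual :: "'a::real_normed_vector set \<Rightarrow> ('a \<Rightarrow> real) set" where
  "subspace_dual Y = {g \<in> extensional Y.
     (\<forall>x\<in>Y. \<forall>y\<in>Y. g (x + y) = g x + g y) \<and>
     (\<forall>c. \<forall>x\<in>Y. g (c *\<^sub>R x) = c * g x) \<and>
     (\<exists>K. \<forall>x\<in>Y. \<bar>g x\<bar> \<le> K * norm x)}"

text \<open>The operator-norm distance; the guard only makes it nonnegative everywhere, as the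
  library locale for metric spaces requires.\<close>

definition subspace_dual_dist :: "'a::real_normed_vector set \<Rightarrow> ('a \<Rightarrow> real) \<Rightarrow> ('a \<Rightarrow> real) \<Rightarrow> real" where
  "subspace_dual_dist Y g h =
     (if g \<in> subspace_dual Y \<and> h \<in> subspace_dual Y
      then (SUP y \<in> Y \<inter> cball 0 1. \<bar>g y - h y\<bar>) else 0)"

lemma subspace_dual_bdd:
  assumes "g \<in> subspace_dual Y" "h \<in> subspace_dual Y"
  shows "bdd_above ((\<lambda>y. \<bar>g y - h y\<bar>) ` (Y \<inter> cball 0 1))"
proof -
  obtain K L where K: "\<And>x. x \<in> Y \<Longrightarrow> \<bar>g x\<bar> \<le> K * norm x"
    and L: "\<And>x. x \<in> Y \<Longrightarrow> \<bar>h x\<bar> \<le> L * norm x"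
    using assms unfolding subspace_dual_def by blast
  have "\<bar>g y - h y\<bar> \<le> \<bar>K\<bar> + \<bar>L\<bar>" if "y \<in> Y" "norm y \<le> 1" for y
  proof -
    have "K * norm y \<le> \<bar>K\<bar> * 1" "L * norm y \<le> \<bar>L\<bar> * 1"
      using that by (intro mult_mono; simp)+
    then show ?thesis using K[OF that(1)] L[OF that(1)] by linarith
  qed
  then show ?thesis by (intro bdd_aboveI2[where M = "\<bar>K\<bar> + \<bar>L\<bar>"]) auto
qed

lemma subspace_dual_Metric_space:
  assumes "subspace Y"
  shows "Metric_space (subspace_dual Y) (subspace_dual_dist Y)"
proof
  have 0: "0 \<in> Y" using assms by (simp add: subspace_0)
  then have ne: "Y \<inter> cball 0 1 \<noteq> {}" by force
  show "subspace_dual_dist Y g h = subspace_dual_dist Y h g" for g h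
    by (auto simp: subspace_dual_dist_def abs_minus_commute)
  fix g h assume g: "g \<in> subspace_dual Y" and h: "h \<in> subspace_dual Y"
  have le: "\<bar>g y - h y\<bar> \<le> subspace_dual_dist Y g h"
    if "y \<in> Y" "norm y \<le> 1" "g \<in> subspace_dual Y" "h \<in> subspace_dual Y" for y g h
    unfolding subspace_dual_dist_def using that subspace_dual_bdd[of g Y h]
    by (simp, intro cSUP_upper) auto
  show "subspace_dual_dist Y g h = 0 \<longleftrightarrow> g = h"
  proof
    assume eq: "subspace_dual_dist Y g h = 0"
    show "g = h"
    proof
      fix x
      show "g x = h x"
      proof (cases "x \<in> Y")
        case False
        then show ?thesis using g h by (simp add: subspace_dual_def extensional_def)
      next
        case True
        define y where "y = inverse (norm x) *\<^sub>R x"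
        have y: "y \<in> Y" "norm y \<le> 1" and x: "x = norm x *\<^sub>R y"
          using True assms by (cases "x = 0"; auto simp: y_def subspace_scale)+
        have "g y = h y" using le[OF y g h] eq by simp
        moreover have "g (norm x *\<^sub>R y) = norm x * g y" "h (norm x *\<^sub>R y) = norm x * h y"
          using g h y unfolding subspace_dual_def by blast+
        ultimately show ?thesis using x by metis
      qed
    qed
  next
    assume "g = h"
    then show "subspace_dual_dist Y g h = 0"
      using ne h by (simp add: subspace_dual_dist_def)
  qed
  fix k assume k: "k \<in> subspace_dual Y"
  show "subspace_dual_dist Y g k \<le> subspace_dual_dist Y g h + subspace_dual_dist Y h k"
  proof -
    have "(SUP y \<in> Y \<inter> cball 0 1. \<bar>g y - k y\<bar>) \<le> subspace_dual_dist Y g h + subspace_dual_dist Y h k"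
    proof (rule cSUP_least[OF ne])
    fix y assume "y \<in> Y \<inter> cball 0 1"
    then show "\<bar>g y - k y\<bar> \<le> subspace_dual_dist Y g h + subspace_dual_dist Y h k"
      using le[of y g h] le[of y h k] g h k by auto
    qed
    then show ?thesis using g k by (simp add: subspace_dual_dist_def[of Y g k])
  qed
next
  fix g h
  show "0 \<le> subspace_dual_dist Y g h"
  proof (cases "g \<in> subspace_dual Y \<and> h \<in> subspace_dual Y")
    case True
    have "0 \<in> Y" using assms by (simp add: subspace_0)
    then have "\<bar>g 0 - h 0\<bar> \<le> subspace_dual_dist Y g h"
      unfolding subspace_dual_dist_def using True subspace_dual_bdd[of g Y h]
      by (simp, intro cSUP_upper) auto
    then show ?thesis by linarith
  qed (auto simp: subspace_dual_dist_def)
qed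

definition asplund_space :: "'a::real_normed_vector itself \<Rightarrow> bool" where
  "asplund_space _ \<longleftrightarrow> (\<forall>Y :: 'a set. subspace Y \<and> separable_space (top_of_set Y) \<longrightarrow>
     separable_space (Metric_space.mtopology (subspace_dual Y) (subspace_dual_dist Y)))"

definition proper_fun :: "('a \<Rightarrow> ereal) \<Rightarrow> bool" where
  "proper_fun g \<longleftrightarrow> (\<forall>x. g x \<noteq> - \<infinity>) \<and> (\<exists>x. g x \<noteq> \<infinity>)"

text \<open>Meant for functions without the value \<open>-\<infinity>\<close>; note that \<open>0 * \<infinity> = 0\<close> in \<^typ>\<open>ereal\<close>, which is
  harmless here.\<close>

definition convex_fun :: "('a::real_vector \<Rightarrow> ereal) \<Rightarrow> bool" where
  "convex_fun g \<longleftrightarrow> (\<forall>x y. \<forall>u\<ge>0. \<forall>v\<ge>0. u + v = 1 \<longrightarrow>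
     g (u *\<^sub>R x + v *\<^sub>R y) \<le> ereal u * g x + ereal v * g y)"

definition lsc_fun :: "('a::topological_space \<Rightarrow> ereal) \<Rightarrow> bool" where
  "lsc_fun g \<longleftrightarrow> (\<forall>x. g x \<le> Liminf (at x) g)"

definition pointwise_sup :: "'i set \<Rightarrow> ('i \<Rightarrow> 'a \<Rightarrow> ereal) \<Rightarrow> 'a \<Rightarrow> ereal" where
  "pointwise_sup T f x = (SUP t\<in>T. f t x)"

definition effective_dom :: "('a \<Rightarrow> ereal) \<Rightarrow> 'a set" where
  "effective_dom g = {x. g x < \<infinity>}"

definition subdifferential :: "('a::real_normed_vector \<Rightarrow> ereal) \<Rightarrow> 'a \<Rightarrow> 'a dual set" where
  "subdifferential g x =
     (if \<bar>g x\<bar> \<noteq> \<infinity> then {xs. \<forall>y. ereal (blinfun_apply xs (y - x)) \<le> g y - g x} else {})"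

definition normal_cone_dom :: "('a::real_normed_vector \<Rightarrow> ereal) \<Rightarrow> 'a \<Rightarrow> 'a dual set" where
  "normal_cone_dom g x = {xs. \<forall>y \<in> effective_dom g. blinfun_apply xs (y - x) \<le> 0}"

text \<open>Nets are represented by filters on the space of triples \<open>(\<lambda>, y, y\<^sup>*)\<close>: a net enters only
  through its filter of tails. The lemma \<open>subgrad_compact_at_iff_nets\<close> below gives the formulation
  with nets over directed sets, and \<open>subgrad_compact_atD\<close> allows directed sets of any type.\<close>

definition subgrad_compact_at :: "('a::real_normed_vector \<Rightarrow> ereal) \<Rightarrow> 'a \<Rightarrow> bool" where
  "subgrad_compact_at g x \<longleftrightarrow> (\<forall>F :: (real \<times> 'a \<times> 'a dual) filter.
     (\<forall>\<^sub>F (l, y, ys) in F. 0 \<le> l \<and> ys \<in> subdifferential g y) \<longrightarrow>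
     ((\<lambda>(l, y, ys). l) \<longlongrightarrow> 0) F \<longrightarrow>
     ((\<lambda>(l, y, ys). y) \<longlongrightarrow> x) F \<longrightarrow>
     ((\<lambda>(l, y, ys). g y) \<longlongrightarrow> g x) F \<longrightarrow>
     limitin weak_star (\<lambda>(l, y, ys). l *\<^sub>R ys) 0 F \<longrightarrow>
     ((\<lambda>(l, y, ys). norm (l *\<^sub>R ys)) \<longlongrightarrow> 0) F)"

definition directed_by :: "'j set \<Rightarrow> ('j \<Rightarrow> 'j \<Rightarrow> bool) \<Rightarrow> bool" where
  "directed_by J le \<longleftrightarrow> J \<noteq> {} \<and> (\<forall>i\<in>J. le i i) \<and>
     (\<forall>i\<in>J. \<forall>j\<in>J. \<forall>k\<in>J. le i j \<longrightarrow> le j k \<longrightarrow> le i k) \<and>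
     (\<forall>i\<in>J. \<forall>j\<in>J. \<exists>k\<in>J. le i k \<and> le j k)"

definition tails :: "'j set \<Rightarrow> ('j \<Rightarrow> 'j \<Rightarrow> bool) \<Rightarrow> 'j filter" where
  "tails J le = (INF i\<in>J. principal {j\<in>J. le i j})"

lemma eventually_tails:
  assumes "directed_by J le"
  shows "eventually P (tails J le) \<longleftrightarrow> (\<exists>i\<in>J. \<forall>j\<in>J. le i j \<longrightarrow> P j)"
  unfolding tails_def
proof (subst eventually_INF_base)
  show "J \<noteq> {}" using assms by (simp add: directed_by_def)
  show "\<exists>k\<in>J. principal {j\<in>J. le k j} \<le> inf (principal {j\<in>J. le a j}) (principal {j\<in>J. le b j})"
    if ab: "a \<in> J" "b \<in> J" for a b
  proof -
    obtain k where k: "k \<in> J" "le a k" "le b k"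
      using assms ab unfolding directed_by_def by blast
    then have "{j\<in>J. le k j} \<subseteq> {j\<in>J. le a j} \<inter> {j\<in>J. le b j}"
      using assms ab unfolding directed_by_def by blast
    then show ?thesis using k(1) by auto
  qed
qed (auto simp: eventually_principal)

lemma subgrad_compact_atD:
  assumes "subgrad_compact_at g x" "directed_by J le"
    and "\<And>j. j \<in> J \<Longrightarrow> 0 \<le> l j \<and> ys j \<in> subdifferential g (y j)"
    and "(l \<longlongrightarrow> 0) (tails J le)" "(y \<longlongrightarrow> x) (tails J le)"
    and "((\<lambda>j. g (y j)) \<longlongrightarrow> g x) (tails J le)"
    and "limitin weak_star (\<lambda>j. l j *\<^sub>R ys j) 0 (tails J le)"
  shows "((\<lambda>j. norm (l j *\<^sub>R ys j)) \<longlongrightarrow> 0) (tails J le)"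
proof -
  define F where "F = filtermap (\<lambda>j. (l j, y j, ys j)) (tails J le)"
  have "\<forall>\<^sub>F j in tails J le. 0 \<le> l j \<and> ys j \<in> subdifferential g (y j)"
    unfolding eventually_tails[OF assms(2)] using assms(2,3) unfolding directed_by_def by blast
  then have "((\<lambda>(l, y, ys). norm (l *\<^sub>R ys)) \<longlongrightarrow> 0) F"
    using assms(4-7)
    by (intro assms(1)[unfolded subgrad_compact_at_def, rule_format, of F])
      (auto simp: F_def eventually_filtermap filterlim_filtermap limitin_def)
  then show ?thesis by (simp add: F_def filterlim_filtermap)
qed

lemma subgrad_compact_at_iff_nets:
  fixes g :: "'a::real_normed_vector \<Rightarrow> ereal" and x :: 'a
  defines "net_cond \<equiv> (\<lambda>J le l y ys. directed_by J le \<longrightarrow>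
    (\<forall>j\<in>J. 0 \<le> l j \<and> ys j \<in> subdifferential g (y j)) \<longrightarrow>
    (l \<longlongrightarrow> 0) (tails J le) \<longrightarrow> (y \<longlongrightarrow> x) (tails J le) \<longrightarrow>
    ((\<lambda>j. g (y j)) \<longlongrightarrow> g x) (tails J le) \<longrightarrow>
    limitin weak_star (\<lambda>j. l j *\<^sub>R ys j) 0 (tails J le) \<longrightarrow>
    ((\<lambda>j. norm (l j *\<^sub>R ys j)) \<longlongrightarrow> 0) (tails J le))"
  shows "subgrad_compact_at g x \<longleftrightarrow>
    (\<forall>(J :: ((real \<times> 'a \<times> 'a dual) set \<times> (real \<times> 'a \<times> 'a dual)) set) le l y ys.
       net_cond J le l y ys)"
proof
  assume "subgrad_compact_at g x"
  then show "\<forall>(J :: ((real \<times> 'a \<times> 'a dual) set \<times> (real \<times> 'a \<times> 'a dual)) set) le l y ys.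
       net_cond J le l y ys"
    unfolding net_cond_def by (intro allI impI, rule subgrad_compact_atD) auto
next
  assume nets: "\<forall>(J :: ((real \<times> 'a \<times> 'a dual) set \<times> (real \<times> 'a \<times> 'a dual)) set) le l y ys.
       net_cond J le l y ys"
  show "subgrad_compact_at g x"
    unfolding subgrad_compact_at_def
  proof (intro allI impI)
    fix F :: "(real \<times> 'a \<times> 'a dual) filter"
    assume ev: "\<forall>\<^sub>F (l, y, ys) in F. 0 \<le> l \<and> ys \<in> subdifferential g y"
      and conv: "((\<lambda>(l, y, ys). l) \<longlongrightarrow> 0) F" "((\<lambda>(l, y, ys). y) \<longlongrightarrow> x) F"
        "((\<lambda>(l, y, ys). g y) \<longlongrightarrow> g x) F" "limitin weak_star (\<lambda>(l, y, ys). l *\<^sub>R ys) 0 F"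
    show "((\<lambda>(l, y, ys). norm (l *\<^sub>R ys)) \<longlongrightarrow> 0) F"
    proof (cases "F = bot")
      case False
      define S :: "(real \<times> 'a \<times> 'a dual) set" where "S = {(l, y, ys). 0 \<le> l \<and> ys \<in> subdifferential g y}"
      have evS: "\<forall>\<^sub>F p in F. p \<in> S" using ev by (simp add: S_def case_prod_unfold)
      define J :: "((real \<times> 'a \<times> 'a dual) set \<times> (real \<times> 'a \<times> 'a dual)) set"
        where "J = {(A, p). A \<subseteq> S \<and> p \<in> A \<and> (\<forall>\<^sub>F q in F. q \<in> A)}"
      define le where "le = (\<lambda>(i :: (real \<times> 'a \<times> 'a dual) set \<times> (real \<times> 'a \<times> 'a dual)) (j :: (real \<times> 'a \<times> 'a dual) set \<times> (real \<times> 'a \<times> 'a dual)).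
        fst j \<subseteq> fst i)"
      have ne: "\<exists>p. p \<in> A" if "\<forall>\<^sub>F q in F. q \<in> A" for A
        using eventually_happens'[OF False that] .
      have dir: "directed_by J le"
        unfolding directed_by_def
      proof (intro conjI)
        show "J \<noteq> {}" using ne[OF evS] evS by (auto simp: J_def)
        show "\<forall>i\<in>J. \<forall>j\<in>J. \<exists>k\<in>J. le i k \<and> le j k"
        proof (intro ballI)
          fix i j assume ij: "i \<in> J" "j \<in> J"
          then have ev: "\<forall>\<^sub>F q in F. q \<in> fst i \<inter> fst j"
            by (auto simp: J_def eventually_conj_iff)
          obtain p where "p \<in> fst i \<inter> fst j" using ne[OF ev] by blast
          then show "\<exists>k\<in>J. le i k \<and> le j k"
            using ev ij by (intro bexI[of _ "(fst i \<inter> fst j, p)"]) (auto simp: J_def le_def)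
        qed
      qed (auto simp: le_def)
      have tl: "filtermap snd (tails J le) = F"
      proof (rule filter_eqI)
        fix P :: "real \<times> 'a \<times> 'a dual \<Rightarrow> bool"
        show "eventually P (filtermap snd (tails J le)) = eventually P F"
          unfolding eventually_filtermap eventually_tails[OF dir]
        proof
          assume "\<exists>i\<in>J. \<forall>j\<in>J. le i j \<longrightarrow> P (snd j)"
          then obtain i where i: "i \<in> J" "\<And>j. j \<in> J \<Longrightarrow> le i j \<Longrightarrow> P (snd j)" by blast
          have "P q" if "q \<in> fst i" for q
            using i(2)[of "(fst i, q)"] i(1) that by (auto simp: J_def le_def)
          moreover have "\<forall>\<^sub>F q in F. q \<in> fst i" using i(1) by (auto simp: J_def)
          ultimately show "eventually P F" by (auto elim: eventually_mono)
        next
          assume "eventually P F"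
          then have ev: "\<forall>\<^sub>F q in F. q \<in> {q \<in> S. P q}" using evS by (simp add: eventually_conj_iff)
          obtain p where "p \<in> {q \<in> S. P q}" using ne[OF ev] by blast
          then show "\<exists>i\<in>J. \<forall>j\<in>J. le i j \<longrightarrow> P (snd j)"
            using ev by (intro bexI[of _ "({q \<in> S. P q}, p)"]) (auto simp: J_def le_def)
        qed
      qed
      have lim: "(h \<longlongrightarrow> c) F \<longleftrightarrow> ((\<lambda>j. h (snd j)) \<longlongrightarrow> c) (tails J le)"
        for h :: "real \<times> 'a \<times> 'a dual \<Rightarrow> 'b::topological_space" and c
        by (subst tl[symmetric]) (simp add: filterlim_filtermap)
      have limw: "limitin weak_star h c F \<longleftrightarrow> limitin weak_star (\<lambda>j. h (snd j)) c (tails J le)"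
        for h :: "real \<times> 'a \<times> 'a dual \<Rightarrow> 'a dual" and c
        by (subst tl[symmetric]) (simp add: limitin_def eventually_filtermap)
      have "\<forall>j\<in>J. 0 \<le> fst (snd j) \<and> snd (snd (snd j)) \<in> subdifferential g (fst (snd (snd j)))"
        by (auto simp: J_def S_def)
      then show ?thesis
        using conv dir nets[unfolded net_cond_def, rule_format, of J le "\<lambda>j. fst (snd j)"
            "\<lambda>j. snd (snd (snd j))" "\<lambda>j. fst (snd (snd j))"]
        unfolding lim limw case_prod_unfold by blast
    qed simp
  qed
qed

text \<open>The sum of the normal cones is a Minkowski sum of sets. If \<open>F1\<close> is empty then so is
  the convex hull, and the member contributes nothing.\<close>

definition approx_subdiff ::
    "'i set \<Rightarrow> ('i \<Rightarrow> 'a::real_normed_vector \<Rightarrow> ereal) \<Rightarrow> 'a \<Rightarrow> real \<Rightarrow> 'a dual set" where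
  "approx_subdiff T f xbar \<epsilon> =
     \<Union> {convex hull (\<Union>t\<in>F1. subdifferential (f t) x') + (\<Sum>t\<in>F2. normal_cone_dom (f t) x') | F1 F2 x'.
        finite F1 \<and> F1 \<subseteq> T \<and> finite F2 \<and> F2 \<subseteq> T \<and> x' \<in> cball xbar \<epsilon> \<and>
        (\<forall>t\<in>F1. \<bar>f t x' - pointwise_sup T f xbar\<bar> \<le> ereal \<epsilon> \<and>
                 f t x' = Max ((\<lambda>s. f s x') ` (F1 \<union> F2)))}"

end

theory Submission
  imports Defs
begin

text \<open>Let \<open>v\<close> be a subgradient of the supremum at \<open>xbar\<close>. On a compact piece of a
  finite-dimensional subspace the supremum can be replaced, up to a small error, by the maximum of
  finitely many \<open>f t\<close>; penalizing the distance to that piece and applying Ekeland's principle gives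
  an exact subgradient \<open>u\<close> of this finite maximum at a nearby point, with \<open>u\<close> weak* close to \<open>v\<close>.
  At that point the maximum rule is exact: give every function its own copy of the variable,
  penalize the distance between the copies, and apply Ekeland's principle to a smooth surrogate of
  the maximum. Its derivatives are positive multipliers, so only genuine subgradients occur.
  The resulting dual vectors are bounded and their sum tends to 0 in norm, while either a multiplier
  or a dual vector stays away from 0. Along a filter on which everything converges
  weak* the limits give the decomposition, unless all multipliers vanish; in that case the
  qualification condition makes all weak* limits 0, compactness of all but one function and the
  smallness of the sum turn this into norm convergence to 0, a contradiction.
  For the converse inclusion, subgradients near
  a fixed functional are bounded in norm when the supremum is continuous somewhere or the space is
  finite-dimensional.\<close>

section \<open>The Hahn-Banach theorem\<close>

text \<open>Functions are treated as pairs of a domain \<open>D t\<close> and a real-valued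
  \<open>g t\<close> with closed sublevel sets; points off the domain stand for the value infinity.
  Both penalizations are instances of \<open>coupled_almost_minimizer\<close>, but they pull in
  different directions. In the first, the penalty factor has to outweigh the loss from dropping all
  but finitely many functions and is not controlled. Hence the subgradient \<open>u\<close> need not
  be near \<open>v\<close> in norm: the dual vector contributed by the compact piece may be large
  and only vanishes on the finite set \<open>E\<close> of test directions. This is why the result is
  a weak* closure. In the second, the factor is 1 and serves as a normalization: what is not gained
  from a multiplier must be paid by a dual vector. The surrogate for the maximum is a sum of
  smoothed positive parts, recentred at the value of each function at the base point. Without
  recentring, the values of inactive functions at the new points would not converge to the value at
  the base point, and the compactness hypothesis could not be applied to them.\<close>

definition sublinear :: "('a::real_vector \<Rightarrow> real) \<Rightarrow> bool" where
  "sublinear q \<longleftrightarrow> (\<forall>x y. q (x + y) \<le> q x + q y) \<and> (\<forall>c\<ge>0. \<forall>x. q (c *\<^sub>R x) = c * q x)"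

lemma sublinearD:
  assumes "sublinear q"
  shows "q (x + y) \<le> q x + q y" "0 \<le> c \<Longrightarrow> q (c *\<^sub>R x) = c * q x" "q 0 = 0" "- q (- x) \<le> q x"
proof -
  show add: "q (x + y) \<le> q x + q y" for x y using assms unfolding sublinear_def by blast
  show hom: "q (c *\<^sub>R x) = c * q x" if "0 \<le> c" for c x using assms that unfolding sublinear_def by blast
  show "q 0 = 0" using hom[of 0 0] by simp
  then show "- q (- x) \<le> q x" using add[of x "- x"] by simp
qed

text \<open>Zorn's lemma for the reversed pointwise order. A chain has a finite pointwise infimum
  because every sublinear \<open>g \<le> q\<close> satisfies \<open>- q (- x) \<le> g x\<close>; the
  infimum stays subadditive because of two members of a chain one lies below the other.\<close>

lemma sublinear_minimal:
  fixes q :: "'a::real_vector \<Rightarrow> real"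
  assumes "sublinear q"
  obtains m where "sublinear m" "m \<le> q" "\<And>g. sublinear g \<Longrightarrow> g \<le> m \<Longrightarrow> g = m"
proof -
  define A where "A = {g. sublinear g \<and> g \<le> q}"
  have "\<exists>m\<in>A. \<forall>a\<in>A. m \<ge> a \<longrightarrow> a = m"
  proof (rule predicate_Zorn)
    show "partial_order_on A (relation_of (\<lambda>f g. g \<le> f) A)"
      by (rule partial_order_on_relation_ofI) auto
    fix C assume "C \<in> Chains (relation_of (\<lambda>f g. g \<le> f) A)"
    then have CA: "C \<subseteq> A" and ch: "\<And>f g. f \<in> C \<Longrightarrow> g \<in> C \<Longrightarrow> f \<le> g \<or> g \<le> f"
      unfolding Chains_def relation_of_def by auto
    show "\<exists>u\<in>A. \<forall>a\<in>C. u \<le> a"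
    proof (cases "C = {}")
      case True
      then show ?thesis using assms by (auto simp: A_def)
    next
      case False
      define u where "u x = (INF g\<in>C. g x)" for x
      have lower: "- q (- x) \<le> g x" if "g \<in> C" for g x
      proof -
        have "sublinear g" "g (- x) \<le> q (- x)" using that CA by (auto simp: A_def le_fun_def)
        then show ?thesis using sublinearD(4)[of g x] by linarith
      qed
      have bdd: "bdd_below ((\<lambda>g. g x) ` C)" for x
        by (rule bdd_belowI2[of _ "- q (- x)"]) (rule lower)
      have le: "u x \<le> g x" if "g \<in> C" for g x
        unfolding u_def using bdd that by (rule cINF_lower)
      have "sublinear u"
        unfolding sublinear_def
      proof (intro conjI allI impI)
        fix x y
        have "u (x + y) \<le> g x + h y" if gh: "g \<in> C" "h \<in> C" for g h
        proof -
          obtain k where k: "k \<in> C" "k \<le> g" "k \<le> h" using ch[OF gh] gh by blast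
          have "u (x + y) \<le> k (x + y)" using le k by blast
          also have "\<dots> \<le> k x + k y" using k(1) CA sublinearD(1) by (auto simp: A_def)
          also have "\<dots> \<le> g x + h y" using k(2,3) by (intro add_mono) (auto simp: le_fun_def)
          finally show ?thesis .
        qed
        then have "u (x + y) - h y \<le> u x" if "h \<in> C" for h
          unfolding u_def[of x] using False that by (intro cINF_greatest) (auto simp: algebra_simps)
        then have "u (x + y) - u x \<le> u y"
          unfolding u_def[of y] using False by (intro cINF_greatest) (auto simp: algebra_simps)
        then show "u (x + y) \<le> u x + u y" by simp
      next
        fix c :: real and x assume c: "0 \<le> c"
        show "u (c *\<^sub>R x) = c * u x"
        proof (cases "c = 0")
          case True
          have "g 0 = 0" if "g \<in> C" for g using that CA sublinearD(3) by (auto simp: A_def)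
          then have "u 0 = (INF g\<in>C. 0)" unfolding u_def by (intro INF_cong) auto
          then show ?thesis using True False by simp
        next
          case pos: False
          have hom: "g (c *\<^sub>R x) = c * g x" if "g \<in> C" for g
            using that CA sublinearD(2) c by (auto simp: A_def)
          have "u (c *\<^sub>R x) \<le> c * g x" if "g \<in> C" for g
            using le[OF that, of "c *\<^sub>R x"] hom[OF that] by simp
          then have "u (c *\<^sub>R x) / c \<le> u x"
            unfolding u_def[of x] using False c pos by (intro cINF_greatest) (auto simp: field_simps)
          moreover have "c * u x \<le> u (c *\<^sub>R x)"
            unfolding u_def[of "c *\<^sub>R x"]
          proof (rule cINF_greatest[OF False])
            fix g assume g: "g \<in> C"
            show "c * u x \<le> g (c *\<^sub>R x)" using le[OF g, of x] hom[OF g] c by (simp add: mult_left_mono)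
          qed
          ultimately show ?thesis using c pos by (simp add: field_simps)
        qed
      qed
      moreover have "u \<le> q"
      proof (rule le_funI)
        fix x
        obtain g where "g \<in> C" using False by blast
        then have "u x \<le> g x" "g x \<le> q x" using le CA by (auto simp: A_def le_fun_def)
        then show "u x \<le> q x" by simp
      qed
      ultimately have "u \<in> A" by (simp add: A_def)
      moreover have "\<forall>a\<in>C. u \<le> a" using le by (auto simp: le_fun_def)
      ultimately show ?thesis by blast
    qed
  qed
  then obtain m where "m \<in> A" "\<And>a. a \<in> A \<Longrightarrow> a \<le> m \<Longrightarrow> a = m" by blast
  then show thesis using that[of m] by (auto simp: A_def)
qed

text \<open>For fixed \<open>y\<close>, the infimum over \<open>t \<ge> 0\<close> of
  \<open>m (x + t *\<^sub>R y) - t * m y\<close> is sublinear in \<open>x\<close> and, by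
  \<open>t = 0\<close>, below \<open>m\<close>. Minimality makes it equal to \<open>m\<close>, and
  \<open>t = 1\<close> then gives superadditivity.\<close>

lemma sublinear_minimal_imp_linear:
  fixes m :: "'a::real_vector \<Rightarrow> real"
  assumes sub: "sublinear m" and min: "\<And>g. sublinear g \<Longrightarrow> g \<le> m \<Longrightarrow> g = m"
  shows "linear m"
proof -
  have super: "m x + m y \<le> m (x + y)" for x y
  proof -
    define g where "g x = (INF t\<in>{0..}. m (x + t *\<^sub>R y) - t * m y)" for x
    have lower: "- m (- x) \<le> m (x + t *\<^sub>R y) - t * m y" if "0 \<le> t" for x t
      using sublinearD(1)[OF sub, of "x + t *\<^sub>R y" "- x"] sublinearD(2)[OF sub that, of y] by simp
    have bdd: "bdd_below ((\<lambda>t. m (x + t *\<^sub>R y) - t * m y) ` {0..})" for x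
      by (rule bdd_belowI2[of _ "- m (- x)"]) (use lower in auto)
    have le: "g x \<le> m (x + t *\<^sub>R y) - t * m y" if "0 \<le> t" for x t
      unfolding g_def using bdd that by (intro cINF_lower) auto
    have "sublinear g"
      unfolding sublinear_def
    proof (intro conjI allI impI)
      fix a b
      have "g (a + b) \<le> (m (a + s *\<^sub>R y) - s * m y) + (m (b + t *\<^sub>R y) - t * m y)"
        if "0 \<le> s" "0 \<le> t" for s t
        using le[of "s + t" "a + b"] that sublinearD(1)[OF sub, of "a + s *\<^sub>R y" "b + t *\<^sub>R y"]
        by (simp add: algebra_simps)
      then have "g (a + b) - (m (b + t *\<^sub>R y) - t * m y) \<le> g a" if "0 \<le> t" for t
        unfolding g_def[of a] using that by (intro cINF_greatest) (auto simp: algebra_simps)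
      then have "g (a + b) - g a \<le> g b"
        unfolding g_def[of b] by (intro cINF_greatest) (auto simp: algebra_simps)
      then show "g (a + b) \<le> g a + g b" by simp
    next
      fix c :: real and x assume c: "0 \<le> c"
      show "g (c *\<^sub>R x) = c * g x"
      proof (cases "c = 0")
        case True
        have "m (t *\<^sub>R y) - t * m y = 0" if "0 \<le> t" for t
          using sublinearD(2)[OF sub that] by simp
        then have "g 0 = (INF t\<in>{0::real..}. 0)" unfolding g_def by (intro INF_cong) auto
        then show ?thesis using True by simp
      next
        case False
        have "g (c *\<^sub>R x) \<le> c * (m (x + t *\<^sub>R y) - t * m y)" if "0 \<le> t" for t
          using le[of "c * t" "c *\<^sub>R x"] sublinearD(2)[OF sub c, of "x + t *\<^sub>R y"] that c
          by (simp add: algebra_simps)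
        then have "g (c *\<^sub>R x) / c \<le> g x"
          unfolding g_def[of x] using c False by (intro cINF_greatest) (auto simp: field_simps)
        moreover have "c * g x \<le> g (c *\<^sub>R x)"
          unfolding g_def[of "c *\<^sub>R x"]
        proof (rule cINF_greatest)
          fix t :: real assume "t \<in> {0..}"
          then have "c * g x \<le> c * (m (x + (t / c) *\<^sub>R y) - t / c * m y)"
            using c by (intro mult_left_mono le) auto
          also have "\<dots> = m (c *\<^sub>R x + t *\<^sub>R y) - t * m y"
            using sublinearD(2)[OF sub c, of "x + (t / c) *\<^sub>R y"] False by (simp add: algebra_simps)
          finally show "c * g x \<le> m (c *\<^sub>R x + t *\<^sub>R y) - t * m y" .
        qed simp
        ultimately show ?thesis using c False by (simp add: field_simps)
      qed
    qed
    moreover have "g \<le> m" using le[of 0] by (auto intro: le_funI)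
    ultimately have "g = m" by (rule min)
    then show ?thesis using le[of 1 x] by simp
  qed
  have add: "m (x + y) = m x + m y" for x y
    using super sublinearD(1)[OF sub] by (auto intro: antisym)
  have neg: "m (- x) = - m x" for x
    using add[of x "- x"] sublinearD(3)[OF sub] by simp
  show ?thesis
  proof (rule linearI)
    show "m (c *\<^sub>R x) = c *\<^sub>R m x" for c x
    proof (cases "0 \<le> c")
      case True
      then show ?thesis using sublinearD(2)[OF sub] by simp
    next
      case False
      then show ?thesis using sublinearD(2)[OF sub, of "- c" x] neg[of "c *\<^sub>R x"] by simp
    qed
  qed (rule add)
qed

lemma sublinear_dominates_linear:
  fixes q :: "'a::real_vector \<Rightarrow> real"
  assumes "sublinear q"
  obtains p where "linear p" "\<And>x. p x \<le> q x"
proof -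
  obtain m where "sublinear m" "m \<le> q" "\<And>g. sublinear g \<Longrightarrow> g \<le> m \<Longrightarrow> g = m"
    using sublinear_minimal[OF assms] by blast
  then show thesis using that[of m] sublinear_minimal_imp_linear[of m] by (auto simp: le_fun_def)
qed

lemma blinfun_of_linear:
  fixes p :: "'a::real_normed_vector \<Rightarrow> real"
  assumes "linear p" "\<And>x. p x \<le> C * norm x"
  obtains P :: "'a dual" where "\<And>x. blinfun_apply P x = p x"
proof -
  have "\<bar>p x\<bar> \<le> norm x * C" for x
    using assms(2)[of x] assms(2)[of "- x"] linear_neg[OF assms(1), of x] by (simp add: mult.commute)
  then have "bounded_linear p"
    using assms(1) linear_iff by (intro bounded_linear_intro[where K = C]) (auto simp: linear_add linear_scale)
  then show thesis using that[of "Blinfun p"] by (simp add: bounded_linear_Blinfun_apply)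
qed

text \<open>A Hahn-Banach sandwich for a convex set of points with heights. The bound by
  \<open>C * norm\<close> yields a bounded functional without any interior point of
  \<open>M\<close>.\<close>

lemma convex_minorant_linear:
  fixes M :: "('a::real_normed_vector \<times> real) set"
  assumes conv: "convex M" and C: "0 \<le> C"
    and lower: "\<And>h r. (h, r) \<in> M \<Longrightarrow> - C * norm h \<le> r"
  obtains P :: "'a dual" where "\<And>h r. (h, r) \<in> M \<Longrightarrow> P h \<le> r" "\<And>h. P h \<le> C * norm h"
proof -
  \<comment> \<open>\<open>q\<close> will be the infimal convolution of the cone generated by
    \<open>M\<close> with \<open>C * norm\<close>. The factor \<open>s\<close> generates the cone;
    the alternative \<open>s = 0\<close> puts \<open>C * norm h\<close> into
    \<open>V h\<close>.\<close>
  define V where "V h = {s * r + C * norm (h - s *\<^sub>R k) | s k r. 0 \<le> s \<and> ((k, r) \<in> M \<or> s = 0)}" for h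
  define q where "q h = Inf (V h)" for h
  have lowV: "- C * norm h \<le> v" if vV: "v \<in> V h" for v h
  proof -
    obtain s k r where s: "0 \<le> s" "(k, r) \<in> M \<or> s = 0" and v: "v = s * r + C * norm (h - s *\<^sub>R k)"
      using vV unfolding V_def by blast
    have "- C * norm (s *\<^sub>R k) \<le> s * r"
      using s lower[of k r] mult_left_mono[of "- C * norm k" r s] by (auto simp: mult.left_commute)
    moreover have "C * norm (s *\<^sub>R k) \<le> C * norm h + C * norm (h - s *\<^sub>R k)"
      unfolding distrib_left[symmetric] using norm_triangle_sub[of "s *\<^sub>R k" h] C
      by (intro mult_left_mono) (auto simp: norm_minus_commute)
    ultimately show ?thesis using v by simp
  qed
  have bdd: "bdd_below (V h)" for h using lowV by (rule bdd_belowI)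
  have V0: "C * norm h \<in> V h" for h
    unfolding V_def mem_Collect_eq by (rule exI[of _ 0]) auto
  then have ne: "V h \<noteq> {}" for h by blast
  have qle: "q h \<le> v" if "v \<in> V h" for v h unfolding q_def using that bdd by (rule cInf_lower)
  have Vadd: "\<exists>w \<in> V (a + b). w \<le> v + v'" if "v \<in> V a" "v' \<in> V b" for v v' a b
  proof -
    obtain s k r where s: "0 \<le> s" "(k, r) \<in> M \<or> s = 0" and v: "v = s * r + C * norm (a - s *\<^sub>R k)"
      using \<open>v \<in> V a\<close> unfolding V_def by blast
    obtain s' k' r' where s': "0 \<le> s'" "(k', r') \<in> M \<or> s' = 0" and v': "v' = s' * r' + C * norm (b - s' *\<^sub>R k')"
      using \<open>v' \<in> V b\<close> unfolding V_def by blast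
    \<comment> \<open>For positive \<open>s\<close> and \<open>s'\<close>, the sum of the two scaled
      points is \<open>s + s'\<close> times their convex combination with weights
      \<open>s / (s + s')\<close> and \<open>s' / (s + s')\<close>.\<close>
    have "\<exists>K R. ((K, R) \<in> M \<or> s + s' = 0) \<and> (s + s') *\<^sub>R K = s *\<^sub>R k + s' *\<^sub>R k' \<and> (s + s') * R = s * r + s' * r'"
    proof (cases "s = 0 \<or> s' = 0")
      case True
      then show ?thesis
      proof
        assume "s = 0"
        then show ?thesis using s' by (intro exI[of _ k'] exI[of _ r']) auto
      next
        assume "s' = 0"
        then show ?thesis using s by (intro exI[of _ k] exI[of _ r]) auto
      qed
    next
      case False
      then have pos: "0 < s" "0 < s'" using s s' by auto
      define \<alpha> \<beta> where "\<alpha> = s / (s + s')" and "\<beta> = s' / (s + s')"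
      have ab: "(s + s') * \<alpha> = s" "(s + s') * \<beta> = s'" "0 \<le> \<alpha>" "0 \<le> \<beta>" "\<alpha> + \<beta> = 1"
        using pos by (auto simp: \<alpha>_def \<beta>_def add_divide_distrib[symmetric])
      have "\<alpha> *\<^sub>R (k, r) + \<beta> *\<^sub>R (k', r') \<in> M"
        using s s' pos ab by (intro convexD[OF conv]) auto
      then have "(\<alpha> *\<^sub>R k + \<beta> *\<^sub>R k', \<alpha> * r + \<beta> * r') \<in> M" by simp
      then show ?thesis
        by (intro exI[of _ "\<alpha> *\<^sub>R k + \<beta> *\<^sub>R k'"] exI[of _ "\<alpha> * r + \<beta> * r'"])
          (simp only: scaleR_add_right scaleR_scaleR distrib_left[of "s + s'"] mult.assoc[symmetric] ab simp_thms)
    qed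
    then obtain K R where KR: "(K, R) \<in> M \<or> s + s' = 0"
      "(s + s') *\<^sub>R K = s *\<^sub>R k + s' *\<^sub>R k'" "(s + s') * R = s * r + s' * r'" by blast
    have "(s + s') * R + C * norm (a + b - (s + s') *\<^sub>R K) \<in> V (a + b)"
      unfolding V_def mem_Collect_eq using KR(1) s s' by (intro exI[of _ "s + s'"]) auto
    moreover have "C * norm (a + b - (s + s') *\<^sub>R K) \<le> C * norm (a - s *\<^sub>R k) + C * norm (b - s' *\<^sub>R k')"
      unfolding KR(2) distrib_left[symmetric]
      using norm_triangle_ineq[of "a - s *\<^sub>R k" "b - s' *\<^sub>R k'"] C
      by (intro mult_left_mono) (auto simp: algebra_simps)
    ultimately show ?thesis using v v' KR(3) by (intro bexI[of _ "(s + s') * R + C * norm (a + b - (s + s') *\<^sub>R K)"]) auto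
  qed
  have Vscale: "c * v \<in> V (c *\<^sub>R a)" if "v \<in> V a" "0 < c" for c v a
  proof -
    obtain s k r where s: "0 \<le> s" "(k, r) \<in> M \<or> s = 0" and v: "v = s * r + C * norm (a - s *\<^sub>R k)"
      using \<open>v \<in> V a\<close> unfolding V_def by blast
    have "norm (c *\<^sub>R a - (c * s) *\<^sub>R k) = c * norm (a - s *\<^sub>R k)"
      using \<open>0 < c\<close> norm_scaleR[of c "a - s *\<^sub>R k"] by (simp add: scaleR_diff_right)
    then have "c * v = (c * s) * r + C * norm (c *\<^sub>R a - (c * s) *\<^sub>R k)"
      using v by (simp add: algebra_simps)
    then show ?thesis
      unfolding V_def mem_Collect_eq using s \<open>0 < c\<close> by (intro exI[of _ "c * s"] exI[of _ k] exI[of _ r]) auto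
  qed
  have "sublinear q"
    unfolding sublinear_def
  proof (intro conjI allI impI)
    fix a b
    have "q (a + b) \<le> v + v'" if "v \<in> V a" "v' \<in> V b" for v v'
      using Vadd[OF that] qle by force
    then have "q (a + b) - v' \<le> q a" if "v' \<in> V b" for v'
      unfolding q_def[of a] using ne that by (intro cInf_greatest) (auto simp: algebra_simps)
    then have "q (a + b) - q a \<le> q b"
      unfolding q_def[of b] using ne by (intro cInf_greatest) (auto simp: algebra_simps)
    then show "q (a + b) \<le> q a + q b" by simp
  next
    fix c :: real and a assume c: "0 \<le> c"
    have scale_le: "q (c *\<^sub>R a) \<le> c * q a" if c: "0 < c" for c a
    proof -
      have "q (c *\<^sub>R a) / c \<le> v" if "v \<in> V a" for v
        using qle[OF Vscale[OF that c]] c by (simp add: field_simps)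
      then have "q (c *\<^sub>R a) / c \<le> q a"
        unfolding q_def[of a] using ne by (intro cInf_greatest) auto
      then show ?thesis using c by (simp add: field_simps)
    qed
    show "q (c *\<^sub>R a) = c * q a"
    proof (cases "c = 0")
      case True
      have "q 0 \<le> 0" using qle[OF V0[of 0]] by simp
      moreover have "0 \<le> q 0" unfolding q_def using ne lowV[of _ 0] by (intro cInf_greatest) auto
      ultimately show ?thesis using True by simp
    next
      case False
      then have "q a \<le> inverse c * q (c *\<^sub>R a)" using scale_le[of "inverse c" "c *\<^sub>R a"] c by simp
      then show ?thesis using scale_le[of c a] False c by (simp add: field_simps)
    qed
  qed
  then obtain p where p: "linear p" "\<And>x. p x \<le> q x" using sublinear_dominates_linear by blast
  have bound: "p h \<le> C * norm h" for h using p(2)[of h] qle[OF V0[of h]] by linarith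
  obtain P :: "'a dual" where P: "\<And>x. P x = p x" using blinfun_of_linear[OF p(1) bound] by blast
  have "p h \<le> r" if "(h, r) \<in> M" for h r
  proof -
    have "1 * r + C * norm (h - 1 *\<^sub>R h) \<in> V h"
      unfolding V_def mem_Collect_eq using that by (intro exI[of _ 1] exI[of _ h] exI[of _ r]) auto
    from qle[OF this] show ?thesis using p(2)[of h] by simp
  qed
  then show thesis using that[of P] P bound by simp
qed

text \<open>\<open>K t\<close> plays the role of the epigraph of a convex function of the variable
  \<open>x t\<close>, and \<open>N\<close> couples the variables. Nonnegativity of the total
  survives when each epigraph is replaced by an affine minorant; Lipschitz continuity of
  \<open>N\<close> in each variable makes the slopes bounded.\<close>

lemma convex_sum_separation:
  fixes K :: "'i \<Rightarrow> ('a::real_normed_vector \<times> real) set" and N :: "('i \<Rightarrow> 'a) \<Rightarrow> real"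
  assumes fin: "finite F"
    and conv: "\<And>t. t \<in> F \<Longrightarrow> convex (K t)"
    and ne: "\<And>t. t \<in> F \<Longrightarrow> K t \<noteq> {}"
    and Nconv: "\<And>x y a b. 0 \<le> a \<Longrightarrow> 0 \<le> b \<Longrightarrow> a + b = 1 \<Longrightarrow> N (\<lambda>t. a *\<^sub>R x t + b *\<^sub>R y t) \<le> a * N x + b * N y"
    and C: "0 \<le> C" and Nlip: "\<And>x t h. t \<in> F \<Longrightarrow> N (x(t := h)) \<le> N x + C * norm (h - x t)"
    and nonneg: "\<And>x a. (\<And>t. t \<in> F \<Longrightarrow> (x t, a t) \<in> K t) \<Longrightarrow> 0 \<le> (\<Sum>t\<in>F. a t) + N x"
  obtains p :: "'i \<Rightarrow> 'a dual" and c :: "'i \<Rightarrow> real"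
  where "\<And>t x a. t \<in> F \<Longrightarrow> (x, a) \<in> K t \<Longrightarrow> p t x + c t \<le> a"
    and "\<And>x. 0 \<le> (\<Sum>t\<in>F. p t (x t) + c t) + N x"
proof -
  txt \<open>The coordinates are split off one at a time: \<open>p\<close> and \<open>c\<close> are known on \<open>S\<close>, and the
    constraints on \<open>F - S\<close> are still the original ones.\<close>
  have "\<exists>(p :: 'i \<Rightarrow> 'a dual) c. (\<forall>t\<in>S. \<forall>(x, a)\<in>K t. p t x + c t \<le> a) \<and>
      (\<forall>x a. (\<forall>t\<in>F - S. (x t, a t) \<in> K t) \<longrightarrow> 0 \<le> (\<Sum>t\<in>S. p t (x t) + c t) + (\<Sum>t\<in>F - S. a t) + N x)"
    if "finite S" "S \<subseteq> F" for S
    using that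
  proof (induction S)
    case empty
    then show ?case using nonneg by simp
  next
    case (insert j S)
    then have "S \<subseteq> F" by simp
    from insert.IH[OF this] obtain p :: "'i \<Rightarrow> 'a dual" and c
      where "\<forall>t\<in>S. \<forall>(x, a)\<in>K t. p t x + c t \<le> a"
        and "\<forall>x a. (\<forall>t\<in>F - S. (x t, a t) \<in> K t) \<longrightarrow>
          0 \<le> (\<Sum>t\<in>S. p t (x t) + c t) + (\<Sum>t\<in>F - S. a t) + N x" by blast
    then have pc: "\<And>t x a. t \<in> S \<Longrightarrow> (x, a) \<in> K t \<Longrightarrow> p t x + c t \<le> a"
      and IH: "\<And>x a. (\<And>t. t \<in> F - S \<Longrightarrow> (x t, a t) \<in> K t) \<Longrightarrow>
        0 \<le> (\<Sum>t\<in>S. p t (x t) + c t) + (\<Sum>t\<in>F - S. a t) + N x" by auto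
    define G where "G = F - insert j S"
    have FS: "F - S = insert j G" "j \<notin> G" "j \<notin> S" "finite G" "j \<in> F"
      using insert.hyps insert.prems fin by (auto simp: G_def)
    \<comment> \<open>\<open>R x a\<close> is the objective without the term of \<open>j\<close>.
      \<open>Q\<close> is, up to attainment, the epigraph of its infimum over the other variables,
      as a function of \<open>x j\<close> alone.\<close>
    define R where "R x a = (\<Sum>t\<in>S. p t (x t) + c t) + (\<Sum>t\<in>G. a t) + N x" for x and a :: "'i \<Rightarrow> real"
    define Q where "Q = {(x j, R x a + e) | x a e. 0 \<le> e \<and> (\<forall>t\<in>G. (x t, a t) \<in> K t)}"
    have "convex Q"
    proof (rule convexI)
      fix q1 q2 :: "'a \<times> real" and u v :: real
      assume "q1 \<in> Q" "q2 \<in> Q" and uv: "0 \<le> u" "0 \<le> v" "u + v = 1"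
      then obtain x a e y b d where q1: "q1 = (x j, R x a + e)" "0 \<le> e" "\<forall>t\<in>G. (x t, a t) \<in> K t"
        and q2: "q2 = (y j, R y b + d)" "0 \<le> d" "\<forall>t\<in>G. (y t, b t) \<in> K t"
        unfolding Q_def by blast
      define z where "z = (\<lambda>t. u *\<^sub>R x t + v *\<^sub>R y t)"
      define w where "w = (\<lambda>t. u * a t + v * b t)"
      have "(z t, w t) \<in> K t" if "t \<in> G" for t
        using convexD[OF conv, of t "(x t, a t)" "(y t, b t)" u v] q1(3) q2(3) uv that
        by (auto simp: z_def w_def G_def)
      moreover have "R z w \<le> u * R x a + v * R y b"
      proof -
        have c: "u * c t + v * c t = c t" for t using uv(3) by (metis distrib_right mult_1)
        have "(\<Sum>t\<in>S. p t (z t) + c t) = (\<Sum>t\<in>S. u * (p t (x t) + c t) + v * (p t (y t) + c t))"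
          unfolding distrib_left z_def blinfun.add_right blinfun.scaleR_right real_scaleR_def
        proof (rule sum.cong)
          fix t
          show "u * p t (x t) + v * p t (y t) + c t = u * p t (x t) + u * c t + (v * p t (y t) + v * c t)"
            using c[of t] by linarith
        qed simp
        then have "(\<Sum>t\<in>S. p t (z t) + c t) = u * (\<Sum>t\<in>S. p t (x t) + c t) + v * (\<Sum>t\<in>S. p t (y t) + c t)"
          by (simp only: sum.distrib[symmetric] sum_distrib_left)
        moreover have "(\<Sum>t\<in>G. w t) = u * (\<Sum>t\<in>G. a t) + v * (\<Sum>t\<in>G. b t)"
          by (simp add: w_def sum.distrib sum_distrib_left)
        moreover have "N z \<le> u * N x + v * N y" unfolding z_def by (rule Nconv[OF uv])
        ultimately show ?thesis unfolding R_def distrib_left by linarith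
      qed
      moreover have "0 \<le> u * e" "0 \<le> v * d" using uv q1(2) q2(2) by auto
      ultimately have "(z j, R z w + (u * R x a + v * R y b - R z w + u * e + v * d)) \<in> Q"
        unfolding Q_def mem_Collect_eq
        by (intro exI[of _ z] exI[of _ w] exI[of _ "u * R x a + v * R y b - R z w + u * e + v * d"]) simp
      then show "u *\<^sub>R q1 + v *\<^sub>R q2 \<in> Q" by (simp add: q1 q2 z_def distrib_left add_ac)
    qed
    \<comment> \<open>Differences of points of \<open>K j\<close> and \<open>Q\<close>, with heights
      added. Moving coordinate \<open>j\<close> from \<open>x j\<close> to \<open>x0\<close> changes
      \<open>N\<close> by at most \<open>C\<close> times the distance, so the induction hypothesis
      bounds the heights below by \<open>- C * norm h\<close>.\<close>
    define M where "M = (\<lambda>((x, a), (y, b)). (x - y, a + b)) ` (K j \<times> Q)"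
    have "linear (\<lambda>((x, a), (y, b)). (x - y :: 'a, a + b :: real))"
      by (rule linearI) (auto simp: algebra_simps)
    then have convM: "convex M" unfolding M_def
      using conv[OF FS(5)] \<open>convex Q\<close> by (intro convex_linear_image convex_Times)
    have lowM: "- C * norm h \<le> r" if hr: "(h, r) \<in> M" for h r
    proof -
      obtain x0 a0 x a e where x: "(x0, a0) \<in> K j" "0 \<le> e" "\<forall>t\<in>G. (x t, a t) \<in> K t"
        and h: "h = x0 - x j" and r: "r = a0 + (R x a + e)"
        using hr by (auto simp: M_def Q_def)
      have "0 \<le> (\<Sum>t\<in>S. p t ((x(j := x0)) t) + c t) + (\<Sum>t\<in>F - S. (a(j := a0)) t) + N (x(j := x0))"
        using x FS by (intro IH) auto
      also have "(\<Sum>t\<in>S. p t ((x(j := x0)) t) + c t) = (\<Sum>t\<in>S. p t (x t) + c t)"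
        using FS by (intro sum.cong) auto
      also have "(\<Sum>t\<in>F - S. (a(j := a0)) t) = a0 + (\<Sum>t\<in>G. a t)"
      proof -
        have "(\<Sum>t\<in>G. (a(j := a0)) t) = (\<Sum>t\<in>G. a t)" using FS by (intro sum.cong) auto
        then show ?thesis using FS by simp
      qed
      finally show ?thesis using Nlip[OF FS(5), of x x0] x(2) by (simp add: r h R_def fun_upd_def)
    qed
    obtain P :: "'a dual" where P: "\<And>h r. (h, r) \<in> M \<Longrightarrow> P h \<le> r"
      using convex_minorant_linear[OF convM C lowM] by metis
    have sep: "P x - P y \<le> a + b" if "(x, a) \<in> K j" "(y, b) \<in> Q" for x a y b
    proof -
      have "(x - y, a + b) \<in> M"
        unfolding M_def by (rule image_eqI[of _ _ "((x, a), (y, b))"]) (use that in auto)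
      from P[OF this] show ?thesis by (simp add: blinfun.diff_right)
    qed
    define k where "k t = (SOME q. q \<in> K t)" for t
    have "\<And>t. t \<in> F \<Longrightarrow> k t \<in> K t" unfolding k_def using ne by (simp add: some_in_eq)
    then have k: "\<And>t. t \<in> F \<Longrightarrow> (fst (k t), snd (k t)) \<in> K t" by simp
    \<comment> \<open>The largest intercept for which the affine function with slope
      \<open>P\<close> stays below \<open>K j\<close>. A point of \<open>Q\<close> shows that it is
      finite, and \<open>sep\<close> makes it large enough for \<open>Q\<close>.\<close>
    define c0 where "c0 = (INF (x, a)\<in>K j. a - P x)"
    have "(fst (k j), R (\<lambda>t. fst (k t)) (\<lambda>t. snd (k t)) + 0) \<in> Q"
      unfolding Q_def mem_Collect_eq using k
      by (intro exI[of _ "\<lambda>t. fst (k t)"] exI[of _ "\<lambda>t. snd (k t)"] exI[of _ 0]) (auto simp: G_def)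
    then obtain y0 b0 where yb: "(y0, b0) \<in> Q" by blast
    have "bdd_below ((\<lambda>(x, a). a - P x) ` K j)"
    proof (rule bdd_belowI2[of _ "- P y0 - b0"])
      fix k assume "k \<in> K j"
      then show "- P y0 - b0 \<le> (case k of (x, a) \<Rightarrow> a - P x)"
        using sep[OF _ yb, of "fst k" "snd k"] by (auto simp: case_prod_unfold)
    qed
    then have c0: "c0 \<le> a - P x" if "(x, a) \<in> K j" for x a
      unfolding c0_def using cINF_lower[of "\<lambda>(x, a). a - P x" "K j" "(x, a)"] that by simp
    have c0': "- b - P y \<le> c0" if "(y, b) \<in> Q" for y b
      unfolding c0_def
    proof (rule cINF_greatest[OF ne[OF FS(5)]])
      fix k assume "k \<in> K j"
      then show "- b - P y \<le> (case k of (x, a) \<Rightarrow> a - P x)"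
        using sep[OF _ that, of "fst k" "snd k"] by (auto simp: case_prod_unfold)
    qed
    show ?case
    proof (intro exI[of _ "p(j := P)"] exI[of _ "c(j := c0)"] conjI allI impI)
      show "\<forall>t\<in>insert j S. \<forall>(x, a)\<in>K t. (p(j := P)) t x + (c(j := c0)) t \<le> a"
        using pc c0 FS(3) by (auto simp: le_diff_eq add.commute)
      fix x a assume "\<forall>t\<in>F - insert j S. (x t, a t) \<in> K t"
      then have "(x j, R x a + 0) \<in> Q"
        unfolding Q_def mem_Collect_eq G_def by (intro exI[of _ x] exI[of _ a] exI[of _ 0]) auto
      then have "0 \<le> P (x j) + c0 + R x a" using c0'[of "x j" "R x a"] by simp
      moreover have "(\<Sum>t\<in>S. (p(j := P)) t (x t) + (c(j := c0)) t) = (\<Sum>t\<in>S. p t (x t) + c t)"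
        using FS by (intro sum.cong) auto
      ultimately show "0 \<le> (\<Sum>t\<in>insert j S. (p(j := P)) t (x t) + (c(j := c0)) t) +
          (\<Sum>t\<in>F - insert j S. a t) + N x"
        using insert.hyps unfolding R_def G_def by simp
    qed
  qed
  from this[OF fin order_refl] obtain p :: "'i \<Rightarrow> 'a dual" and c where
    "\<forall>t\<in>F. \<forall>(x, a)\<in>K t. p t x + c t \<le> a" "\<forall>x. 0 \<le> (\<Sum>t\<in>F. p t (x t) + c t) + N x" by auto
  then show thesis by (intro that[of p c]) auto
qed

section \<open>Ekeland's principle for finitely many variables\<close>

text \<open>\<open>closed\<close> combines closedness of \<open>S\<close> and lower semicontinuity
  of \<open>\<Phi>\<close> in sequential form. Coordinates outside \<open>I\<close> are ignored, so
  the distance \<open>d\<close> of the proof is only a pseudometric.\<close>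

lemma ekeland_tuples:
  fixes \<Phi> :: "('i \<Rightarrow> 'a::banach) \<Rightarrow> real" and I :: "'i set"
  assumes fin: "finite I" and x0: "x0 \<in> S" and e: "0 < e"
    and closed: "\<And>s z c. (\<And>n::nat. s n \<in> S \<and> \<Phi> (s n) \<le> c) \<Longrightarrow> (\<And>t. t \<in> I \<Longrightarrow> (\<lambda>n. s n t) \<longlonglongrightarrow> z t) \<Longrightarrow>
      z \<in> S \<and> \<Phi> z \<le> c"
    and lower: "\<And>x. x \<in> S \<Longrightarrow> l \<le> \<Phi> x"
  obtains z where "z \<in> S" "\<Phi> z + e * (\<Sum>t\<in>I. norm (z t - x0 t)) \<le> \<Phi> x0"
    "\<And>x. x \<in> S \<Longrightarrow> \<Phi> z \<le> \<Phi> x + e * (\<Sum>t\<in>I. norm (x t - z t))"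
proof -
  define d where "d x y = (\<Sum>t\<in>I. norm (x t - y t))" for x y :: "'i \<Rightarrow> 'a"
  have d_tri: "d x z \<le> d x y + d y z" for x y z
    unfolding d_def sum.distrib[symmetric]
    by (intro sum_mono) (metis norm_triangle_ineq diff_add_cancel add_diff_eq)
  have d_ge0: "0 \<le> d x y" for x y unfolding d_def by (intro sum_nonneg) simp
  have d_self: "d x x = 0" for x by (simp add: d_def)
  define A where "A y = {x \<in> S. \<Phi> x + e * d x y \<le> \<Phi> y}" for y
  \<comment> \<open>\<open>g n y\<close> minimizes \<open>\<Phi>\<close> over \<open>A y\<close> up
    to \<open>(1/2)^n\<close>; iterating it gives Ekeland's sequence with decreasing sets
    \<open>A (s n)\<close>.\<close>
  define g where "g n y = (SOME x. x \<in> A y \<and> (\<forall>w\<in>A y. \<Phi> x \<le> \<Phi> w + (1/2)^n))" for n :: nat and y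
  have g: "g n y \<in> A y" "\<And>w. w \<in> A y \<Longrightarrow> \<Phi> (g n y) \<le> \<Phi> w + (1/2)^n" if y: "y \<in> S" for n y
  proof -
    have ne: "\<Phi> ` A y \<noteq> {}" using y by (auto simp: A_def d_self)
    have bdd: "bdd_below (\<Phi> ` A y)" using lower by (intro bdd_belowI2[of _ l]) (auto simp: A_def)
    have "Inf (\<Phi> ` A y) < Inf (\<Phi> ` A y) + (1/2)^n" by simp
    then obtain x where "x \<in> A y" "\<Phi> x < Inf (\<Phi> ` A y) + (1/2)^n"
      using cInf_lessD[OF ne, of "Inf (\<Phi> ` A y) + (1/2)^n"] by blast
    moreover have "Inf (\<Phi> ` A y) \<le> \<Phi> w" if "w \<in> A y" for w
      using bdd that by (intro cInf_lower) auto
    ultimately have "\<exists>x. x \<in> A y \<and> (\<forall>w\<in>A y. \<Phi> x \<le> \<Phi> w + (1/2)^n)" by force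
    from someI_ex[OF this] show "g n y \<in> A y" "\<And>w. w \<in> A y \<Longrightarrow> \<Phi> (g n y) \<le> \<Phi> w + (1/2)^n"
      unfolding g_def by auto
  qed
  define s where "s = rec_nat x0 g"
  have s0: "s 0 = x0" and sSuc: "s (Suc n) = g n (s n)" for n by (simp_all add: s_def)
  have sS: "s n \<in> S" for n
    by (induction n) (use x0 g(1) in \<open>auto simp: s0 sSuc A_def\<close>)
  have A_trans: "w \<in> A x" if "w \<in> A y" "y \<in> A x" for w x y
  proof -
    have "e * d w x \<le> e * d w y + e * d y x"
      using d_tri[of w x y] e by (simp flip: distrib_left)
    then show ?thesis using that unfolding A_def by simp
  qed
  have sA: "s (n + k) \<in> A (s n)" for n k
  proof (induction k)
    case 0
    then show ?case using sS by (simp add: A_def d_self)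
  next
    case (Suc k)
    show ?case using A_trans[OF g(1)[OF sS] Suc.IH] by (simp add: sSuc)
  qed
  have \<Phi>dec: "\<Phi> (s m) + e * d (s m) (s n) \<le> \<Phi> (s n)" if "n \<le> m" for m n
    using sA[of n "m - n"] that by (simp add: A_def)
  have "decseq (\<lambda>n. \<Phi> (s n))"
    unfolding decseq_def
  proof (intro allI impI)
    fix m n :: nat assume "m \<le> n"
    moreover have "0 \<le> e * d (s n) (s m)" using e d_ge0 by simp
    ultimately show "\<Phi> (s n) \<le> \<Phi> (s m)" using \<Phi>dec[of m n] by linarith
  qed
  moreover have "l \<le> \<Phi> (s n)" for n using lower sS .
  ultimately obtain L where L: "(\<lambda>n. \<Phi> (s n)) \<longlonglongrightarrow> L" "\<And>n. L \<le> \<Phi> (s n)"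
    using decseq_convergent by metis
  \<comment> \<open>The values decrease to \<open>L\<close>, and a move over distance
    \<open>d\<close> lowers the value by at least \<open>e * d\<close>; so the remaining moves
    become short.\<close>
  have small: "\<exists>M. \<forall>m\<ge>M. d (s m) (s M) \<le> r" if r: "0 < r" for r
  proof -
    have "\<forall>\<^sub>F n in sequentially. \<Phi> (s n) < L + e * r"
      using L(1) e r by (intro order_tendstoD) auto
    then obtain M where M: "\<Phi> (s M) < L + e * r" by (auto simp: eventually_sequentially)
    have "e * d (s m) (s M) \<le> e * r" if "M \<le> m" for m
      using \<Phi>dec[OF that] L(2)[of m] M by linarith
    then show ?thesis using e by auto
  qed
  have "Cauchy (\<lambda>n. s n t)" if t: "t \<in> I" for t
  proof (rule metric_CauchyI)
    fix r :: real assume "0 < r"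
    then obtain M where M: "\<And>m. M \<le> m \<Longrightarrow> d (s m) (s M) \<le> r / 3" using small[of "r / 3"] by auto
    have "norm (s m t - s M t) \<le> r / 3" if "M \<le> m" for m
      using M[OF that] member_le_sum[OF t _ fin, of "\<lambda>t. norm (s m t - s M t)"] by (simp add: d_def)
    then have "dist (s m t) (s M t) \<le> r / 3" if "M \<le> m" for m using that by (simp add: dist_norm)
    then have "dist (s m t) (s n t) \<le> r / 3 + r / 3" if "M \<le> m" "M \<le> n" for m n
      using that by (meson add_mono dist_triangle2 order_trans)
    then show "\<exists>M. \<forall>m\<ge>M. \<forall>n\<ge>M. dist (s m t) (s n t) < r" using \<open>0 < r\<close>
      by (intro exI[of _ M]) force
  qed
  then have "\<exists>y. t \<in> I \<longrightarrow> (\<lambda>n. s n t) \<longlonglongrightarrow> y" for t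
    using Cauchy_convergent convergent_def by blast
  then obtain z where z: "\<And>t. t \<in> I \<Longrightarrow> (\<lambda>n. s n t) \<longlonglongrightarrow> z t" by metis
  have dz: "(\<lambda>m. d (s m) y) \<longlonglongrightarrow> d z y" for y
    unfolding d_def by (intro tendsto_intros z)
  have zA: "z \<in> A (s n)" for n
  proof -
    have "z \<in> S \<and> \<Phi> z \<le> \<Phi> (s n) - e * d z (s n) + r" if r: "0 < r" for r
    proof -
      have "\<forall>\<^sub>F m in sequentially. \<Phi> (s n) - e * d (s m) (s n) < \<Phi> (s n) - e * d z (s n) + r"
      proof (rule order_tendstoD(2))
        show "(\<lambda>m. \<Phi> (s n) - e * d (s m) (s n)) \<longlonglongrightarrow> \<Phi> (s n) - e * d z (s n)"
          by (intro tendsto_intros dz)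
      qed (use r in simp)
      then obtain M where M: "\<And>m. M \<le> m \<Longrightarrow> \<Phi> (s n) - e * d (s m) (s n) < \<Phi> (s n) - e * d z (s n) + r"
        by (auto simp: eventually_sequentially)
      show ?thesis
      proof (rule closed[of "\<lambda>m. s (m + (M + n))"])
        show "s (m + (M + n)) \<in> S \<and> \<Phi> (s (m + (M + n))) \<le> \<Phi> (s n) - e * d z (s n) + r" for m
          using sS M[of "m + (M + n)"] \<Phi>dec[of n "m + (M + n)"] by auto
        show "(\<lambda>m. s (m + (M + n)) t) \<longlonglongrightarrow> z t" if "t \<in> I" for t
          using z[OF that] by (rule LIMSEQ_ignore_initial_segment)
      qed
    qed
    note le_add = this
    have "\<Phi> z \<le> \<Phi> (s n) - e * d z (s n)" by (rule field_le_epsilon) (use le_add in blast)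
    then show ?thesis using le_add[OF zero_less_one] by (simp add: A_def)
  qed
  have min: "\<Phi> z \<le> \<Phi> x + e * d x z" if x: "x \<in> S" for x
  proof (rule ccontr)
    assume less: "\<not> \<Phi> z \<le> \<Phi> x + e * d x z"
    \<comment> \<open>A violating point would lie in every \<open>A (s n)\<close>, where
      \<open>s (Suc n)\<close> is minimal up to \<open>(1/2)^n\<close>; its value is therefore at
      least that of \<open>z\<close>.\<close>
    then have xA: "x \<in> A (s n)" for n using A_trans[OF _ zA, of x n] x by (simp add: A_def)
    have "\<Phi> z \<le> \<Phi> x + (1/2)^n" for n
    proof -
      have "\<Phi> z + e * d z (s (Suc n)) \<le> \<Phi> (s (Suc n))" using zA[of "Suc n"] by (simp add: A_def)
      moreover have "0 \<le> e * d z (s (Suc n))" using e d_ge0 by simp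
      moreover have "\<Phi> (s (Suc n)) \<le> \<Phi> x + (1/2)^n" using g(2)[OF sS xA] by (simp add: sSuc)
      ultimately show ?thesis by linarith
    qed
    moreover have "(\<lambda>n. \<Phi> x + (1/2)^n) \<longlonglongrightarrow> \<Phi> x + 0"
      by (intro tendsto_intros LIMSEQ_power_zero) auto
    ultimately have "\<Phi> z \<le> \<Phi> x" using LIMSEQ_le_const[of _ "\<Phi> x + 0" "\<Phi> z"] by auto
    moreover have "0 \<le> e * d x z" using e d_ge0 by simp
    ultimately show False using less by linarith
  qed
  show thesis
  proof (rule that[of z])
    show "z \<in> S" "\<Phi> z + e * (\<Sum>t\<in>I. norm (z t - x0 t)) \<le> \<Phi> x0"
      using zA[of 0] by (auto simp: A_def s0 d_def)
  qed (use min in \<open>simp add: d_def\<close>)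
qed

text \<open>Lower semicontinuity of the function that is \<open>g\<close> on \<open>D\<close> and
  infinite elsewhere. If \<open>z\<close> lies outside \<open>D\<close>, nothing is required of
  \<open>c\<close>; with all sublevel sets closed, the values \<open>g (s n)\<close> then tend to
  infinity.\<close>

lemma eventually_gt_of_closed_sublevel:
  fixes g :: "'a::topological_space \<Rightarrow> real"
  assumes "closed {x \<in> D. g x \<le> c}" "z \<in> D \<Longrightarrow> c < g z" "s \<longlonglongrightarrow> z" "\<And>n::nat. s n \<in> D"
  shows "\<forall>\<^sub>F n in sequentially. c < g (s n)"
proof -
  have "\<forall>\<^sub>F n in sequentially. s n \<in> - {x \<in> D. g x \<le> c}"
    using assms by (intro topological_tendstoD[OF assms(3)]) (auto simp: open_Compl)
  then show ?thesis by eventually_elim (use assms(4) in auto)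
qed

text \<open>No term can tend to infinity, since the others are eventually bounded below and the
  total stays below \<open>c\<close>; so the limit remains in all domains, and lower semicontinuity
  can be added up.\<close>

lemma sum_closed_sublevel:
  fixes D :: "'i \<Rightarrow> 'a::topological_space set" and \<psi> :: "'i \<Rightarrow> 'a \<Rightarrow> real" and N :: "('i \<Rightarrow> 'a) \<Rightarrow> real"
  assumes fin: "finite I"
    and closed: "\<And>t c. t \<in> I \<Longrightarrow> closed {x \<in> D t. \<psi> t x \<le> c}"
    and sD: "\<And>n::nat. \<And>t. t \<in> I \<Longrightarrow> s n t \<in> D t"
    and le: "\<And>n. (\<Sum>t\<in>I. \<psi> t (s n t)) + N (s n) \<le> c"
    and lim: "\<And>t. t \<in> I \<Longrightarrow> (\<lambda>n. s n t) \<longlonglongrightarrow> z t" and limN: "(\<lambda>n. N (s n)) \<longlonglongrightarrow> N z"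
  shows "\<forall>t\<in>I. z t \<in> D t" "(\<Sum>t\<in>I. \<psi> t (z t)) + N z \<le> c"
proof -
  have *: "(\<Sum>t\<in>I. b t) + N z \<le> c" if b: "\<And>t. t \<in> I \<Longrightarrow> z t \<in> D t \<Longrightarrow> b t < \<psi> t (z t)" for b
  proof -
    have "\<forall>\<^sub>F n in sequentially. \<forall>t\<in>I. b t < \<psi> t (s n t)"
      using eventually_gt_of_closed_sublevel[OF closed b lim sD] fin
      by (auto intro!: eventually_ball_finite)
    then have "\<forall>\<^sub>F n in sequentially. (\<Sum>t\<in>I. b t) + N (s n) \<le> c"
    proof eventually_elim
      case (elim n)
      then have "(\<Sum>t\<in>I. b t) \<le> (\<Sum>t\<in>I. \<psi> t (s n t))" by (intro sum_mono) (auto intro: less_imp_le)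
      then show ?case using le[of n] by linarith
    qed
    moreover have "(\<lambda>n. (\<Sum>t\<in>I. b t) + N (s n)) \<longlonglongrightarrow> (\<Sum>t\<in>I. b t) + N z"
      by (intro tendsto_intros limN)
    ultimately show ?thesis by (intro tendsto_upperbound[of _ _ sequentially]) auto
  qed
  show zD: "\<forall>t\<in>I. z t \<in> D t"
  proof (rule ccontr)
    assume "\<not> ?thesis"
    then obtain j where j: "j \<in> I" "z j \<notin> D j" by blast
    \<comment> \<open>As \<open>z j\<close> lies outside \<open>D j\<close>, the lower bound at
      \<open>j\<close> is arbitrary; raising it by \<open>r\<close> makes the total of the bounds
      and \<open>N z\<close> equal to \<open>c + 1\<close>.\<close>
    define b where "b t = (if t = j then 0 else \<psi> t (z t) - 1)" for t
    define r where "r = c - N z - (\<Sum>t\<in>I. b t) + 1"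
    have "(\<Sum>t\<in>I. b t + (if t = j then r else 0)) + N z \<le> c"
      using j(2) by (intro *) (auto simp: b_def)
    then show False using j(1) fin by (simp add: sum.distrib r_def)
  qed
  show "(\<Sum>t\<in>I. \<psi> t (z t)) + N z \<le> c"
  proof (rule field_le_epsilon)
    fix e :: real assume e: "0 < e"
    define r where "r = e / (card I + 1)"
    have "(\<Sum>t\<in>I. \<psi> t (z t) - r) + N z \<le> c" using e by (intro *) (auto simp: r_def)
    moreover have "(\<Sum>t\<in>I. r) \<le> e" using e by (simp add: r_def field_simps)
    ultimately show "(\<Sum>t\<in>I. \<psi> t (z t)) + N z \<le> c + e" by (simp add: sum_subtractf)
  qed
qed

text \<open>The penalty decouples the variables; the Ekeland point then satisfies an exact optimality
  condition, which Hahn-Banach splits into one subgradient per variable.\<close>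

lemma coupled_almost_minimizer:
  fixes D :: "'i \<Rightarrow> 'a::banach set" and \<psi> :: "'i \<Rightarrow> 'a \<Rightarrow> real"
  assumes fin: "finite I" and j: "j \<in> I"
    and conv: "\<And>t. t \<in> I \<Longrightarrow> convex_on (D t) (\<psi> t)"
    and closed: "\<And>t c. t \<in> I \<Longrightarrow> closed {x \<in> D t. \<psi> t x \<le> c}"
    and x0: "\<And>t. t \<in> I \<Longrightarrow> x0 \<in> D t"
    and k: "0 \<le> k" and e: "0 < e"
    and lower: "\<And>x. (\<And>t. t \<in> I \<Longrightarrow> x t \<in> D t) \<Longrightarrow>
      (\<Sum>t\<in>I. \<psi> t x0) - e\<^sup>2 \<le> (\<Sum>t\<in>I. \<psi> t (x t)) + k * (\<Sum>t\<in>I. norm (x t - x j))"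
  obtains z :: "'i \<Rightarrow> 'a" and p :: "'i \<Rightarrow> 'a dual"
  where "\<And>t. t \<in> I \<Longrightarrow> z t \<in> D t" "\<And>t. t \<in> I \<Longrightarrow> norm (z t - x0) \<le> e"
    "(\<Sum>t\<in>I. \<psi> t (z t)) + k * (\<Sum>t\<in>I. norm (z t - z j)) \<le> (\<Sum>t\<in>I. \<psi> t x0)"
    "\<And>t x. t \<in> I \<Longrightarrow> x \<in> D t \<Longrightarrow> p t (x - z t) \<le> \<psi> t x - \<psi> t (z t)"
    "\<And>x. k * (\<Sum>t\<in>I. norm (z t - z j)) \<le> (\<Sum>t\<in>I. p t (x t - z t)) +
      k * (\<Sum>t\<in>I. norm (x t - x j)) + e * (\<Sum>t\<in>I. norm (x t - z t))"
proof -
  define B where "B x = k * (\<Sum>t\<in>I. norm (x t - x j))" for x :: "'i \<Rightarrow> 'a"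
  define S where "S = {x. \<forall>t\<in>I. x t \<in> D t}"
  define \<Phi> where "\<Phi> x = (\<Sum>t\<in>I. \<psi> t (x t)) + B x" for x
  obtain z where z: "z \<in> S" "\<Phi> z + e * (\<Sum>t\<in>I. norm (z t - x0)) \<le> \<Phi> (\<lambda>_. x0)"
    "\<And>x. x \<in> S \<Longrightarrow> \<Phi> z \<le> \<Phi> x + e * (\<Sum>t\<in>I. norm (x t - z t))"
  proof (rule ekeland_tuples[OF fin _ e, of "\<lambda>_. x0" S \<Phi> "(\<Sum>t\<in>I. \<psi> t x0) - e\<^sup>2"])
    show "(\<lambda>_. x0) \<in> S" using x0 by (simp add: S_def)
    show "(\<Sum>t\<in>I. \<psi> t x0) - e\<^sup>2 \<le> \<Phi> x" if "x \<in> S" for x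
      using lower[of x] that by (simp add: S_def \<Phi>_def B_def)
    fix s :: "nat \<Rightarrow> 'i \<Rightarrow> 'a" and z c
    assume s: "\<And>n. s n \<in> S \<and> \<Phi> (s n) \<le> c" and lim: "\<And>t. t \<in> I \<Longrightarrow> (\<lambda>n. s n t) \<longlonglongrightarrow> z t"
    have limB: "(\<lambda>n. B (s n)) \<longlonglongrightarrow> B z" unfolding B_def by (intro tendsto_intros lim j)
    show "z \<in> S \<and> \<Phi> z \<le> c"
      using sum_closed_sublevel[where D = D and \<psi> = \<psi> and s = s and N = B and c = c and z = z, OF fin closed _ _ lim limB] s
      by (simp add: S_def \<Phi>_def)
  qed (use that in blast)
  have zD: "z t \<in> D t" if "t \<in> I" for t using z(1) that by (simp add: S_def)
  have \<Phi>0: "\<Phi> (\<lambda>_. x0) = (\<Sum>t\<in>I. \<psi> t x0)" by (simp add: \<Phi>_def B_def)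
  \<comment> \<open>Epigraphs recentred so that \<open>z t\<close> has height 0. \<open>N\<close> is
    the penalty, recentred at \<open>z\<close>, plus the Ekeland term; minimality of
    \<open>z\<close> then says that heights plus \<open>N\<close> are nonnegative.\<close>
  define K where "K t = {(x, a). x \<in> D t \<and> \<psi> t x - \<psi> t (z t) \<le> a}" for t
  define N where "N x = B x - B z + e * (\<Sum>t\<in>I. norm (x t - z t))" for x
  \<comment> \<open>Changing one variable by \<open>h\<close> changes each of the
    \<open>card I\<close> distances to variable \<open>j\<close> by at most
    \<open>2 * norm h\<close>, one \<open>norm h\<close> for each end, and each Ekeland distance by
    at most \<open>norm h\<close>.\<close>
  define C where "C = k * (card I * 2) + e * card I"
  obtain p :: "'i \<Rightarrow> 'a dual" and c where pK: "\<And>t x a. t \<in> I \<Longrightarrow> (x, a) \<in> K t \<Longrightarrow> p t x + c t \<le> a"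
    and pN: "\<And>x. 0 \<le> (\<Sum>t\<in>I. p t (x t) + c t) + N x"
  proof (rule convex_sum_separation[OF fin, of K N C])
    show "convex (K t)" if "t \<in> I" for t
    proof -
      have "convex_on (D t) (\<lambda>x. \<psi> t x + - \<psi> t (z t))"
        using conv[OF that] convex_on_imp_convex by (intro convex_on_add) (auto simp: convex_on_const)
      then have "convex (epigraph (D t) (\<lambda>x. \<psi> t x + - \<psi> t (z t)))"
        by (rule convex_epigraphI)
      then show ?thesis by (simp add: epigraph_def K_def case_prod_unfold)
    qed
    show "K t \<noteq> {}" if "t \<in> I" for t using zD[OF that] by (auto simp: K_def)
    show "0 \<le> C" using k e by (simp add: C_def)
    show "N (\<lambda>t. a *\<^sub>R x t + b *\<^sub>R y t) \<le> a * N x + b * N y" if "0 \<le> a" "0 \<le> b" "a + b = 1" for a b x y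
    proof -
      have tri: "norm ((a *\<^sub>R u + b *\<^sub>R v) - (a *\<^sub>R u' + b *\<^sub>R v')) \<le> a * norm (u - u') + b * norm (v - v')"
        for u v u' v' :: 'a
      proof -
        have "(a *\<^sub>R u + b *\<^sub>R v) - (a *\<^sub>R u' + b *\<^sub>R v') = a *\<^sub>R (u - u') + b *\<^sub>R (v - v')"
          by (simp add: algebra_simps)
        then show ?thesis using that norm_triangle_ineq[of "a *\<^sub>R (u - u')" "b *\<^sub>R (v - v')"] by simp
      qed
      have zz: "a *\<^sub>R w + b *\<^sub>R w = w" for w :: 'a using that by (metis scaleR_add_left scaleR_one)
      have "(\<Sum>t\<in>I. norm ((a *\<^sub>R x t + b *\<^sub>R y t) - (a *\<^sub>R x j + b *\<^sub>R y j)))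
          \<le> a * (\<Sum>t\<in>I. norm (x t - x j)) + b * (\<Sum>t\<in>I. norm (y t - y j))"
        unfolding sum_distrib_left sum.distrib[symmetric] by (intro sum_mono tri)
      then have 1: "B (\<lambda>t. a *\<^sub>R x t + b *\<^sub>R y t) \<le> k * (a * (\<Sum>t\<in>I. norm (x t - x j)) + b * (\<Sum>t\<in>I. norm (y t - y j)))"
        unfolding B_def using k by (rule mult_left_mono)
      have "(\<Sum>t\<in>I. norm ((a *\<^sub>R x t + b *\<^sub>R y t) - z t))
          \<le> a * (\<Sum>t\<in>I. norm (x t - z t)) + b * (\<Sum>t\<in>I. norm (y t - z t))"
        unfolding sum_distrib_left sum.distrib[symmetric]
      proof (intro sum_mono)
        fix t
        show "norm (a *\<^sub>R x t + b *\<^sub>R y t - z t) \<le> a * norm (x t - z t) + b * norm (y t - z t)"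
          using tri[of "x t" "y t" "z t" "z t"] unfolding zz .
      qed
      then have 2: "e * (\<Sum>t\<in>I. norm ((a *\<^sub>R x t + b *\<^sub>R y t) - z t))
          \<le> e * (a * (\<Sum>t\<in>I. norm (x t - z t)) + b * (\<Sum>t\<in>I. norm (y t - z t)))"
        using e by (intro mult_left_mono) auto
      have "a * B z + b * B z = B z" using that by (metis distrib_right mult_1)
      then show ?thesis using 1 2 unfolding N_def B_def by (simp add: algebra_simps)
    qed
    show "N (x(t := h)) \<le> N x + C * norm (h - x t)" if "t \<in> I" for x t h
    proof -
      let ?y = "x(t := h)" and ?d = "norm (h - x t)"
      have d: "norm (?y s - x s) \<le> ?d" for s by simp
      have "norm (?y s - ?y j) \<le> norm (x s - x j) + 2 * ?d" for s
      proof -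
        have "?y s - ?y j = (x s - x j) + ((?y s - x s) - (?y j - x j))" by (simp add: algebra_simps)
        then have "norm (?y s - ?y j) \<le> norm (x s - x j) + norm ((?y s - x s) - (?y j - x j))"
          by (metis norm_triangle_ineq)
        moreover have "norm ((?y s - x s) - (?y j - x j)) \<le> norm (?y s - x s) + norm (?y j - x j)"
          by (rule norm_triangle_ineq4)
        ultimately show ?thesis using d[of s] d[of j] by linarith
      qed
      then have "(\<Sum>s\<in>I. norm (?y s - ?y j)) \<le> (\<Sum>s\<in>I. norm (x s - x j) + 2 * ?d)" by (intro sum_mono)
      then have "B ?y \<le> k * ((\<Sum>s\<in>I. norm (x s - x j)) + card I * (2 * ?d))"
        unfolding B_def using k by (intro mult_left_mono) (simp_all add: sum.distrib)
      moreover have "norm (?y s - z s) \<le> norm (x s - z s) + ?d" for s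
        using norm_triangle_ineq[of "x s - z s" "?y s - x s"] d[of s] by (simp add: algebra_simps)
      then have "(\<Sum>s\<in>I. norm (?y s - z s)) \<le> (\<Sum>s\<in>I. norm (x s - z s) + ?d)" by (intro sum_mono)
      then have "e * (\<Sum>s\<in>I. norm (?y s - z s)) \<le> e * ((\<Sum>s\<in>I. norm (x s - z s)) + card I * ?d)"
        using e by (intro mult_left_mono) (simp_all add: sum.distrib)
      ultimately show ?thesis unfolding N_def C_def B_def by (simp add: algebra_simps)
    qed
    show "0 \<le> (\<Sum>t\<in>I. a t) + N x" if xa: "\<And>t. t \<in> I \<Longrightarrow> (x t, a t) \<in> K t" for x a
    proof -
      have "x \<in> S" using xa by (auto simp: S_def K_def)
      moreover have "(\<Sum>t\<in>I. \<psi> t (x t) - \<psi> t (z t)) \<le> (\<Sum>t\<in>I. a t)"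
        using xa by (intro sum_mono) (auto simp: K_def)
      ultimately show ?thesis using z(3)[of x] by (simp add: \<Phi>_def N_def sum_subtractf)
    qed
  qed (use that in blast)
  \<comment> \<open>Each affine minorant is at most 0 at \<open>z\<close>, where height 0 is
    allowed, while \<open>pN\<close> at \<open>z\<close> makes their sum nonnegative; so all of them
    vanish there.\<close>
  have c: "c t = - p t (z t)" if t: "t \<in> I" for t
  proof -
    have nonpos: "p s (z s) + c s \<le> 0" if "s \<in> I" for s
      using pK[OF that, of "z s" 0] zD[OF that] by (simp add: K_def)
    have "- (p t (z t) + c t) \<le> (\<Sum>s\<in>I. - (p s (z s) + c s))"
      using member_le_sum[OF t _ fin, of "\<lambda>s. - (p s (z s) + c s)"] nonpos by force
    also have "\<dots> = - (\<Sum>s\<in>I. p s (z s) + c s)" by (rule sum_negf)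
    also have "\<dots> \<le> 0" using pN[of z] by (simp add: N_def)
    finally show ?thesis using nonpos[OF t] by simp
  qed
  show thesis
  proof (rule that[of z p])
    show "z t \<in> D t" if "t \<in> I" for t using zD[OF that] .
    show "(\<Sum>t\<in>I. \<psi> t (z t)) + k * (\<Sum>t\<in>I. norm (z t - z j)) \<le> (\<Sum>t\<in>I. \<psi> t x0)"
    proof -
      have "0 \<le> e * (\<Sum>t\<in>I. norm (z t - x0))" using e by (simp add: sum_nonneg)
      then show ?thesis using z(2) unfolding \<Phi>0 by (simp add: \<Phi>_def B_def)
    qed
    show "norm (z t - x0) \<le> e" if t: "t \<in> I" for t
    proof -
      have "e * (\<Sum>t\<in>I. norm (z t - x0)) \<le> e * e"
        using z(2) lower[OF zD] unfolding \<Phi>0 by (simp add: \<Phi>_def B_def power2_eq_square)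
      then have "(\<Sum>t\<in>I. norm (z t - x0)) \<le> e" using e by simp
      then show ?thesis using member_le_sum[OF t _ fin, of "\<lambda>t. norm (z t - x0)"] by simp
    qed
    show "p t (x - z t) \<le> \<psi> t x - \<psi> t (z t)" if "t \<in> I" "x \<in> D t" for t x
      using pK[OF that(1), of x "\<psi> t x - \<psi> t (z t)"] that(2) c[OF that(1)]
      by (simp add: K_def blinfun.diff_right)
    show "k * (\<Sum>t\<in>I. norm (z t - z j)) \<le> (\<Sum>t\<in>I. p t (x t - z t)) +
      k * (\<Sum>t\<in>I. norm (x t - x j)) + e * (\<Sum>t\<in>I. norm (x t - z t))" for x
    proof -
      have "(\<Sum>t\<in>I. p t (x t) + c t) = (\<Sum>t\<in>I. p t (x t - z t))"
        using c by (intro sum.cong) (auto simp: blinfun.diff_right)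
      then show ?thesis using pN[of x] by (simp add: N_def B_def)
    qed
  qed
qed

section \<open>Approximate multipliers for a finite maximum\<close>

text \<open>A smooth, strictly positive, increasing and convex approximation of
  \<open>2 * max r 0\<close>, with error tending to 0 with \<open>\<eta>\<close>. In the form
  \<open>norm (r, \<eta>) + r\<close>, monotonicity and convexity come from the triangle
  inequality.\<close>

definition soft_pos :: "real \<Rightarrow> real \<Rightarrow> real" where
  "soft_pos \<eta> r = sqrt (r\<^sup>2 + \<eta>\<^sup>2) + r"

definition soft_pos_deriv :: "real \<Rightarrow> real \<Rightarrow> real" where
  "soft_pos_deriv \<eta> r = 1 + r / sqrt (r\<^sup>2 + \<eta>\<^sup>2)"

lemma soft_pos_0: "0 < \<eta> \<Longrightarrow> soft_pos \<eta> 0 = \<eta>"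
  by (simp add: soft_pos_def)

lemma sqrt_gt_abs: "0 < \<eta> \<Longrightarrow> \<bar>r\<bar> < sqrt (r\<^sup>2 + \<eta>\<^sup>2)"
  by (rule real_less_rsqrt) simp

lemma soft_pos_pos: "0 < \<eta> \<Longrightarrow> 0 < soft_pos \<eta> r"
  using sqrt_gt_abs[of \<eta> r] by (simp add: soft_pos_def)

lemma soft_pos_ge: "0 < \<eta> \<Longrightarrow> 2 * r \<le> soft_pos \<eta> r"
  using sqrt_gt_abs[of \<eta> r] by (simp add: soft_pos_def)

lemma soft_pos_norm: "soft_pos \<eta> r = norm (r, \<eta>) + r"
  by (simp add: soft_pos_def norm_Pair)

lemma soft_pos_mono: "r \<le> s \<Longrightarrow> soft_pos \<eta> r \<le> soft_pos \<eta> s"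
proof -
  assume "r \<le> s"
  moreover have "norm (r, \<eta>) \<le> norm (s, \<eta>) + norm ((r, \<eta>) - (s, \<eta>))" by (rule norm_triangle_sub)
  ultimately show ?thesis by (simp add: soft_pos_norm norm_Pair)
qed

lemma soft_pos_convex:
  assumes "0 \<le> u" "0 \<le> v" "u + v = 1"
  shows "soft_pos \<eta> (u * r + v * s) \<le> u * soft_pos \<eta> r + v * soft_pos \<eta> s"
proof -
  have "u * \<eta> + v * \<eta> = \<eta>" using assms by (metis distrib_right mult_1)
  then have "(u * r + v * s, \<eta>) = u *\<^sub>R (r, \<eta>) + v *\<^sub>R (s, \<eta>)" by simp
  then have "norm (u * r + v * s, \<eta>) \<le> u * norm (r, \<eta>) + v * norm (s, \<eta>)"
    using norm_triangle_ineq[of "u *\<^sub>R (r, \<eta>)" "v *\<^sub>R (s, \<eta>)"] assms by (metis abs_of_nonneg norm_scaleR)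
  then show ?thesis by (simp add: soft_pos_norm algebra_simps)
qed

text \<open>Squaring solves the inequality for \<open>r\<close> explicitly, so that sublevel sets of
  \<open>soft_pos\<close> composed with \<open>g\<close> are sublevel sets of
  \<open>g\<close>.\<close>

lemma soft_pos_le_iff:
  assumes "0 < \<eta>" "0 < b"
  shows "soft_pos \<eta> r \<le> b \<longleftrightarrow> r \<le> (b\<^sup>2 - \<eta>\<^sup>2) / (2 * b)"
proof -
  have "soft_pos \<eta> r \<le> b \<longleftrightarrow> r\<^sup>2 + \<eta>\<^sup>2 \<le> (b - r)\<^sup>2 \<and> r \<le> b"
  proof
    assume "soft_pos \<eta> r \<le> b"
    then have *: "sqrt (r\<^sup>2 + \<eta>\<^sup>2) \<le> b - r" by (simp add: soft_pos_def)
    then have "0 \<le> b - r" using sqrt_gt_abs[OF assms(1), of r] by linarith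
    then show "r\<^sup>2 + \<eta>\<^sup>2 \<le> (b - r)\<^sup>2 \<and> r \<le> b" using * sqrt_le_D by auto
  next
    assume "r\<^sup>2 + \<eta>\<^sup>2 \<le> (b - r)\<^sup>2 \<and> r \<le> b"
    then have "sqrt (r\<^sup>2 + \<eta>\<^sup>2) \<le> b - r" by (intro real_le_lsqrt) auto
    then show "soft_pos \<eta> r \<le> b" by (simp add: soft_pos_def)
  qed
  also have "\<dots> \<longleftrightarrow> 2 * b * r \<le> b\<^sup>2 - \<eta>\<^sup>2 \<and> r \<le> b"
    by (simp add: power2_eq_square algebra_simps)
  also have "\<dots> \<longleftrightarrow> 2 * b * r \<le> b\<^sup>2 - \<eta>\<^sup>2"
  proof -
    have "r \<le> b" if "2 * b * r \<le> b\<^sup>2 - \<eta>\<^sup>2"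
    proof (rule ccontr)
      assume "\<not> r \<le> b"
      then have "b * b < b * r" "0 < b * b" using assms by simp_all
      moreover have "0 \<le> \<eta>\<^sup>2" by simp
      ultimately show False using that unfolding power2_eq_square[of b] by linarith
    qed
    then show ?thesis by blast
  qed
  also have "\<dots> \<longleftrightarrow> r \<le> (b\<^sup>2 - \<eta>\<^sup>2) / (2 * b)"
    using assms by (simp add: field_simps)
  finally show ?thesis .
qed

lemma soft_pos_has_derivative:
  assumes "0 < \<eta>"
  shows "(soft_pos \<eta> has_real_derivative soft_pos_deriv \<eta> r) (at r)"
proof -
  have "0 < r\<^sup>2 + \<eta>\<^sup>2" using assms by (simp add: add_nonneg_pos)
  then show ?thesis
    unfolding soft_pos_def[abs_def] soft_pos_deriv_def
    by (auto intro!: derivative_eq_intros simp: field_simps)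
qed

lemma soft_pos_deriv_bounds:
  assumes "0 < \<eta>"
  shows "0 < soft_pos_deriv \<eta> r" "soft_pos_deriv \<eta> r \<le> 2" "0 \<le> r \<Longrightarrow> 1 \<le> soft_pos_deriv \<eta> r"
proof -
  have s: "\<bar>r\<bar> < sqrt (r\<^sup>2 + \<eta>\<^sup>2)" "0 < sqrt (r\<^sup>2 + \<eta>\<^sup>2)"
    using sqrt_gt_abs[OF assms, of r] abs_ge_zero[of r] by linarith+
  then have "\<bar>r / sqrt (r\<^sup>2 + \<eta>\<^sup>2)\<bar> < 1" by (simp add: field_simps)
  then show "0 < soft_pos_deriv \<eta> r" "soft_pos_deriv \<eta> r \<le> 2"
    unfolding soft_pos_deriv_def abs_less_iff by linarith+
  show "1 \<le> soft_pos_deriv \<eta> r" if "0 \<le> r" using that s by (simp add: soft_pos_deriv_def)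
qed

lemma convex_on_soft_pos_comp:
  assumes "convex_on D g" "0 \<le> \<kappa>"
  shows "convex_on D (\<lambda>x. \<kappa> * soft_pos \<eta> (g x - c))"
proof (rule convex_on_cmul[OF assms(2)])
  show "convex_on D (\<lambda>x. soft_pos \<eta> (g x - c))"
    unfolding convex_on_def
  proof (intro conjI ballI allI impI)
    show "convex D" using assms(1) by (rule convex_on_imp_convex)
    fix x y and u v :: real
    assume xy: "x \<in> D" "y \<in> D" and uv: "0 \<le> u" "0 \<le> v" "u + v = 1"
    have "g (u *\<^sub>R x + v *\<^sub>R y) \<le> u * g x + v * g y" using assms(1) xy uv by (simp add: convex_on_def)
    moreover have "u * c + v * c = c" using uv by (metis distrib_right mult_1)
    ultimately have "g (u *\<^sub>R x + v *\<^sub>R y) - c \<le> u * (g x - c) + v * (g y - c)"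
      unfolding right_diff_distrib by linarith
    from soft_pos_mono[OF this] soft_pos_convex[OF uv]
    show "soft_pos \<eta> (g (u *\<^sub>R x + v *\<^sub>R y) - c) \<le> u * soft_pos \<eta> (g x - c) + v * soft_pos \<eta> (g y - c)"
      by (rule order_trans)
  qed
qed

lemma closed_sublevel_soft_pos_comp:
  assumes "\<And>a. closed {x \<in> D. g x \<le> a}" "0 < \<kappa>" "0 < \<eta>"
  shows "closed {x \<in> D. \<kappa> * soft_pos \<eta> (g x - c) \<le> a}"
proof (cases "0 < a")
  case True
  define b where "b = a / \<kappa>"
  have b: "0 < b" "\<And>v. \<kappa> * v \<le> a \<longleftrightarrow> v \<le> b" using True assms(2) by (auto simp: b_def field_simps)
  have "\<kappa> * soft_pos \<eta> (g x - c) \<le> a \<longleftrightarrow> g x \<le> (b\<^sup>2 - \<eta>\<^sup>2) / (2 * b) + c" for x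
    unfolding b(2) soft_pos_le_iff[OF assms(3) b(1)] diff_le_eq ..
  then show ?thesis using assms(1) by simp
next
  case False
  have "0 < \<kappa> * soft_pos \<eta> (g x - c)" for x using assms soft_pos_pos by simp
  then have empty: "{x \<in> D. \<kappa> * soft_pos \<eta> (g x - c) \<le> a} = {}"
    using False by (force simp: not_le intro: less_le_trans)
  show ?thesis unfolding empty by (rule closed_empty)
qed

text \<open>A chain rule for subgradients in which \<open>g\<close> need not be differentiable: on
  the segment from \<open>z\<close> to \<open>y\<close>, convexity puts \<open>g\<close> below its
  chord, and only \<open>soft_pos\<close> is differentiated.\<close>

lemma subgradient_soft_pos_comp:
  assumes g: "convex_on D g" and z: "z \<in> D" and \<eta>: "0 < \<eta>" and \<kappa>: "0 < \<kappa>" and P: "linear (P :: 'a::real_vector \<Rightarrow> real)"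
    and sub: "\<And>y. y \<in> D \<Longrightarrow> P (y - z) \<le> \<kappa> * soft_pos \<eta> (g y - c) - \<kappa> * soft_pos \<eta> (g z - c)"
    and y: "y \<in> D"
  shows "P (y - z) \<le> \<kappa> * soft_pos_deriv \<eta> (g z - c) * (g y - g z)"
proof (rule ccontr)
  \<comment> \<open>With the chord in place of \<open>g\<close>, the subgradient inequality gives
    \<open>G 0 \<le> G h\<close>, whereas failure of the claim would make the derivative of
    \<open>G\<close> at 0 negative.\<close>
  define G where "G s = \<kappa> * soft_pos \<eta> (g z - c + s * (g y - g z)) - s * P (y - z)" for s
  assume "\<not> ?thesis"
  then have neg: "\<kappa> * (soft_pos_deriv \<eta> (g z - c) * (g y - g z)) - P (y - z) < 0" by simp
  have "((\<lambda>s. g z - c + s * (g y - g z)) has_real_derivative (g y - g z)) (at 0)"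
    by (auto intro!: derivative_eq_intros)
  then have "((\<lambda>s. soft_pos \<eta> (g z - c + s * (g y - g z))) has_real_derivative
      soft_pos_deriv \<eta> (g z - c) * (g y - g z)) (at 0)"
    using soft_pos_has_derivative[OF \<eta>] by (intro DERIV_chain2[where f = "soft_pos \<eta>"]) auto
  then have "(G has_real_derivative (\<kappa> * (soft_pos_deriv \<eta> (g z - c) * (g y - g z)) - P (y - z))) (at 0)"
    unfolding G_def by (auto intro!: derivative_eq_intros)
  then obtain d where d: "0 < d" "\<And>h. 0 < h \<Longrightarrow> h < d \<Longrightarrow> G (0 + h) < G 0"
    using DERIV_neg_dec_right[OF _ neg] by blast
  define h where "h = min (d / 2) 1"
  have h: "0 < h" "h < d" "h \<le> 1" using d(1) by (auto simp: h_def)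
  define w where "w = (1 - h) *\<^sub>R z + h *\<^sub>R y"
  have wD: "w \<in> D" unfolding w_def using z y h by (intro convexD[OF convex_on_imp_convex[OF g]]) auto
  have "g w \<le> (1 - h) * g z + h * g y" using g z y h by (simp add: convex_on_def w_def)
  then have "soft_pos \<eta> (g w - c) \<le> soft_pos \<eta> (g z - c + h * (g y - g z))"
    by (intro soft_pos_mono) (simp add: algebra_simps)
  then have "\<kappa> * soft_pos \<eta> (g w - c) \<le> \<kappa> * soft_pos \<eta> (g z - c + h * (g y - g z))" using \<kappa> by simp
  moreover have "w - z = h *\<^sub>R (y - z)" by (simp add: w_def algebra_simps)
  then have "P (w - z) = h * P (y - z)" using P by (simp add: linear_scale)
  ultimately have "G 0 \<le> G h" using sub[OF wD] by (simp add: G_def)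
  then show False using d(2)[OF h(1,2)] by simp
qed

lemma approximate_multipliers:
  fixes D :: "'i \<Rightarrow> 'a::banach set" and g :: "'i \<Rightarrow> 'a \<Rightarrow> real"
  assumes fin: "finite F" and ne: "F \<noteq> {}"
    and conv: "\<And>t. t \<in> F \<Longrightarrow> convex_on (D t) (g t)"
    and closed: "\<And>t c. t \<in> F \<Longrightarrow> closed {x \<in> D t. g t x \<le> c}"
    and x0: "\<And>t. t \<in> F \<Longrightarrow> x0 \<in> D t" and g0: "\<And>t. t \<in> F \<Longrightarrow> g t x0 \<le> 0"
    and max_nonneg: "\<And>x. (\<And>t. t \<in> F \<Longrightarrow> x \<in> D t) \<Longrightarrow> \<exists>t\<in>F. 0 \<le> g t x"
    and \<epsilon>: "0 < \<epsilon>"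
  obtains z :: "'i \<Rightarrow> 'a" and p :: "'i \<Rightarrow> 'a dual" and l :: "'i \<Rightarrow> real"
  where "\<And>t. t \<in> F \<Longrightarrow> z t \<in> D t \<and> norm (z t - x0) \<le> \<epsilon> \<and> g t (z t) \<le> g t x0 + \<epsilon>"
    "\<And>t. t \<in> F \<Longrightarrow> 0 < l t \<and> l t \<le> 2 \<and> (g t x0 < 0 \<longrightarrow> l t \<le> \<epsilon>)"
    "\<And>t x. t \<in> F \<Longrightarrow> x \<in> D t \<Longrightarrow> p t (x - z t) \<le> l t * (g t x - g t (z t))"
    "\<And>t. t \<in> F \<Longrightarrow> norm (p t) \<le> 3 * real (card F)"
    "norm (\<Sum>t\<in>F. p t) \<le> \<epsilon>"
    "(\<exists>t\<in>F. 1 \<le> l t) \<or> (\<exists>t\<in>F. 1 - \<epsilon> \<le> norm (p t))"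
proof -
  define m where "m = real (card F)"
  have m: "1 \<le> m" using fin ne by (simp add: m_def Suc_le_eq card_gt_0_iff)
  \<comment> \<open>The margin by which inactive functions are negative at \<open>x0\<close>; the
    entry 1 keeps the minimum meaningful if there are none.\<close>
  define \<delta> where "\<delta> = Min (insert 1 ((\<lambda>t. - g t x0) ` {t \<in> F. g t x0 < 0}))"
  have \<delta>: "0 < \<delta>" "\<And>t. t \<in> F \<Longrightarrow> g t x0 < 0 \<Longrightarrow> \<delta> \<le> - g t x0"
    using fin by (auto simp: \<delta>_def)
  \<comment> \<open>The bound \<open>\<epsilon> / (2 * m\<^sup>2)\<close> serves
    \<open>m * e \<le> \<epsilon>\<close>, for the sum of the dual vectors, and
    \<open>2 * q \<le> \<epsilon>\<close>, for inactive multipliers. The bound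
    \<open>\<delta> / (2 * m)\<close> gives \<open>e < \<delta>\<close>, so that inactive functions
    stay negative at the new points.\<close>
  define q where "q = min (1/2) (min (\<epsilon> / (2 * m\<^sup>2)) (\<delta> / (2 * m)))"
  have q: "0 < q" "q \<le> 1" using \<epsilon> \<delta> m by (auto simp: q_def)
  have "q \<le> \<epsilon> / (2 * m\<^sup>2)" "q \<le> \<delta> / (2 * m)" by (auto simp: q_def)
  then have q2: "2 * (m\<^sup>2 * q) \<le> \<epsilon>" and q3: "2 * (m * q) \<le> \<delta>"
    using m by (simp_all add: field_simps)
  have mm: "m * q \<le> m\<^sup>2 * q" "q \<le> m * q" "0 < m * q"
    using m q by (simp_all add: power2_eq_square)
  define e where "e = m * q"
  have e: "0 < e" "e \<le> \<epsilon>" "e \<le> m" "m * e \<le> \<epsilon>" "2 * q \<le> \<epsilon>" "e < \<delta>"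
  proof -
    have "m * q \<le> m" using mult_left_mono[OF q(2), of m] m by simp
    moreover have "m * (m * q) = m\<^sup>2 * q" by (simp add: power2_eq_square)
    ultimately show "0 < e" "e \<le> \<epsilon>" "e \<le> m" "m * e \<le> \<epsilon>" "2 * q \<le> \<epsilon>" "e < \<delta>"
      unfolding e_def using mm q2 q3 \<epsilon> by linarith+
  qed
  \<comment> \<open>The square pays for the weight \<open>q\<close> of inactive functions:
    \<open>q\<close> times twice the increase of \<open>g t\<close> is at most
    \<open>m * \<eta>\<close>, and this must leave an increase of order \<open>q\<close>. It also
    yields the gap \<open>m * \<eta> \<le> e\<^sup>2\<close> for Ekeland's principle.\<close>
  define \<eta> where "\<eta> = q\<^sup>2"
  have \<eta>: "0 < \<eta>" using q by (simp add: \<eta>_def)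
  \<comment> \<open>After recentring, an inactive function would have a multiplier that need not be
    small; the weight \<open>q\<close> scales it down to at most \<open>2 * q\<close>.\<close>
  define \<kappa> where "\<kappa> t = (if g t x0 < 0 then q else 1)" for t
  have \<kappa>: "0 < \<kappa> t" "q \<le> \<kappa> t" "\<kappa> t \<le> 1" for t using q by (auto simp: \<kappa>_def)
  define \<psi> where "\<psi> t x = \<kappa> t * soft_pos \<eta> (g t x - g t x0)" for t x
  have \<psi>pos: "0 < \<psi> t x" for t x using \<kappa> soft_pos_pos[OF \<eta>] by (simp add: \<psi>_def)
  have "\<psi> t x0 \<le> \<eta>" for t using \<kappa>[of t] \<eta> by (simp add: \<psi>_def soft_pos_0 mult_left_le_one_le)
  then have \<psi>0: "(\<Sum>t\<in>F. \<psi> t x0) \<le> m * \<eta>"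
    using sum_mono[of F "\<lambda>t. \<psi> t x0" "\<lambda>_. \<eta>"] by (simp add: m_def)
  have "m * \<eta> \<le> e\<^sup>2"
  proof -
    have "e\<^sup>2 = m * (m * \<eta>)" by (simp add: e_def \<eta>_def power2_eq_square)
    moreover have "m * \<eta> \<le> m * (m * \<eta>)" using m \<eta> by (intro mult_left_mono) auto
    ultimately show ?thesis by simp
  qed
  obtain j where j: "j \<in> F" using ne by blast
  obtain z and p :: "'i \<Rightarrow> 'a dual" where zD: "\<And>t. t \<in> F \<Longrightarrow> z t \<in> D t" and zx: "\<And>t. t \<in> F \<Longrightarrow> norm (z t - x0) \<le> e"
    and val: "(\<Sum>t\<in>F. \<psi> t (z t)) + 1 * (\<Sum>t\<in>F. norm (z t - z j)) \<le> (\<Sum>t\<in>F. \<psi> t x0)"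
    and sub: "\<And>t x. t \<in> F \<Longrightarrow> x \<in> D t \<Longrightarrow> p t (x - z t) \<le> \<psi> t x - \<psi> t (z t)"
    and opt: "\<And>x. 1 * (\<Sum>t\<in>F. norm (z t - z j)) \<le> (\<Sum>t\<in>F. p t (x t - z t)) +
      1 * (\<Sum>t\<in>F. norm (x t - x j)) + e * (\<Sum>t\<in>F. norm (x t - z t))"
  proof (rule coupled_almost_minimizer[OF fin j, of D \<psi> x0 1 e])
    show "convex_on (D t) (\<psi> t)" if "t \<in> F" for t
      unfolding \<psi>_def using conv[OF that] \<kappa>[of t] by (intro convex_on_soft_pos_comp) auto
    show "closed {x \<in> D t. \<psi> t x \<le> c}" if "t \<in> F" for t c
      unfolding \<psi>_def using closed[OF that] \<kappa>(1) \<eta> by (rule closed_sublevel_soft_pos_comp)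
    fix x :: "'i \<Rightarrow> 'a"
    have "0 \<le> (\<Sum>t\<in>F. \<psi> t (x t)) + 1 * (\<Sum>t\<in>F. norm (x t - x j))"
      using \<psi>pos by (auto intro!: add_nonneg_nonneg sum_nonneg simp: less_imp_le)
    then show "(\<Sum>t\<in>F. \<psi> t x0) - e\<^sup>2 \<le> (\<Sum>t\<in>F. \<psi> t (x t)) + 1 * (\<Sum>t\<in>F. norm (x t - x j))"
      using \<psi>0 \<open>m * \<eta> \<le> e\<^sup>2\<close> by linarith
  qed (use x0 e that in auto)
  define l where "l t = \<kappa> t * soft_pos_deriv \<eta> (g t (z t) - g t x0)" for t
  have gz: "g t (z t) - g t x0 \<le> e" if t: "t \<in> F" for t
  proof -
    have "\<psi> t (z t) \<le> (\<Sum>t\<in>F. \<psi> t (z t))"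
      using member_le_sum[OF t _ fin, of "\<lambda>t. \<psi> t (z t)"] \<psi>pos by (simp add: less_imp_le)
    also have "\<dots> \<le> m * \<eta>" using val \<psi>0 sum_nonneg[of F "\<lambda>t. norm (z t - z j)"] by simp
    finally have *: "\<kappa> t * soft_pos \<eta> (g t (z t) - g t x0) \<le> m * \<eta>" by (simp add: \<psi>_def)
    show ?thesis
    proof (cases "g t (z t) - g t x0 \<le> 0")
      case False
      have "q * (2 * (g t (z t) - g t x0)) \<le> \<kappa> t * soft_pos \<eta> (g t (z t) - g t x0)"
        using False \<kappa>[of t] soft_pos_ge[OF \<eta>, of "g t (z t) - g t x0"] by (intro mult_mono) auto
      then have "q * (2 * (g t (z t) - g t x0)) \<le> q * (m * q)"
        using * by (simp add: \<eta>_def power2_eq_square algebra_simps)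
      then have "2 * (g t (z t) - g t x0) \<le> m * q" using q(1) by (rule mult_left_le_imp_le)
      then show ?thesis using False by (simp add: e_def)
    qed (use e in linarith)
  qed
  show thesis
  proof (rule that[of z l p])
    show "z t \<in> D t \<and> norm (z t - x0) \<le> \<epsilon> \<and> g t (z t) \<le> g t x0 + \<epsilon>" if "t \<in> F" for t
      using zD[OF that] zx[OF that] gz[OF that] e(2) by linarith
    show "0 < l t \<and> l t \<le> 2 \<and> (g t x0 < 0 \<longrightarrow> l t \<le> \<epsilon>)" for t
    proof -
      have d: "0 < soft_pos_deriv \<eta> (g t (z t) - g t x0)" "soft_pos_deriv \<eta> (g t (z t) - g t x0) \<le> 2"
        using soft_pos_deriv_bounds[OF \<eta>] by auto
      then have "l t \<le> \<kappa> t * 2" unfolding l_def using \<kappa>[of t] by (intro mult_left_mono) auto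
      moreover have "0 < l t" using d \<kappa>[of t] by (simp add: l_def)
      moreover have "g t x0 < 0 \<longrightarrow> \<kappa> t = q" by (simp add: \<kappa>_def)
      ultimately show ?thesis using \<kappa>[of t] e(5) by auto
    qed
    show "p t (x - z t) \<le> l t * (g t x - g t (z t))" if "t \<in> F" "x \<in> D t" for t x
      unfolding l_def using sub[OF that(1)] that(2)
      by (intro subgradient_soft_pos_comp[OF conv[OF that(1)] zD[OF that(1)] \<eta> \<kappa>(1) bounded_linear.linear[OF blinfun.bounded_linear_right]])
        (auto simp: \<psi>_def)
    show "norm (p t) \<le> 3 * real (card F)" if t: "t \<in> F" for t
    proof -
      have *: "- p t h \<le> (2 * m + e) * norm h" for h
      proof -
        \<comment> \<open>Moving a single copy bounds a single dual vector: the penalty grows by at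
          most \<open>2 * m * norm h\<close>, the Ekeland term by \<open>e * norm h\<close>.\<close>
        let ?x = "z(t := z t + h)"
        have "norm (?x s - ?x j) \<le> norm (z s - z j) + 2 * norm h" for s
        proof -
          have "norm (?x s - ?x j) \<le> norm (z s - z j) + norm ((?x s - z s) - (?x j - z j))"
            using norm_triangle_ineq[of "z s - z j" "(?x s - z s) - (?x j - z j)"] by (simp add: algebra_simps)
          moreover have "norm ((?x s - z s) - (?x j - z j)) \<le> norm (?x s - z s) + norm (?x j - z j)"
            by (rule norm_triangle_ineq4)
          moreover have "norm (?x s - z s) \<le> norm h" "norm (?x j - z j) \<le> norm h" by auto
          ultimately show ?thesis by linarith
        qed
        then have "(\<Sum>s\<in>F. norm (?x s - ?x j)) \<le> (\<Sum>s\<in>F. norm (z s - z j) + 2 * norm h)" by (intro sum_mono)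
        also have "\<dots> = (\<Sum>s\<in>F. norm (z s - z j)) + 2 * m * norm h" by (simp add: sum.distrib m_def)
        finally have 1: "(\<Sum>s\<in>F. norm (?x s - ?x j)) \<le> (\<Sum>s\<in>F. norm (z s - z j)) + 2 * m * norm h" .
        have "(\<Sum>s\<in>F. norm (?x s - z s)) = (\<Sum>s\<in>F. if s = t then norm h else 0)"
          by (intro sum.cong) auto
        then have 2: "(\<Sum>s\<in>F. norm (?x s - z s)) = norm h" using fin t by simp
        have "(\<Sum>s\<in>F. p s (?x s - z s)) = (\<Sum>s\<in>F. if s = t then p t h else 0)"
          by (intro sum.cong) auto
        then have 3: "(\<Sum>s\<in>F. p s (?x s - z s)) = p t h" using fin t by simp
        show ?thesis using opt[of ?x] 1 unfolding 2 3 distrib_right by linarith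
      qed
      have "norm (p t h) \<le> (2 * m + e) * norm h" for h
        using *[of h] *[of "- h"] by (simp add: blinfun.minus_right abs_le_iff)
      moreover have "0 \<le> 2 * m + e" using m e by simp
      ultimately have "norm (p t) \<le> 2 * m + e" by (intro norm_blinfun_bound) (auto simp: mult.commute)
      then show ?thesis using e(3) by (simp add: m_def)
    qed
    show "norm (\<Sum>t\<in>F. p t) \<le> \<epsilon>"
    proof -
      \<comment> \<open>Translating all copies together leaves the penalty unchanged, so only the
        Ekeland term is paid.\<close>
      have *: "- (\<Sum>t\<in>F. p t) h \<le> m * e * norm h" for h
        using opt[of "\<lambda>t. z t + h"] by (simp add: blinfun.sum_left m_def algebra_simps)
      have "norm ((\<Sum>t\<in>F. p t) h) \<le> (m * e) * norm h" for h
        using *[of h] *[of "- h"] by (simp add: blinfun.minus_right abs_le_iff)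
      then have "norm (\<Sum>t\<in>F. p t) \<le> m * e" using m e by (intro norm_blinfun_bound) auto
      then show ?thesis using e(4) by simp
    qed
    show "(\<exists>t\<in>F. 1 \<le> l t) \<or> (\<exists>t\<in>F. 1 - \<epsilon> \<le> norm (p t))"
    proof (cases "\<forall>t\<in>F. z t = z j")
      case True
      \<comment> \<open>All copies agree, so their common point lies in every domain and some
        \<open>g t\<close> is nonnegative there. As \<open>e < \<delta>\<close>, this
        \<open>t\<close> is active: its weight is 1 and \<open>soft_pos_deriv\<close> is taken at a
        nonnegative argument.\<close>
      then obtain t where t: "t \<in> F" "0 \<le> g t (z t)" using max_nonneg[of "z j"] zD by metis
      have "\<not> g t x0 < 0" using gz[OF t(1)] t \<delta>(2) e(6) by force
      then have "\<kappa> t = 1" "0 \<le> g t (z t) - g t x0" using t g0[OF t(1)] by (auto simp: \<kappa>_def)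
      then have "1 \<le> l t" using soft_pos_deriv_bounds(3)[OF \<eta>] by (simp add: l_def)
      then show ?thesis using t(1) by blast
    next
      case False
      then obtain t where t: "t \<in> F" "z t \<noteq> z j" by blast
      \<comment> \<open>Moving copy \<open>t\<close> onto copy \<open>j\<close> saves
        \<open>norm ?h\<close> of the penalty and costs \<open>e * norm ?h\<close> in the Ekeland
        term; by optimality \<open>p t\<close> has to compensate the difference.\<close>
      let ?x = "z(t := z j)" and ?h = "z j - z t"
      have "(\<Sum>s\<in>F. norm (?x s - z s)) = (\<Sum>s\<in>F. if s = t then norm ?h else 0)"
        by (intro sum.cong) auto
      then have 2: "(\<Sum>s\<in>F. norm (?x s - z s)) = norm ?h" using fin t by simp
      have "(\<Sum>s\<in>F. p s (?x s - z s)) = (\<Sum>s\<in>F. if s = t then p t ?h else 0)"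
        by (intro sum.cong) auto
      then have 3: "(\<Sum>s\<in>F. p s (?x s - z s)) = p t ?h" using fin t by simp
      have "(\<Sum>s\<in>F. norm (?x s - ?x j)) = (\<Sum>s\<in>F. norm (z s - z j) - (if s = t then norm ?h else 0))"
        using t(2) by (intro sum.cong) (auto simp: norm_minus_commute)
      then have 1: "(\<Sum>s\<in>F. norm (?x s - ?x j)) = (\<Sum>s\<in>F. norm (z s - z j)) - norm ?h"
        using fin t by (simp add: sum_subtractf)
      have "(1 - e) * norm ?h \<le> p t ?h"
        using opt[of ?x] unfolding 1 2 3 by (simp add: left_diff_distrib)
      also have "\<dots> \<le> norm (p t) * norm ?h" using norm_blinfun[of "p t" ?h] by simp
      finally have "1 - e \<le> norm (p t)" using t(2) by simp
      then show ?thesis using t(1) e(2) by (intro disjI2 bexI[of _ t]) auto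
    qed
  qed
qed

section \<open>The exact maximum rule\<close>

lemma compact_Pi_cball:
  fixes b :: "'k \<Rightarrow> real"
  shows "compact {g. \<forall>k. g k \<in> cball (0::real) (b k)}"
proof -
  have "compactin (product_topology (\<lambda>k. euclidean) UNIV) (PiE UNIV (\<lambda>k. cball (0::real) (b k)))"
    unfolding compactin_PiE by simp
  moreover have "PiE UNIV (\<lambda>k. cball (0::real) (b k)) = {g. \<forall>k. g k \<in> cball (0::real) (b k)}" by auto
  ultimately show ?thesis by (simp add: euclidean_product_topology)
qed

lemma tendsto_coordinate:
  assumes "(s \<longlongrightarrow> (l :: 'k \<Rightarrow> 'b::topological_space)) F"
  shows "((\<lambda>n. s n k) \<longlongrightarrow> l k) F"
proof (rule topological_tendstoI)
  fix S assume "open S" "l k \<in> S"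
  moreover have "continuous_on UNIV (\<lambda>g :: 'k \<Rightarrow> 'b. g k)" by (rule continuous_on_product_coordinates)
  ultimately have "open ((\<lambda>g :: 'k \<Rightarrow> 'b. g k) -` S)" by (metis open_vimage)
  then show "\<forall>\<^sub>F n in F. s n k \<in> S"
    using topological_tendstoD[OF assms] \<open>l k \<in> S\<close> by fastforce
qed

text \<open>Tychonoff's theorem replaces sequential weak* compactness of dual balls: instead of a
  subsequence there is a finer filter along which everything converges.\<close>

lemma bounded_convergent_subfilter:
  fixes s :: "nat \<Rightarrow> 'k \<Rightarrow> real"
  assumes "\<And>n k. \<bar>s n k\<bar> \<le> b k"
  obtains G l where "G \<noteq> bot" "G \<le> sequentially" "\<And>k. ((\<lambda>n. s n k) \<longlongrightarrow> l k) G" "\<And>k. \<bar>l k\<bar> \<le> b k"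
proof -
  let ?U = "{g. \<forall>k. g k \<in> cball (0::real) (b k)}"
  have "\<forall>\<^sub>F g in filtermap s sequentially. g \<in> ?U" using assms by (simp add: eventually_filtermap)
  moreover have "filtermap s sequentially \<noteq> bot" by (simp add: filtermap_bot_iff)
  ultimately obtain l where l: "l \<in> ?U" "inf (nhds l) (filtermap s sequentially) \<noteq> bot"
    using compact_Pi_cball[of b] unfolding compact_filter by blast
  \<comment> \<open>Generated by the sets of late indices whose values lie near the cluster point
    \<open>l\<close>; being a cluster point is exactly what makes this filter proper.\<close>
  define G where "G = inf (filtercomap s (nhds l)) sequentially"
  have "G \<noteq> bot"
  proof
    assume "G = bot"
    then have "eventually (\<lambda>_. False) G" by simp
    then obtain P Q where PQ: "eventually P (filtercomap s (nhds l))" "eventually Q sequentially" "\<And>n. P n \<Longrightarrow> Q n \<Longrightarrow> False"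
      unfolding G_def eventually_inf by blast
    then obtain R where R: "eventually R (nhds l)" "\<And>n. R (s n) \<Longrightarrow> P n" unfolding eventually_filtercomap by blast
    have "eventually (\<lambda>g. \<not> R g) (filtermap s sequentially)"
      unfolding eventually_filtermap using PQ(2) by eventually_elim (use PQ(3) R(2) in blast)
    then have "eventually (\<lambda>_. False) (inf (nhds l) (filtermap s sequentially))"
      unfolding eventually_inf using R(1) by blast
    then show False using l(2) by (simp add: eventually_False)
  qed
  moreover have "(s \<longlongrightarrow> l) G" unfolding G_def filterlim_iff_le_filtercomap by simp
  then have "((\<lambda>n. s n k) \<longlongrightarrow> l k) G" for k by (rule tendsto_coordinate)
  ultimately show thesis using that[of G l] l(1) by (simp add: G_def)
qed

text \<open>The real-valued counterpart of \<open>subdifferential\<close>, with the domain kept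
  apart. Membership of \<open>x\<close> in \<open>D\<close> is not included;
  \<open>subdifferential_iff\<close> states it separately.\<close>

definition subgradients :: "'a::real_normed_vector set \<Rightarrow> ('a \<Rightarrow> real) \<Rightarrow> 'a \<Rightarrow> 'a dual set" where
  "subgradients D g x = {v. \<forall>y\<in>D. blinfun_apply v (y - x) \<le> g y - g x}"

definition normals :: "'a::real_normed_vector set \<Rightarrow> 'a \<Rightarrow> 'a dual set" where
  "normals D x = {v. \<forall>y\<in>D. blinfun_apply v (y - x) \<le> 0}"

text \<open>A passage to the limit in \<open>approximate_multipliers\<close>: a positive limit
  multiplier leaves a subgradient, a zero one leaves a normal, and division by the sum of the
  multipliers normalizes. Convergence holds only along a filter on the indices, which is why
  \<open>compactness\<close> is phrased with \<open>G\<close>.\<close>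

lemma max_subgradient_decomposition:
  fixes D :: "'i \<Rightarrow> 'a::banach set" and g :: "'i \<Rightarrow> 'a \<Rightarrow> real"
  assumes fin: "finite F" and ne: "F \<noteq> {}"
    and conv: "\<And>t. t \<in> F \<Longrightarrow> convex_on (D t) (g t)"
    and closed: "\<And>t c. t \<in> F \<Longrightarrow> closed {x \<in> D t. g t x \<le> c}"
    and x0: "\<And>t. t \<in> F \<Longrightarrow> x0 \<in> D t" and g0: "\<And>t. t \<in> F \<Longrightarrow> g t x0 \<le> 0"
    and max_nonneg: "\<And>x. (\<And>t. t \<in> F \<Longrightarrow> x \<in> D t) \<Longrightarrow> \<exists>t\<in>F. 0 \<le> g t x"
    and qual: "\<And>w. (\<And>t. t \<in> F \<Longrightarrow> w t \<in> normals (D t) x0) \<Longrightarrow> (\<Sum>t\<in>F. w t) = 0 \<Longrightarrow> \<forall>t\<in>F. w t = 0"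
    and compactness: "\<And>t G l y v. t \<in> F - {t0} \<Longrightarrow> G \<noteq> bot \<Longrightarrow>
      (\<And>n::nat. 0 < l n \<and> y n \<in> D t \<and> v n \<in> subgradients (D t) (g t) (y n)) \<Longrightarrow>
      (l \<longlongrightarrow> 0) G \<Longrightarrow> (y \<longlongrightarrow> x0) G \<Longrightarrow> ((\<lambda>n. g t (y n)) \<longlongrightarrow> g t x0) G \<Longrightarrow>
      (\<And>h. ((\<lambda>n. l n * v n h) \<longlongrightarrow> 0) G) \<Longrightarrow> ((\<lambda>n. norm (l n *\<^sub>R v n)) \<longlongrightarrow> 0) G"
  obtains \<alpha> v w where "(\<Sum>t\<in>F. \<alpha> t) = 1" "\<And>t. t \<in> F \<Longrightarrow> 0 \<le> \<alpha> t"
    "\<And>t. t \<in> F \<Longrightarrow> 0 < \<alpha> t \<Longrightarrow> g t x0 = 0 \<and> v t \<in> subgradients (D t) (g t) x0"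
    "\<And>t. t \<in> F \<Longrightarrow> w t \<in> normals (D t) x0"
    "(\<Sum>t\<in>F. \<alpha> t *\<^sub>R v t) + (\<Sum>t\<in>F. w t) = 0"
proof -
  define \<epsilon> where "\<epsilon> n = inverse (real (Suc n))" for n
  have \<epsilon>pos: "0 < \<epsilon> n" for n by (simp add: \<epsilon>_def)
  have \<epsilon>0: "\<epsilon> \<longlonglongrightarrow> 0" unfolding \<epsilon>_def by (rule LIMSEQ_inverse_real_of_nat)
  define approx where "approx n z p l \<longleftrightarrow>
      (\<forall>t\<in>F. z t \<in> D t \<and> norm (z t - x0) \<le> \<epsilon> n \<and> g t (z t) \<le> g t x0 + \<epsilon> n) \<and>
      (\<forall>t\<in>F. 0 < l t \<and> l t \<le> 2 \<and> (g t x0 < 0 \<longrightarrow> l t \<le> \<epsilon> n)) \<and>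
      (\<forall>t\<in>F. \<forall>x\<in>D t. blinfun_apply (p t) (x - z t) \<le> l t * (g t x - g t (z t))) \<and>
      (\<forall>t\<in>F. norm (p t) \<le> 3 * real (card F)) \<and>
      norm (\<Sum>t\<in>F. p t) \<le> \<epsilon> n \<and>
      ((\<exists>t\<in>F. 1 \<le> l t) \<or> (\<exists>t\<in>F. 1 - \<epsilon> n \<le> norm (p t)))"
    for n and z :: "'i \<Rightarrow> 'a" and p :: "'i \<Rightarrow> 'a dual" and l
  have "\<exists>z p l. approx n z p l" for n
    unfolding approx_def
    by (rule approximate_multipliers[OF fin ne conv closed x0 g0 max_nonneg \<epsilon>pos[of n]]) blast+
  then obtain z p l where approx: "\<And>n. approx n (z n) (p n) (l n)" by metis
  have z: "z n t \<in> D t \<and> norm (z n t - x0) \<le> \<epsilon> n \<and> g t (z n t) \<le> g t x0 + \<epsilon> n"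
    and l: "0 < l n t \<and> l n t \<le> 2 \<and> (g t x0 < 0 \<longrightarrow> l n t \<le> \<epsilon> n)"
    and sub: "x \<in> D t \<Longrightarrow> p n t (x - z n t) \<le> l n t * (g t x - g t (z n t))"
    and pb: "norm (p n t) \<le> 3 * real (card F)" if "t \<in> F" for n t x
    using approx[of n] that unfolding approx_def by blast+
  have psum: "norm (\<Sum>t\<in>F. p n t) \<le> \<epsilon> n"
    and nontriv: "(\<exists>t\<in>F. 1 \<le> l n t) \<or> (\<exists>t\<in>F. 1 - \<epsilon> n \<le> norm (p n t))" for n
    using approx[of n] unfolding approx_def by blast+
  \<comment> \<open>The multipliers, under \<open>None\<close>, and all values of the dual vectors,
    under \<open>Some x\<close>, form one pointwise bounded family, so that a single filter makes
    everything converge.\<close>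
  define s where "s n = (\<lambda>(t, h). if t \<in> F then (case h of None \<Rightarrow> l n t | Some x \<Rightarrow> p n t x) else 0)" for n
  define b where "b = (\<lambda>(t :: 'i, h :: 'a option). case h of None \<Rightarrow> 2 | Some x \<Rightarrow> 3 * real (card F) * norm x)"
  have "\<bar>s n k\<bar> \<le> b k" for n k
  proof -
    obtain t h where k: "k = (t, h)" by (cases k)
    have "\<bar>p n t x\<bar> \<le> 3 * real (card F) * norm x" if "t \<in> F" for x
      using norm_blinfun[of "p n t" x] mult_right_mono[OF pb[OF that, of n] norm_ge_zero[of x]] by simp
    then show ?thesis using l[of t n] by (cases h) (auto simp: k s_def b_def)
  qed
  then obtain G lim where G: "G \<noteq> bot" "G \<le> sequentially" and lim: "\<And>k. ((\<lambda>n. s n k) \<longlongrightarrow> lim k) G"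
    and limb: "\<And>k. \<bar>lim k\<bar> \<le> b k"
    using bounded_convergent_subfilter by metis
  have ex\<Lambda>: "((\<lambda>n. l n t) \<longlongrightarrow> lim (t, None)) G" and exP: "((\<lambda>n. p n t x) \<longlongrightarrow> lim (t, Some x)) G"
    if "t \<in> F" for t x
    using lim[of "(t, None)"] lim[of "(t, Some x)"] that by (simp_all add: s_def)
  define \<Lambda> where "\<Lambda> t = lim (t, None)" for t
  have \<Lambda>: "((\<lambda>n. l n t) \<longlongrightarrow> \<Lambda> t) G" if "t \<in> F" for t using ex\<Lambda>[OF that] by (simp add: \<Lambda>_def)
  have "\<exists>P :: 'a dual. \<forall>x. P x = lim (t, Some x)" if t: "t \<in> F" for t
  proof -
    \<comment> \<open>The limit is pointwise, so linearity is inherited; the uniform bound on the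
      norms makes the limit functional bounded.\<close>
    have "linear (\<lambda>x. lim (t, Some x))"
    proof (rule linearI)
      show "lim (t, Some (x + y)) = lim (t, Some x) + lim (t, Some y)" for x y
        using tendsto_add[OF exP[OF t, of x] exP[OF t, of y]] exP[OF t, of "x + y"] G(1)
        by (intro tendsto_unique[of G]) (auto simp: blinfun.add_right)
      show "lim (t, Some (c *\<^sub>R x)) = c *\<^sub>R lim (t, Some x)" for c x
        using tendsto_mult[OF tendsto_const[of c] exP[OF t, of x]] exP[OF t, of "c *\<^sub>R x"] G(1)
        by (intro tendsto_unique[of G]) (auto simp: blinfun.scaleR_right)
    qed
    moreover have "lim (t, Some x) \<le> (3 * real (card F)) * norm x" for x
      using limb[of "(t, Some x)"] by (simp add: b_def)
    ultimately obtain P :: "'a dual" where "\<And>x. P x = lim (t, Some x)" by (rule blinfun_of_linear) blast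
    then show ?thesis by blast
  qed
  then have "\<forall>t\<in>F. \<exists>P :: 'a dual. \<forall>x. P x = lim (t, Some x)" by blast
  from bchoice[OF this] obtain P :: "'i \<Rightarrow> 'a dual"
    where "\<And>t x. t \<in> F \<Longrightarrow> P t x = lim (t, Some x)" by blast
  then have P: "((\<lambda>n. p n t x) \<longlongrightarrow> P t x) G" if "t \<in> F" for t x using exP that by simp
  have \<epsilon>G: "(\<epsilon> \<longlongrightarrow> 0) G" using \<epsilon>0 G(2) by (rule tendsto_mono[rotated])
  have zG: "((\<lambda>n. z n t) \<longlongrightarrow> x0) G" if "t \<in> F" for t
  proof (rule LIM_zero_cancel, rule Lim_null_comparison[OF _ \<epsilon>G])
    show "\<forall>\<^sub>F n in G. norm (z n t - x0) \<le> \<epsilon> n" using z[OF that] by simp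
  qed
  \<comment> \<open>The lower estimate is lower semicontinuity, argued along
    \<open>sequentially\<close> and handed down to \<open>G\<close>; the upper one is
    \<open>g t (z n t) \<le> g t x0 + \<epsilon> n\<close>.\<close>
  have gG: "((\<lambda>n. g t (z n t)) \<longlongrightarrow> g t x0) G" if t: "t \<in> F" for t
  proof (rule order_tendstoI)
    fix a assume "a < g t x0"
    have "(\<lambda>n. z n t) \<longlonglongrightarrow> x0"
    proof (rule LIM_zero_cancel, rule Lim_null_comparison[OF _ \<epsilon>0])
      show "\<forall>\<^sub>F n in sequentially. norm (z n t - x0) \<le> \<epsilon> n" using z[OF t] by simp
    qed
    then have "\<forall>\<^sub>F n in sequentially. a < g t (z n t)"
      using \<open>a < g t x0\<close> z[OF t] by (intro eventually_gt_of_closed_sublevel[OF closed[OF t]]) auto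
    then show "\<forall>\<^sub>F n in G. a < g t (z n t)" using G(2) by (rule filter_leD[rotated])
  next
    fix a assume "g t x0 < a"
    then have "\<forall>\<^sub>F n in G. \<epsilon> n < a - g t x0" using \<epsilon>G by (intro order_tendstoD) auto
    then show "\<forall>\<^sub>F n in G. g t (z n t) < a" by eventually_elim (use z[OF t] in \<open>smt (verit)\<close>)
  qed
  have limit: "P t (y - x0) \<le> \<Lambda> t * (g t y - g t x0)" if t: "t \<in> F" and y: "y \<in> D t" for t y
  proof -
    have "((\<lambda>n. p n t (z n t - x0)) \<longlongrightarrow> 0) G"
    proof (rule Lim_null_comparison)
      show "\<forall>\<^sub>F n in G. norm (p n t (z n t - x0)) \<le> 3 * real (card F) * \<epsilon> n"
      proof (intro always_eventually allI)
        fix n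
        have "norm (p n t) * norm (z n t - x0) \<le> 3 * real (card F) * \<epsilon> n"
          using pb[OF t, of n] z[OF t, of n] by (intro mult_mono) auto
        then show "norm (p n t (z n t - x0)) \<le> 3 * real (card F) * \<epsilon> n"
          using norm_blinfun[of "p n t" "z n t - x0"] by linarith
      qed
      show "((\<lambda>n. 3 * real (card F) * \<epsilon> n) \<longlongrightarrow> 0) G" using tendsto_mult_right_zero[OF \<epsilon>G] .
    qed
    from tendsto_diff[OF P[OF t, of "y - x0"] this]
    have "((\<lambda>n. p n t (y - z n t)) \<longlongrightarrow> P t (y - x0)) G" by (simp add: blinfun.diff_right)
    moreover have "((\<lambda>n. l n t * (g t y - g t (z n t))) \<longlongrightarrow> \<Lambda> t * (g t y - g t x0)) G"
      by (intro tendsto_intros \<Lambda> gG t)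
    ultimately show ?thesis using sub[OF t y] G(1) by (intro tendsto_le[of G]) auto
  qed
  have \<Lambda>0: "0 \<le> \<Lambda> t" if "t \<in> F" for t
    using \<Lambda>[OF that] l[OF that] G(1) by (intro tendsto_lowerbound[of _ _ G]) (auto simp: less_imp_le)
  have inactive: "\<Lambda> t = 0" if t: "t \<in> F" "g t x0 < 0" for t
  proof (rule tendsto_unique[OF G(1) \<Lambda>[OF t(1)]], rule Lim_null_comparison[OF _ \<epsilon>G])
    show "\<forall>\<^sub>F n in G. norm (l n t) \<le> \<epsilon> n" using l[OF t(1)] t(2) by (simp add: less_imp_le)
  qed
  have Psum: "(\<Sum>t\<in>F. P t) = 0"
  proof (rule blinfun_eqI)
    fix x
    have "((\<lambda>n. \<Sum>t\<in>F. p n t x) \<longlongrightarrow> (\<Sum>t\<in>F. P t x)) G" by (intro tendsto_sum P)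
    moreover have "((\<lambda>n. \<Sum>t\<in>F. p n t x) \<longlongrightarrow> 0) G"
    proof (rule Lim_null_comparison)
      show "\<forall>\<^sub>F n in G. norm (\<Sum>t\<in>F. p n t x) \<le> \<epsilon> n * norm x"
      proof (intro always_eventually allI)
        fix n
        show "norm (\<Sum>t\<in>F. p n t x) \<le> \<epsilon> n * norm x"
          using norm_blinfun[of "\<Sum>t\<in>F. p n t" x] mult_right_mono[OF psum[of n] norm_ge_zero[of x]]
          by (simp add: blinfun.sum_left)
      qed
      show "((\<lambda>n. \<epsilon> n * norm x) \<longlongrightarrow> 0) G" using tendsto_mult_left_zero[OF \<epsilon>G] .
    qed
    ultimately show "blinfun_apply (\<Sum>t\<in>F. P t) x = blinfun_apply 0 x"
      using tendsto_unique[OF G(1)] by (auto simp: blinfun.sum_left)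
  qed
  have normal: "P t \<in> normals (D t) x0" if "t \<in> F" "\<Lambda> t = 0" for t
    using limit[OF that(1)] that(2) by (simp add: normals_def)
  define \<sigma> where "\<sigma> = (\<Sum>t\<in>F. \<Lambda> t)"
  have \<sigma>: "0 < \<sigma>"
  proof (rule ccontr)
    assume "\<not> 0 < \<sigma>"
    moreover have "\<Lambda> t \<le> \<sigma>" if "t \<in> F" for t
      unfolding \<sigma>_def using that \<Lambda>0 fin by (intro member_le_sum) auto
    ultimately have z\<Lambda>: "\<Lambda> t = 0" if "t \<in> F" for t using \<Lambda>0[OF that] that by fastforce
    then have P0: "P t = 0" if "t \<in> F" for t using qual[of P] normal Psum that by blast
    have small: "((\<lambda>n. norm (p n t)) \<longlongrightarrow> 0) G" if t: "t \<in> F - {t0}" for t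
    proof -
      \<comment> \<open>Dividing by the positive multiplier gives a subgradient of
        \<open>g t\<close> itself, the form in which \<open>compactness\<close> applies.\<close>
      define v where "v n = (1 / l n t) *\<^sub>R p n t" for n
      have lv: "l n t *\<^sub>R v n = p n t" for n using l[of t n] t by (simp add: v_def)
      have "((\<lambda>n. norm (l n t *\<^sub>R v n)) \<longlongrightarrow> 0) G"
      proof (rule compactness[OF t G(1), of "\<lambda>n. l n t" "\<lambda>n. z n t" v])
        fix n
        have "v n \<in> subgradients (D t) (g t) (z n t)"
          unfolding subgradients_def mem_Collect_eq
        proof
          fix x assume "x \<in> D t"
          then have "p n t (x - z n t) \<le> l n t * (g t x - g t (z n t))" using sub t by blast
          then show "v n (x - z n t) \<le> g t x - g t (z n t)"
            using l[of t n] t by (simp add: v_def blinfun.scaleR_left divide_le_eq mult.commute)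
        qed
        then show "0 < l n t \<and> z n t \<in> D t \<and> v n \<in> subgradients (D t) (g t) (z n t)"
          using l z t by blast
      next
        fix h
        have "l n t * v n h = p n t h" for n using lv[of n] by (metis blinfun.scaleR_left real_scaleR_def)
        then show "((\<lambda>n. l n t * v n h) \<longlongrightarrow> 0) G" using P[of t h] P0[of t] t by simp
      qed (use \<Lambda>[of t] z\<Lambda>[of t] zG gG t in auto)
      then show ?thesis by (simp add: lv)
    qed
    have "((\<lambda>n. norm (p n t)) \<longlongrightarrow> 0) G" if t: "t \<in> F" for t
    proof (cases "t = t0")
      case True
      have sum0: "((\<lambda>n. \<epsilon> n + (\<Sum>s\<in>F - {t0}. norm (p n s))) \<longlongrightarrow> 0) G"
        using tendsto_add[OF \<epsilon>G tendsto_sum[of "F - {t0}", OF small]] by simp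
      have "norm (norm (p n t)) \<le> \<epsilon> n + (\<Sum>s\<in>F - {t0}. norm (p n s))" for n
      proof -
        \<comment> \<open>The index exempt from compactness is recovered from the whole sum, small
          in norm, and the remaining vectors.\<close>
        have "p n t = (\<Sum>s\<in>F. p n s) - (\<Sum>s\<in>F - {t0}. p n s)"
          using True t fin by (simp add: sum.remove)
        then have "norm (p n t) \<le> norm (\<Sum>s\<in>F. p n s) + norm (\<Sum>s\<in>F - {t0}. p n s)"
          by (metis norm_triangle_ineq4)
        then show ?thesis using psum[of n] norm_sum[of "p n" "F - {t0}"] by simp
      qed
      then show ?thesis by (intro Lim_null_comparison[OF _ sum0] always_eventually allI)
    qed (use small t in auto)
    \<comment> \<open>Norms and \<open>\<epsilon> n\<close> below 1/2 together with multipliers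
      below 1 contradict both alternatives of \<open>nontriv\<close>.\<close>
    then have "\<forall>\<^sub>F n in G. \<forall>t\<in>F. norm (p n t) < 1/2"
      using fin by (intro eventually_ball_finite ballI order_tendstoD(2)) auto
    moreover have "\<forall>\<^sub>F n in G. \<forall>t\<in>F. l n t < 1"
    proof (intro eventually_ball_finite fin ballI)
      fix t assume "t \<in> F"
      then show "\<forall>\<^sub>F n in G. l n t < 1" using order_tendstoD(2)[OF \<Lambda>, of t 1] z\<Lambda> by simp
    qed
    moreover have "\<forall>\<^sub>F n in G. \<epsilon> n < 1/2" using \<epsilon>G by (intro order_tendstoD(2)) auto
    ultimately have "\<forall>\<^sub>F n in G. False"
    proof eventually_elim
      case (elim n)
      then show ?case using nontriv[of n] by fastforce
    qed
    then show False using G(1) by simp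
  qed
  \<comment> \<open>If \<open>\<Lambda> t = 0\<close>, then \<open>1 / \<Lambda> t\<close> is 0 and
    \<open>P t\<close> goes into \<open>w t\<close> instead; in either case the two parts contribute
    \<open>P t\<close> divided by \<open>\<sigma>\<close>.\<close>
  define v where "v t = (1 / \<Lambda> t) *\<^sub>R P t" for t
  define w where "w t = (if \<Lambda> t = 0 then (1 / \<sigma>) *\<^sub>R P t else 0)" for t
  show thesis
  proof (rule that[of "\<lambda>t. \<Lambda> t / \<sigma>" v w])
    show "(\<Sum>t\<in>F. \<Lambda> t / \<sigma>) = 1" using \<sigma> by (simp add: sum_divide_distrib[symmetric] \<sigma>_def)
    show "0 \<le> \<Lambda> t / \<sigma>" if "t \<in> F" for t using \<sigma> \<Lambda>0[OF that] by simp
    show "g t x0 = 0 \<and> v t \<in> subgradients (D t) (g t) x0" if t: "t \<in> F" and pos: "0 < \<Lambda> t / \<sigma>" for t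
    proof
      have \<Lambda>t: "0 < \<Lambda> t" using pos \<sigma> by (simp add: zero_less_divide_iff)
      show "g t x0 = 0" using inactive[OF t] g0[OF t] \<Lambda>t by fastforce
      show "v t \<in> subgradients (D t) (g t) x0"
        using limit[OF t] \<Lambda>t by (simp add: subgradients_def v_def blinfun.scaleR_left divide_le_eq mult.commute)
    qed
    show "w t \<in> normals (D t) x0" if "t \<in> F" for t
      using normal[OF that] \<sigma> by (auto simp: w_def normals_def blinfun.scaleR_left divide_le_0_iff)
    have "(\<Lambda> t / \<sigma>) *\<^sub>R v t + w t = (1 / \<sigma>) *\<^sub>R P t" if "t \<in> F" for t
      by (simp add: v_def w_def)
    then have "(\<Sum>t\<in>F. (\<Lambda> t / \<sigma>) *\<^sub>R v t) + (\<Sum>t\<in>F. w t) = (\<Sum>t\<in>F. (1 / \<sigma>) *\<^sub>R P t)"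
      by (simp add: sum.distrib[symmetric])
    then show "(\<Sum>t\<in>F. (\<Lambda> t / \<sigma>) *\<^sub>R v t) + (\<Sum>t\<in>F. w t) = 0"
      by (simp add: scaleR_sum_right[symmetric] Psum)
  qed
qed

section \<open>Reduction to finitely many functions\<close>

text \<open>The coefficient of a new vector \<open>a\<close> is bounded because \<open>a\<close> has
  positive distance from \<open>span E\<close>. The ball is then cut out of a continuous image of a
  compact set.\<close>

lemma compact_span_Int_cball:
  fixes E :: "'a::real_normed_vector set"
  assumes "finite E"
  shows "compact (span E \<inter> cball 0 r)"
  using assms
proof (induction E arbitrary: r)
  case empty
  then show ?case by (intro finite_imp_compact) simp
next
  case (insert a E)
  show ?case
  proof (cases "a \<in> span E")
    case True
    then show ?thesis using insert.IH span_redundant by metis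
  next
    case False
    \<comment> \<open>Points of \<open>span E\<close> within distance 1 of \<open>a\<close> have
      norm at most \<open>norm a + 1\<close>, so this part, compact by induction, already decides
      the distance.\<close>
    define S where "S = span E \<inter> cball 0 (norm a + 1)"
    have "closed S" unfolding S_def using insert.IH by (rule compact_imp_closed)
    then have "open (- S)" by (rule open_Compl)
    moreover have "a \<in> - S" using False by (simp add: S_def)
    ultimately have "open (- S)" "a \<in> - S" .
    then obtain d where d: "0 < d" "ball a d \<subseteq> - S" using open_contains_ball by blast
    define \<delta> where "\<delta> = min d 1"
    have \<delta>: "0 < \<delta>" using d by (simp add: \<delta>_def)
    have far: "\<delta> \<le> norm (a - s)" if s: "s \<in> span E" for s
    proof (rule ccontr)
      assume "\<not> \<delta> \<le> norm (a - s)"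
      then have "norm (a - s) < d" "norm (a - s) < 1" by (auto simp: \<delta>_def)
      moreover have "norm s \<le> norm a + norm (a - s)" using norm_triangle_sub[of s a] by (simp add: norm_minus_commute)
      ultimately have "s \<in> S" "s \<in> ball a d" using s by (auto simp: S_def dist_norm)
      then show False using d(2) by blast
    qed
    define R where "R = r / \<delta>"
    define B where "B = (span E \<inter> cball 0 (r + R * norm a)) \<times> cball (0::real) R"
    have "span (insert a E) \<inter> cball 0 r = (\<lambda>(s, c). s + c *\<^sub>R a) ` B \<inter> cball 0 r"
    proof (intro equalityI subsetI)
      fix x assume x: "x \<in> span (insert a E) \<inter> cball 0 r"
      then obtain c where c: "x - c *\<^sub>R a \<in> span E" by (auto simp: span_insert)
      have "\<bar>c\<bar> * \<delta> \<le> norm x"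
      proof (cases "c = 0")
        case False
        have "(- 1 / c) *\<^sub>R (x - c *\<^sub>R a) \<in> span E" using c by (rule span_scale)
        then have "\<delta> \<le> norm (a - (- 1 / c) *\<^sub>R (x - c *\<^sub>R a))" by (rule far)
        also have "a - (- 1 / c) *\<^sub>R (x - c *\<^sub>R a) = (1 / c) *\<^sub>R x" using False by (simp add: algebra_simps)
        finally show ?thesis using False by (simp add: field_simps)
      qed simp
      also have "\<dots> \<le> r" using x by simp
      finally have cR: "\<bar>c\<bar> \<le> R" using \<delta> by (simp add: R_def field_simps)
      then have "norm (c *\<^sub>R a) \<le> R * norm a" by (simp add: mult_right_mono)
      then have "norm (x - c *\<^sub>R a) \<le> r + R * norm a"
        using norm_triangle_ineq4[of x "c *\<^sub>R a"] x by simp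
      then have "(x - c *\<^sub>R a, c) \<in> B" using c cR by (simp add: B_def)
      then have "x \<in> (\<lambda>(s, c). s + c *\<^sub>R a) ` B" by (rule rev_image_eqI) simp
      then show "x \<in> (\<lambda>(s, c). s + c *\<^sub>R a) ` B \<inter> cball 0 r" using x by simp
    next
      fix x assume "x \<in> (\<lambda>(s, c). s + c *\<^sub>R a) ` B \<inter> cball 0 r"
      then obtain q c where "x = q + c *\<^sub>R a" "q \<in> span E" "norm x \<le> r" by (auto simp: B_def)
      then show "x \<in> span (insert a E) \<inter> cball 0 r" by (auto simp: span_insert intro!: exI[of _ c])
    qed
    moreover have "compact ((\<lambda>(s, c). s + c *\<^sub>R a) ` B)"
      unfolding B_def case_prod_unfold
      by (intro compact_continuous_image compact_Times insert.IH compact_cball continuous_intros)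
    ultimately show ?thesis by (simp add: compact_Int_closed)
  qed
qed

lemma weak_star_neighbourhood:
  fixes v :: "'a::real_normed_vector dual"
  assumes "openin weak_star W" "v \<in> W"
  obtains E \<delta> where "finite E" "0 < \<delta>" "\<And>u. (\<And>e. e \<in> E \<Longrightarrow> \<bar>blinfun_apply u e - v e\<bar> < \<delta>) \<Longrightarrow> u \<in> W"
proof -
  obtain S where S: "open S" "W = blinfun_apply -` S"
    using assms(1) unfolding strong_operator_topology_def openin_pullback_topology by auto
  have "openin (product_topology (\<lambda>_. euclidean) UNIV) S" using S(1) by (simp add: open_fun_def)
  from product_topology_open_contains_basis[OF this, of "blinfun_apply v"] obtain X where
    X: "blinfun_apply v \<in> PiE UNIV X" "\<And>i. open (X i)" "finite {i. X i \<noteq> UNIV}" "PiE UNIV X \<subseteq> S"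
    using S(2) assms(2) by auto
  define E where "E = {i. X i \<noteq> UNIV}"
  have "\<exists>d>0. \<forall>y. dist y (v i) < d \<longrightarrow> y \<in> X i" for i
    using X(1,2) open_dist[of "X i"] by auto
  then obtain d where d: "\<And>i. 0 < d i" "\<And>i y. dist y (v i) < d i \<Longrightarrow> y \<in> X i" by metis
  show thesis
  proof (rule that[of E "Min (insert 1 (d ` E))"])
    show "finite E" "0 < Min (insert 1 (d ` E))" using X(3) d(1) by (auto simp: E_def)
    fix u :: "'a dual" assume u: "\<And>e. e \<in> E \<Longrightarrow> \<bar>u e - v e\<bar> < Min (insert 1 (d ` E))"
    have "u i \<in> X i" for i
    proof (cases "i \<in> E")
      case True
      then have "Min (insert 1 (d ` E)) \<le> d i" using X(3) by (simp add: E_def)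
      then show ?thesis using u[OF True] by (intro d(2)) (simp add: dist_real_def)
    qed (simp add: E_def)
    then show "u \<in> W" using X(4) S(2) by auto
  qed
qed

lemma openin_weak_star_finite:
  fixes v :: "'a::real_normed_vector dual"
  assumes "finite E"
  shows "openin weak_star {u. \<forall>e\<in>E. \<bar>blinfun_apply u e - v e\<bar> < \<delta>}"
proof -
  have "openin weak_star {u :: 'a dual. \<forall>e\<in>E. blinfun_apply u (id e) \<in> ball (v e) \<delta>}"
    using assms by (intro strong_operator_topology_basis) auto
  then show ?thesis by (simp add: dist_real_def abs_minus_commute)
qed

lemma closed_sublevel_add_continuous:
  fixes g N :: "'a::real_normed_vector \<Rightarrow> real"
  assumes closed: "\<And>c. closed {x \<in> D. g x \<le> c}" and N: "continuous_on UNIV N"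
  shows "closed {x \<in> D. g x + N x \<le> c}"
  unfolding closed_sequential_limits
proof (intro allI impI, elim conjE)
  fix s z assume s: "\<forall>n. s n \<in> {x \<in> D. g x + N x \<le> c}" and lim: "s \<longlonglongrightarrow> z"
  have "(\<lambda>n. N (s n)) \<longlonglongrightarrow> N z"
    using N lim continuous_on_tendsto_compose[of UNIV N s z] by simp
  \<comment> \<open>The one-variable case, with a one-point index type.\<close>
  with sum_closed_sublevel[of "UNIV :: unit set" "\<lambda>_. D" "\<lambda>_. g" "\<lambda>n _. s n" "\<lambda>x. N (x ())" c "\<lambda>_. z"]
  show "z \<in> {x \<in> D. g x + N x \<le> c}" using closed s lim by simp
qed

text \<open>Subtracting the affine function that supports the supremum at \<open>x0\<close> gives
  functions \<open>h t\<close> that are at most 0 at \<open>x0\<close> and whose supremum is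
  nonnegative everywhere. The implication in \<open>sup\<close> lets points off \<open>D t\<close>
  count as infinite values.\<close>

lemma finite_max_subgradient:
  fixes D :: "'i \<Rightarrow> 'a::banach set" and g :: "'i \<Rightarrow> 'a \<Rightarrow> real" and v :: "'a dual"
  assumes conv: "\<And>t. t \<in> T \<Longrightarrow> convex_on (D t) (g t)"
    and closed: "\<And>t c. t \<in> T \<Longrightarrow> closed {x \<in> D t. g t x \<le> c}"
    and x0: "\<And>t. t \<in> T \<Longrightarrow> x0 \<in> D t \<and> g t x0 \<le> \<gamma>"
    and sup: "\<And>x a. 0 < a \<Longrightarrow> \<exists>t\<in>T. x \<in> D t \<longrightarrow> \<gamma> + v (x - x0) - a < g t x"
    and E: "finite E" and \<epsilon>: "0 < \<epsilon>"
  obtains F x u M where "finite F" "F \<subseteq> T" "F \<noteq> {}" "norm (x - x0) \<le> \<epsilon>"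
    "\<And>t. t \<in> F \<Longrightarrow> x \<in> D t \<and> g t x \<le> M" "\<exists>t\<in>F. g t x = M" "\<bar>M - \<gamma>\<bar> \<le> \<epsilon>"
    "\<And>y. (\<And>t. t \<in> F \<Longrightarrow> y \<in> D t) \<Longrightarrow> \<exists>t\<in>F. blinfun_apply u (y - x) \<le> g t y - M"
    "\<And>e. e \<in> E \<Longrightarrow> \<bar>u e - v e\<bar> \<le> \<epsilon> * norm e"
proof -
  \<comment> \<open>Gives \<open>2 * (norm v + 1) * \<eta> \<le> \<epsilon>\<close>, which absorbs
    the variation of \<open>v\<close> between \<open>x0\<close> and \<open>x\<close>; the bound 1/2
    keeps the point found in \<open>K\<close> away from the rim of \<open>K\<close>.\<close>
  define \<eta> where "\<eta> = min (1/2) (\<epsilon> / (2 * (norm v + 1)))"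
  have v1: "0 < norm v + 1" by (simp add: add_nonneg_pos)
  then have \<eta>: "0 < \<eta>" "\<eta> < 1" using \<epsilon> by (auto simp: \<eta>_def)
  have "\<eta> \<le> \<epsilon> / (2 * (norm v + 1))" by (simp add: \<eta>_def)
  then have "2 * ((norm v + 1) * \<eta>) \<le> \<epsilon>" using v1 by (simp add: field_simps)
  then have \<eta>\<epsilon>: "2 * (norm v * \<eta>) + 2 * \<eta> \<le> \<epsilon>" by (simp add: algebra_simps)
  have v\<eta>: "0 \<le> norm v * \<eta>" using \<eta> by simp
  have \<eta>2: "0 < \<eta>\<^sup>2" "\<eta>\<^sup>2 \<le> \<eta>" using \<eta> by (auto simp: power2_eq_square mult_left_le_one_le)
  define h where "h t x = g t x + (v (x0 - x) - \<gamma>)" for t x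
  have closed_h: "closed {x \<in> D t. h t x \<le> c}" if "t \<in> T" for t c
    unfolding h_def using closed[OF that]
    by (rule closed_sublevel_add_continuous) (intro continuous_intros)
  have conv_h: "convex_on (D t) (h t)" if "t \<in> T" for t
    unfolding h_def
  proof (rule convex_on_add[OF conv[OF that]])
    have c: "convex (D t)" using conv[OF that] by (rule convex_on_imp_convex)
    show "convex_on (D t) (\<lambda>x. v (x0 - x) - \<gamma>)"
      unfolding convex_on_def
    proof (intro conjI ballI allI impI c)
      fix x y and a b :: real assume ab: "0 \<le> a" "0 \<le> b" "a + b = 1"
      have "a *\<^sub>R x0 + b *\<^sub>R x0 = x0" "a * \<gamma> + b * \<gamma> = \<gamma>"
        using ab by (metis scaleR_add_left scaleR_one, metis distrib_right mult_1)
      then have "v (x0 - (a *\<^sub>R x + b *\<^sub>R y)) - \<gamma> = v (a *\<^sub>R x0 + b *\<^sub>R x0 - (a *\<^sub>R x + b *\<^sub>R y)) - (a * \<gamma> + b * \<gamma>)"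
        by simp
      then show "v (x0 - (a *\<^sub>R x + b *\<^sub>R y)) - \<gamma> \<le> a * (v (x0 - x) - \<gamma>) + b * (v (x0 - y) - \<gamma>)"
        by (simp add: blinfun.diff_right blinfun.add_right blinfun.scaleR_right algebra_simps)
    qed
  qed
  define K where "K = (\<lambda>s. x0 + s) ` (span E \<inter> cball 0 1)"
  have K: "compact K" unfolding K_def
    by (intro compact_continuous_image compact_span_Int_cball E continuous_intros)
  have convK: "convex K" unfolding K_def
    by (intro convex_translation convex_Int subspace_imp_convex subspace_span convex_cball)
  have x0K: "x0 \<in> K" unfolding K_def by (rule image_eqI[of _ _ 0]) (auto simp: span_zero)
  \<comment> \<open>The points where \<open>h t\<close> exceeds \<open>- \<eta>\<^sup>2\<close>,
    including those off \<open>D t\<close>, where it counts as infinite.\<close>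
  define W where "W t = - {x \<in> D t. h t x \<le> - \<eta>\<^sup>2}" for t
  have openW: "open (W t)" if "t \<in> T" for t unfolding W_def using closed_h[OF that] by (rule open_Compl)
  have "K \<subseteq> (\<Union>t\<in>T. W t)"
  proof
    fix x
    obtain t where "t \<in> T" "x \<in> D t \<longrightarrow> \<gamma> + v (x - x0) - \<eta>\<^sup>2 < g t x" using sup[OF \<eta>2(1), of x] by blast
    then show "x \<in> (\<Union>t\<in>T. W t)" by (auto simp: W_def h_def blinfun.diff_right intro!: bexI[of _ t])
  qed
  then obtain F where F: "F \<subseteq> T" "finite F" "K \<subseteq> (\<Union>t\<in>F. W t)"
    using compactE_image[OF K, of T W] openW by blast
  have Fne: "F \<noteq> {}" using F(3) x0K by blast
  have "open (\<Union>t\<in>F. W t)" using F(1) openW by blast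
  then obtain r where r: "0 < r" "(\<Union>x\<in>K. cball x r) \<subseteq> (\<Union>t\<in>F. W t)"
    using compact_subset_open_imp_cball_epsilon_subset[OF K _ F(3)] by blast
  define A where "A = (\<Inter>t\<in>F. D t)"
  define H where "H x = Max ((\<lambda>t. h t x) ` F)" for x
  have hH: "h t x \<le> H x" if "t \<in> F" for t x unfolding H_def using F(2) that by simp
  have H_le_iff: "H x \<le> c \<longleftrightarrow> (\<forall>t\<in>F. h t x \<le> c)" for x c
    unfolding H_def using F(2) Fne by (subst Max_le_iff) auto
  have H_attained: "\<exists>t\<in>F. h t x = H x" for x
  proof -
    have "H x \<in> (\<lambda>t. h t x) ` F" unfolding H_def using F(2) Fne by (intro Max_in) auto
    then show ?thesis by (force simp: image_iff)
  qed
  have x0A: "x0 \<in> A" using x0 F(1) by (auto simp: A_def)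
  have Hx0: "H x0 \<le> 0" unfolding H_le_iff using x0 F(1) by (auto simp: h_def)
  have convH: "convex_on A H"
    unfolding convex_on_def
  proof (intro conjI ballI allI impI)
    show "convex A" unfolding A_def using F(1) conv convex_on_imp_convex by (intro convex_INT) blast
    fix x y and a b :: real assume xy: "x \<in> A" "y \<in> A" and ab: "0 \<le> a" "0 \<le> b" "a + b = 1"
    show "H (a *\<^sub>R x + b *\<^sub>R y) \<le> a * H x + b * H y"
      unfolding H_le_iff
    proof
      fix t assume t: "t \<in> F"
      have "h t (a *\<^sub>R x + b *\<^sub>R y) \<le> a * h t x + b * h t y"
        using conv_h[of t] t F(1) xy ab by (auto simp: convex_on_def A_def)
      also have "\<dots> \<le> a * H x + b * H y" using hH[OF t] ab by (intro add_mono mult_left_mono) auto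
      finally show "h t (a *\<^sub>R x + b *\<^sub>R y) \<le> a * H x + b * H y" .
    qed
  qed
  have near: "- \<eta>\<^sup>2 \<le> H x" if xy: "x \<in> A" "y \<in> K" "norm (x - y) \<le> r" for x y
  proof -
    have "x \<in> cball y r" using xy(3) by (simp add: dist_norm norm_minus_commute)
    then obtain t where "t \<in> F" "x \<in> W t" using r(2) xy(2) by blast
    then have "- \<eta>\<^sup>2 < h t x" using xy(1) by (auto simp: W_def A_def)
    then show ?thesis using hH[OF \<open>t \<in> F\<close>, of x] by linarith
  qed
  have normK: "norm (y - x0) \<le> 1" if "y \<in> K" for y using that by (auto simp: K_def)
  \<comment> \<open>For \<open>r < d\<close> and \<open>R \<le> d + 1\<close>, the quantity
    \<open>\<eta>\<^sup>2 * (1 + R / r)\<close> is at most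
    \<open>\<eta>\<^sup>2 * (2 / r + 1 / r\<^sup>2) * d\<close>; the summand 1 makes the inequality
    strict.\<close>
  define k where "k = 2 * (\<eta>\<^sup>2 / r) + \<eta>\<^sup>2 / r\<^sup>2 + 1"
  have k: "0 < k" unfolding k_def using r(1) \<eta>2 by (intro add_pos_pos mult_pos_pos divide_pos_pos) auto
  have far: "0 < H x + k * norm (x - y)" if x: "x \<in> A" and y: "y \<in> K" and "r < norm (x - y)" for x y
  proof -
    define R where "R = norm (x - x0)"
    define d where "d = norm (x - y)"
    have d: "r < d" using that(3) by (simp add: d_def)
    have Rd: "R \<le> d + 1"
      using norm_triangle_ineq[of "x - y" "y - x0"] normK[OF y] by (simp add: R_def d_def)
    \<comment> \<open>A convex function that is at most 0 at \<open>x0\<close> and at least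
      \<open>- \<eta>\<^sup>2\<close> on \<open>A\<close> within distance \<open>r\<close> decreases
      at most linearly: shrink \<open>x\<close> towards \<open>x0\<close> until the distance is
      \<open>r\<close>.\<close>
    have "- \<eta>\<^sup>2 * (1 + R / r) \<le> H x"
    proof (cases "R \<le> r")
      case True
      then have "- \<eta>\<^sup>2 \<le> H x" using near[OF x x0K] by (simp add: R_def)
      moreover have "0 \<le> R / r" using r(1) by (simp add: R_def)
      then have "\<eta>\<^sup>2 * 1 \<le> \<eta>\<^sup>2 * (1 + R / r)" by (intro mult_left_mono) auto
      ultimately show ?thesis by simp
    next
      case False
      define a where "a = r / R"
      have a: "0 < a" "a \<le> 1" using False r(1) by (auto simp: a_def)
      define w where "w = (1 - a) *\<^sub>R x0 + a *\<^sub>R x"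
      have "w \<in> A" unfolding w_def using x x0A a by (intro convexD[OF convex_on_imp_convex[OF convH]]) auto
      moreover have "w - x0 = a *\<^sub>R (x - x0)" by (simp add: w_def algebra_simps)
      then have "norm (w - x0) = a * R" using a by (simp add: R_def)
      then have "norm (w - x0) \<le> r" using False r(1) by (simp add: a_def)
      ultimately have "- \<eta>\<^sup>2 \<le> H w" using near[OF _ x0K] by blast
      also have "H w \<le> (1 - a) * H x0 + a * H x"
        using convH x x0A a by (simp add: convex_on_def w_def)
      also have "\<dots> \<le> a * H x" using Hx0 a by (simp add: mult_nonneg_nonpos)
      finally have "- \<eta>\<^sup>2 / a \<le> H x" using a by (simp add: field_simps)
      moreover have "- \<eta>\<^sup>2 / a = - \<eta>\<^sup>2 * (R / r)" by (simp add: a_def)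
      moreover have "\<eta>\<^sup>2 * (R / r) \<le> \<eta>\<^sup>2 * (1 + R / r)" by (intro mult_left_mono) auto
      ultimately show ?thesis by linarith
    qed
    moreover have "\<eta>\<^sup>2 * (1 + R / r) < k * d"
    proof -
      have "1 \<le> d / r" using r(1) d by simp
      moreover have "R / r \<le> d / r + 1 / r"
        using r(1) Rd by (simp add: add_divide_distrib[symmetric] divide_right_mono)
      moreover have "1 / r \<le> d / r\<^sup>2" using r(1) d by (simp add: field_simps power2_eq_square)
      ultimately have "1 + R / r \<le> 2 * (d / r) + d / r\<^sup>2" by linarith
      then have "\<eta>\<^sup>2 * (1 + R / r) \<le> \<eta>\<^sup>2 * (2 * (d / r) + d / r\<^sup>2)" by (intro mult_left_mono) auto
      also have "\<dots> = k * d - d" by (simp add: k_def algebra_simps)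
      also have "\<dots> < k * d" using r(1) d by simp
      finally show ?thesis .
    qed
    ultimately show ?thesis by (simp add: d_def)
  qed
  \<comment> \<open>\<open>True\<close> is the copy that carries the maximum \<open>H\<close> on
    \<open>A\<close>, \<open>False\<close> the copy confined to \<open>K\<close>, with objective
    0.\<close>
  define DD where "DD b = (if b then A else K)" for b
  define \<psi> where "\<psi> b = (if b then H else (\<lambda>_. 0))" for b
  have psi_sum: "(\<Sum>b\<in>UNIV. \<psi> b (x b)) = H (x True)" for x by (simp add: UNIV_bool \<psi>_def)
  have diff_sum: "(\<Sum>b\<in>UNIV. norm (x b - x False)) = norm (x True - x False)" for x :: "bool \<Rightarrow> 'a" by (simp add: UNIV_bool)
  obtain z and p :: "bool \<Rightarrow> 'a dual" where zD: "\<And>b. z b \<in> DD b" and zx: "\<And>b. norm (z b - x0) \<le> \<eta>"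
    and val: "H (z True) + k * norm (z True - z False) \<le> H x0"
    and sub: "\<And>b x. x \<in> DD b \<Longrightarrow> p b (x - z b) \<le> \<psi> b x - \<psi> b (z b)"
    and opt: "\<And>x. k * norm (z True - z False) \<le> (\<Sum>b\<in>UNIV. p b (x b - z b)) +
      k * norm (x True - x False) + \<eta> * (\<Sum>b\<in>UNIV. norm (x b - z b))"
  proof (rule coupled_almost_minimizer[of UNIV False DD \<psi> x0 k \<eta>, unfolded psi_sum diff_sum])
    show "convex_on (DD b) (\<psi> b)" for b
      using convH convK by (cases b) (auto simp: DD_def \<psi>_def convex_on_const)
    show "closed {x \<in> DD b. \<psi> b x \<le> c}" for b c
    proof (cases b)
      case True
      have "{x \<in> A. H x \<le> c} = (\<Inter>t\<in>F. {x \<in> D t. h t x \<le> c})"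
        using Fne by (auto simp: A_def H_le_iff)
      moreover have "closed (\<Inter>t\<in>F. {x \<in> D t. h t x \<le> c})" using closed_h F(1) by blast
      ultimately show ?thesis using True by (simp add: DD_def \<psi>_def)
    next
      case False
      then show ?thesis using compact_imp_closed[OF K] by (cases "0 \<le> c") (auto simp: DD_def \<psi>_def)
    qed
    show "x0 \<in> DD b" for b using x0A x0K by (simp add: DD_def)
    fix x assume "\<And>b. b \<in> UNIV \<Longrightarrow> x b \<in> DD b"
    from this[of True] this[of False] have x: "x True \<in> A" "x False \<in> K" by (auto simp: DD_def)
    show "H x0 - \<eta>\<^sup>2 \<le> H (x True) + k * norm (x True - x False)"
    proof (cases "norm (x True - x False) \<le> r")
      case True
      have "0 \<le> k * norm (x True - x False)" using k by simp
      then show ?thesis using near[OF x True] Hx0 by linarith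
    next
      case False
      then show ?thesis using far[OF x] Hx0 \<eta>2 by linarith
    qed
  qed (use k \<eta> that in auto)
  have zA: "z True \<in> A" and zK: "z False \<in> K" using zD[of True] zD[of False] by (auto simp: DD_def)
  have "norm (z True - z False) \<le> r"
    using far[OF zA zK] val Hx0 by force
  then have Hlow: "- \<eta>\<^sup>2 \<le> H (z True)" by (rule near[OF zA zK])
  have "0 \<le> k * norm (z True - z False)" using k by simp
  then have Hup: "H (z True) \<le> 0" using val Hx0 by linarith
  \<comment> \<open>\<open>p False\<close> is normal to \<open>K\<close> at \<open>z False\<close>,
    which lies within \<open>\<eta> < 1\<close> of the centre \<open>x0\<close>. From there
    \<open>K\<close> extends in both directions \<open>e\<close> and \<open>- e\<close>, so
    \<open>p False\<close> vanishes on \<open>E\<close>.\<close>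
  have flat: "p False e = 0" if e: "e \<in> E" for e
  proof -
    define s where "s = (1 - \<eta>) / (norm e + 1)"
    have ne: "0 < norm e + 1" by (simp add: add_nonneg_pos)
    have s: "0 < s" "s * norm e \<le> 1 - \<eta>" using \<eta> ne by (auto simp: s_def field_simps)
    have "z False + a *\<^sub>R e \<in> K" if a: "\<bar>a\<bar> = s" for a
    proof -
      obtain q where q: "q \<in> span E" "z False = x0 + q" using zK by (auto simp: K_def)
      have "norm (q + a *\<^sub>R e) \<le> 1"
        using norm_triangle_ineq[of q "a *\<^sub>R e"] zx[of False] q(2) s(2) a by simp
      moreover have "q + a *\<^sub>R e \<in> span E" by (rule span_add[OF q(1) span_scale[OF span_base[OF e]]])
      ultimately show ?thesis unfolding q(2) K_def
        by (intro image_eqI[of _ _ "q + a *\<^sub>R e"]) (auto simp: add.assoc)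
    qed
    then have "p False (a *\<^sub>R e) \<le> 0" if "\<bar>a\<bar> = s" for a
      using sub[of "z False + a *\<^sub>R e" False] that by (simp add: DD_def \<psi>_def)
    from this[of s] this[of "- s"] show ?thesis
      using s(1) by (simp add: blinfun.scaleR_right blinfun.minus_right mult_le_0_iff zero_le_mult_iff)
  qed
  define x where "x = z True"
  define u where "u = p True + v"
  define M where "M = \<gamma> + v (x - x0) + H x"
  have gM: "g t y - M = h t y - H x + v (y - x)" for t y
    by (simp add: M_def h_def blinfun.diff_right)
  show thesis
  proof (rule that[of F x M u])
    show "finite F" "F \<subseteq> T" "F \<noteq> {}" using F Fne by auto
    show "norm (x - x0) \<le> \<epsilon>" unfolding x_def using zx[of True] \<eta>\<epsilon> v\<eta> \<eta> by linarith
    show "x \<in> D t \<and> g t x \<le> M" if "t \<in> F" for t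
      using zA that hH[OF that, of x] gM[of t x] by (simp add: A_def x_def)
    obtain t where "t \<in> F" "h t x = H x" using H_attained by blast
    then show "\<exists>t\<in>F. g t x = M" using gM[of t x] by (intro bexI[of _ t]) auto
    have "\<bar>v (x - x0)\<bar> \<le> norm v * \<eta>"
      using norm_blinfun[of v "x - x0"] mult_left_mono[OF zx[of True], of "norm v"] by (simp add: x_def)
    then show "\<bar>M - \<gamma>\<bar> \<le> \<epsilon>" 
      unfolding M_def x_def using Hlow Hup \<eta>2 \<eta>\<epsilon> v\<eta> \<eta> by linarith
    show "\<exists>t\<in>F. u (y - x) \<le> g t y - M" if "\<And>t. t \<in> F \<Longrightarrow> y \<in> D t" for y
    proof -
      have "p True (y - z True) \<le> H y - H (z True)"
        using sub[of y True] that by (simp add: DD_def A_def \<psi>_def)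
      moreover obtain t where "t \<in> F" "h t y = H y" using H_attained by blast
      ultimately show ?thesis unfolding gM by (intro bexI[of _ t]) (simp_all add: u_def x_def blinfun.add_left)
    qed
    show "\<bar>u e - v e\<bar> \<le> \<epsilon> * norm e" if e: "e \<in> E" for e
    proof -
      \<comment> \<open>Both copies are translated by \<open>a\<close>, so the penalty cancels
        whatever the size of \<open>k\<close>.\<close>
      have "- p True a \<le> 2 * \<eta> * norm a" if "p False a = 0" for a
        using opt[of "\<lambda>b. z b + a"] that by (simp add: UNIV_bool)
      from this[of e] this[of "- e"] have "\<bar>p True e\<bar> \<le> 2 * \<eta> * norm e"
        using flat[OF e] by (simp add: blinfun.minus_right abs_le_iff)
      also have "\<dots> \<le> \<epsilon> * norm e" 
      proof (rule mult_right_mono)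
        show "2 * \<eta> \<le> \<epsilon>" using \<eta>\<epsilon> v\<eta> by linarith
      qed simp
      finally show ?thesis by (simp add: u_def blinfun.add_left)
    qed
  qed
qed

section \<open>Extended-real-valued functions\<close>

lemma limitin_weak_starI:
  fixes l :: "'a::real_normed_vector dual"
  assumes "\<And>h. ((\<lambda>n. blinfun_apply (v n) h) \<longlongrightarrow> blinfun_apply l h) G"
  shows "limitin weak_star v l G"
  unfolding limitin_def
proof (intro conjI allI impI)
  fix W assume "openin weak_star W \<and> l \<in> W"
  then have "openin weak_star W" "l \<in> W" by auto
  then obtain E \<delta> where E: "finite E" "0 < \<delta>"
    "\<And>u. (\<And>e. e \<in> E \<Longrightarrow> \<bar>blinfun_apply u e - l e\<bar> < \<delta>) \<Longrightarrow> u \<in> W"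
    by (rule weak_star_neighbourhood) blast
  have "\<forall>\<^sub>F n in G. \<forall>e\<in>E. dist (v n e) (l e) < \<delta>"
    by (intro eventually_ball_finite E(1) ballI tendstoD[OF assms E(2)])
  then show "\<forall>\<^sub>F n in G. v n \<in> W"
    by eventually_elim (rule E(3), simp add: dist_real_def)
qed (simp add: strong_operator_topology_topspace)

lemma proper_fun_cases:
  assumes "proper_fun g"
  shows "x \<in> effective_dom g \<Longrightarrow> g x = ereal (real_of_ereal (g x))" "x \<notin> effective_dom g \<Longrightarrow> g x = \<infinity>"
  using assms by (cases "g x"; auto simp: proper_fun_def effective_dom_def)+

lemma convex_fun_real:
  assumes "proper_fun g" "convex_fun g"
  shows "convex_on (effective_dom g) (\<lambda>x. real_of_ereal (g x))"
proof -
  have *: "u *\<^sub>R x + v *\<^sub>R y \<in> effective_dom g \<and>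
      real_of_ereal (g (u *\<^sub>R x + v *\<^sub>R y)) \<le> u * real_of_ereal (g x) + v * real_of_ereal (g y)"
    if xy: "x \<in> effective_dom g" "y \<in> effective_dom g" and uv: "0 \<le> u" "0 \<le> v" "u + v = 1" for x y u v
  proof -
    let ?w = "u *\<^sub>R x + v *\<^sub>R y"
    have "g ?w \<le> ereal u * g x + ereal v * g y" using assms(2) uv by (simp add: convex_fun_def)
    also have "\<dots> = ereal (u * real_of_ereal (g x) + v * real_of_ereal (g y))"
      by (subst proper_fun_cases(1)[OF assms(1) xy(1)], subst proper_fun_cases(1)[OF assms(1) xy(2)]) simp
    finally have le: "g ?w \<le> ereal (u * real_of_ereal (g x) + v * real_of_ereal (g y))" .
    then have "?w \<in> effective_dom g" by (auto simp: effective_dom_def)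
    moreover from le have "real_of_ereal (g ?w) \<le> u * real_of_ereal (g x) + v * real_of_ereal (g y)"
      using proper_fun_cases(1)[OF assms(1) calculation] by (metis ereal_less_eq(3))
    ultimately show ?thesis by blast
  qed
  then show ?thesis unfolding convex_on_def convex_def by blast
qed

lemma lsc_fun_closed_sublevel:
  assumes "proper_fun g" "lsc_fun g"
  shows "closed {x \<in> effective_dom g. real_of_ereal (g x) \<le> c}"
proof -
  have "{x \<in> effective_dom g. real_of_ereal (g x) \<le> c} = {x. g x \<le> ereal c}"
  proof (intro equalityI subsetI)
    fix x assume "x \<in> {x. g x \<le> ereal c}"
    then have x: "x \<in> effective_dom g" "g x \<le> ereal c" by (auto simp: effective_dom_def)
    then show "x \<in> {x \<in> effective_dom g. real_of_ereal (g x) \<le> c}"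
      using proper_fun_cases(1)[OF assms(1) x(1)] by (metis (mono_tags) ereal_less_eq(3) mem_Collect_eq)
  next
    fix x assume "x \<in> {x \<in> effective_dom g. real_of_ereal (g x) \<le> c}"
    then show "x \<in> {x. g x \<le> ereal c}"
      using proper_fun_cases(1)[OF assms(1), of x] by (metis (mono_tags) ereal_less_eq(3) mem_Collect_eq)
  qed
  moreover have "open (- {x. g x \<le> ereal c})"
    unfolding open_subopen[of "- {x. g x \<le> ereal c}"]
  proof
    fix x assume "x \<in> - {x. g x \<le> ereal c}"
    then have x: "ereal c < g x" by simp
    then have "ereal c < Liminf (at x) g" using assms(2) by (auto simp: lsc_fun_def intro: less_le_trans)
    then have "\<forall>\<^sub>F y in at x. ereal c < g y" by (rule less_LiminfD)
    \<comment> \<open>\<open>Liminf\<close> looks only at punctured neighbourhoods; the point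
      \<open>x\<close> itself is added by the strict inequality at \<open>x\<close>.\<close>
    then have "\<forall>\<^sub>F y in nhds x. ereal c < g y" using x by (auto simp: eventually_nhds_conv_at)
    then obtain S where "open S" "x \<in> S" "\<forall>y\<in>S. ereal c < g y" unfolding eventually_nhds by blast
    then show "\<exists>S. open S \<and> x \<in> S \<and> S \<subseteq> - {x. g x \<le> ereal c}"
      by (intro exI[of _ S]) (auto simp: not_le)
  qed
  ultimately show ?thesis by (simp add: closed_def)
qed

lemma subdifferential_iff:
  assumes "proper_fun g"
  shows "v \<in> subdifferential g x \<longleftrightarrow>
    x \<in> effective_dom g \<and> v \<in> subgradients (effective_dom g) (\<lambda>x. real_of_ereal (g x)) x"
proof (cases "x \<in> effective_dom g")
  case True
  define r where "r = real_of_ereal (g x)"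
  have r: "g x = ereal r" unfolding r_def by (rule proper_fun_cases(1)[OF assms True])
  have "ereal (v (y - x)) \<le> g y - g x \<longleftrightarrow> (y \<in> effective_dom g \<longrightarrow> v (y - x) \<le> real_of_ereal (g y) - r)" for y
  proof (cases "y \<in> effective_dom g")
    case y: True
    show ?thesis using proper_fun_cases(1)[OF assms y] y by (metis r ereal_minus(1) ereal_less_eq(3))
  next
    case False
    then show ?thesis using proper_fun_cases(2)[OF assms False] by (simp add: r)
  qed
  then show ?thesis using True by (auto simp: subdifferential_def subgradients_def r)
next
  case False
  then show ?thesis using proper_fun_cases(2)[OF assms False] by (simp add: subdifferential_def)
qed

lemma normal_cone_dom_eq: "normal_cone_dom g x = normals (effective_dom g) x"
  by (simp add: normal_cone_dom_def normals_def)

text \<open>Tilting by \<open>u\<close> turns the subgradient inequality into nonnegativity of the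
  maximum, and \<open>u\<close> is added back to each subgradient at the end. Compactness is
  insensitive to the tilt, since \<open>l n *\<^sub>R u\<close> tends to 0 in norm.\<close>

lemma max_subdifferential_decomposition:
  fixes f :: "'i \<Rightarrow> 'a::banach \<Rightarrow> ereal" and u :: "'a dual"
  assumes fin: "finite F" and ne: "F \<noteq> {}"
    and proper: "\<And>t. t \<in> F \<Longrightarrow> proper_fun (f t)" and conv: "\<And>t. t \<in> F \<Longrightarrow> convex_fun (f t)"
    and lsc: "\<And>t. t \<in> F \<Longrightarrow> lsc_fun (f t)"
    and le: "\<And>t. t \<in> F \<Longrightarrow> f t x \<le> ereal M"
    and sub: "\<And>y. (\<And>t. t \<in> F \<Longrightarrow> y \<in> effective_dom (f t)) \<Longrightarrow>
      \<exists>t\<in>F. u (y - x) \<le> real_of_ereal (f t y) - M"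
    and compactness: "\<And>t. t \<in> F - {t0} \<Longrightarrow> subgrad_compact_at (f t) x"
    and qual: "\<And>w. (\<And>t. t \<in> F \<Longrightarrow> w t \<in> normal_cone_dom (f t) x) \<Longrightarrow> (\<Sum>t\<in>F. w t) = 0 \<Longrightarrow> \<forall>t\<in>F. w t = 0"
  shows "\<exists>F1\<subseteq>F. F1 \<noteq> {} \<and> (\<forall>t\<in>F1. f t x = ereal M) \<and>
    u \<in> convex hull (\<Union>t\<in>F1. subdifferential (f t) x) + (\<Sum>t\<in>F. normal_cone_dom (f t) x)"
proof -
  define D where "D t = effective_dom (f t)" for t
  define \<phi> where "\<phi> t = (\<lambda>y. real_of_ereal (f t y))" for t
  define g where "g t y = \<phi> t y + (u (x - y) - M)" for t y
  have xD: "x \<in> D t" if "t \<in> F" for t using le[OF that] by (auto simp: D_def effective_dom_def)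
  have fx: "f t y = ereal (\<phi> t y)" if "t \<in> F" "y \<in> D t" for t y
    using proper_fun_cases(1)[OF proper[OF that(1)]] that(2) by (simp add: D_def \<phi>_def)
  have sub_iff: "v \<in> subgradients (D t) (g t) y \<longleftrightarrow> v + u \<in> subgradients (D t) (\<phi> t) y" for t v y
    by (auto simp: subgradients_def g_def blinfun.diff_right blinfun.add_left algebra_simps)
  have subd: "v \<in> subdifferential (f t) y \<longleftrightarrow> y \<in> D t \<and> v \<in> subgradients (D t) (\<phi> t) y" if "t \<in> F" for t v y
    unfolding D_def \<phi>_def by (rule subdifferential_iff[OF proper[OF that]])
  obtain \<alpha> v w where \<alpha>: "(\<Sum>t\<in>F. \<alpha> t) = 1" "\<And>t. t \<in> F \<Longrightarrow> 0 \<le> \<alpha> t"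
    and v: "\<And>t. t \<in> F \<Longrightarrow> 0 < \<alpha> t \<Longrightarrow> g t x = 0 \<and> v t \<in> subgradients (D t) (g t) x"
    and w: "\<And>t. t \<in> F \<Longrightarrow> w t \<in> normals (D t) x"
    and sum: "(\<Sum>t\<in>F. \<alpha> t *\<^sub>R v t) + (\<Sum>t\<in>F. w t) = 0"
  proof (rule max_subgradient_decomposition[OF fin ne, of D g x t0])
    show "convex_on (D t) (g t)" if "t \<in> F" for t
    proof -
      have c: "convex_on (D t) (\<phi> t)"
        unfolding D_def \<phi>_def using proper[OF that] conv[OF that] by (rule convex_fun_real)
      moreover have "convex_on (D t) (\<lambda>y. u (x - y) - M)"
        unfolding convex_on_def
      proof (intro conjI ballI allI impI convex_on_imp_convex[OF c])
        fix y y' and a b :: real assume ab: "0 \<le> a" "0 \<le> b" "a + b = 1"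
        have "b = 1 - a" using ab by simp
        show "u (x - (a *\<^sub>R y + b *\<^sub>R y')) - M \<le> a * (u (x - y) - M) + b * (u (x - y') - M)"
          unfolding \<open>b = 1 - a\<close> by (simp add: blinfun.diff_right blinfun.add_right blinfun.scaleR_right algebra_simps)
      qed
      ultimately show ?thesis unfolding g_def by (rule convex_on_add)
    qed
    show "closed {y \<in> D t. g t y \<le> c}" if "t \<in> F" for t c
      unfolding g_def D_def \<phi>_def using lsc_fun_closed_sublevel[OF proper[OF that] lsc[OF that]]
      by (rule closed_sublevel_add_continuous) (intro continuous_intros)
    show "g t x \<le> 0" if "t \<in> F" for t
      using le[OF that] fx[OF that xD[OF that]] by (simp add: g_def)
    show "\<exists>t\<in>F. 0 \<le> g t y" if yD: "\<And>t. t \<in> F \<Longrightarrow> y \<in> D t" for y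
    proof -
      obtain t where "t \<in> F" "u (y - x) \<le> \<phi> t y - M" using sub[of y] yD by (auto simp: D_def \<phi>_def)
      then show ?thesis by (auto simp: g_def blinfun.diff_right intro!: bexI[of _ t])
    qed
    show "\<forall>t\<in>F. w t = 0" if "\<And>t. t \<in> F \<Longrightarrow> w t \<in> normals (D t) x" "(\<Sum>t\<in>F. w t) = 0" for w
      using qual[of w] that by (simp add: normal_cone_dom_eq D_def)
    fix t G and l :: "nat \<Rightarrow> real" and y v
    assume t: "t \<in> F - {t0}" and G: "G \<noteq> bot"
      and elems: "\<And>n. 0 < l n \<and> y n \<in> D t \<and> v n \<in> subgradients (D t) (g t) (y n)"
      and l: "(l \<longlongrightarrow> 0) G" and y: "(y \<longlongrightarrow> x) G" and gy: "((\<lambda>n. g t (y n)) \<longlongrightarrow> g t x) G"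
      and weak: "\<And>h. ((\<lambda>n. l n * v n h) \<longlongrightarrow> 0) G"
    have tF: "t \<in> F" using t by blast
    \<comment> \<open>\<open>subgrad_compact_at\<close> speaks of filters on triples, so the
      sequence enters through its image filter, with the tilt undone.\<close>
    define FF where "FF = filtermap (\<lambda>n. (l n, y n, v n + u)) G"
    have "((\<lambda>(l, y, ys). norm (l *\<^sub>R ys)) \<longlongrightarrow> 0) FF"
    proof (rule compactness[OF t, unfolded subgrad_compact_at_def, rule_format])
      show "\<forall>\<^sub>F (l, y, ys) in FF. 0 \<le> l \<and> ys \<in> subdifferential (f t) y"
        using elems unfolding FF_def eventually_filtermap subd[OF tF] sub_iff by (simp add: less_imp_le)
      show "((\<lambda>(l, y, ys). l) \<longlongrightarrow> 0) FF" "((\<lambda>(l, y, ys). y) \<longlongrightarrow> x) FF"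
        using l y by (simp_all add: FF_def filterlim_filtermap)
      have "((\<lambda>n. g t (y n) - (u (x - y n) - M)) \<longlongrightarrow> g t x - (u (x - x) - M)) G"
        by (intro tendsto_intros gy y)
      then have "((\<lambda>n. \<phi> t (y n)) \<longlongrightarrow> \<phi> t x) G" by (simp add: g_def)
      then show "((\<lambda>(l, y, ys). f t y) \<longlongrightarrow> f t x) FF"
        using elems xD[OF tF] fx[OF tF] by (simp add: FF_def filterlim_filtermap)
      have "((\<lambda>n. (l n *\<^sub>R (v n + u)) h) \<longlongrightarrow> 0) G" for h
        using tendsto_add[OF weak[of h] tendsto_mult_left_zero[OF l, of "u h"]]
        by (simp add: blinfun.scaleR_left blinfun.add_left algebra_simps)
      then have "limitin weak_star (\<lambda>n. l n *\<^sub>R (v n + u)) 0 G"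
        by (intro limitin_weak_starI) simp
      then show "limitin weak_star (\<lambda>(l, y, ys). l *\<^sub>R ys) 0 FF"
        by (simp add: FF_def limitin_def eventually_filtermap)
    qed
    then have "((\<lambda>n. norm (l n *\<^sub>R (v n + u))) \<longlongrightarrow> 0) G"
      by (simp add: FF_def filterlim_filtermap)
    then have "((\<lambda>n. l n *\<^sub>R (v n + u)) \<longlongrightarrow> 0) G" by (rule tendsto_norm_zero_cancel)
    moreover have "((\<lambda>n. l n *\<^sub>R u) \<longlongrightarrow> 0 *\<^sub>R u) G" by (intro tendsto_intros l)
    ultimately have "((\<lambda>n. l n *\<^sub>R (v n + u) - l n *\<^sub>R u) \<longlongrightarrow> 0 - 0 *\<^sub>R u) G" by (rule tendsto_diff)
    then have "((\<lambda>n. l n *\<^sub>R v n) \<longlongrightarrow> 0) G" by (simp add: scaleR_add_right)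
    then show "((\<lambda>n. norm (l n *\<^sub>R v n)) \<longlongrightarrow> 0) G" by (rule tendsto_norm_zero)
  qed (use xD that in auto)
  \<comment> \<open>Only a positive multiplier guarantees that \<open>v t\<close> is a subgradient
    and that \<open>f t\<close> has the value \<open>M\<close> at \<open>x\<close>.\<close>
  define F1 where "F1 = {t \<in> F. 0 < \<alpha> t}"
  have F1: "finite F1" "F1 \<subseteq> F" using fin by (auto simp: F1_def)
  have zero: "\<alpha> t = 0" if "t \<in> F - F1" for t using \<alpha>(2)[of t] that by (auto simp: F1_def)
  have sum1: "(\<Sum>t\<in>F1. \<alpha> t) = 1" using \<alpha>(1) sum.mono_neutral_left[OF fin F1(2)] zero by metis
  have Msub: "v t + u \<in> subdifferential (f t) x \<and> f t x = ereal M" if "t \<in> F1" for t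
    using v[of t] that xD[of t] fx[of t x] unfolding sub_iff by (auto simp: F1_def subd g_def)
  have "(\<Sum>t\<in>F1. \<alpha> t *\<^sub>R (v t + u)) \<in> convex hull (\<Union>t\<in>F1. subdifferential (f t) x)"
  proof (rule convex_sum[OF F1(1) convex_convex_hull sum1])
    show "0 \<le> \<alpha> t" if "t \<in> F1" for t using that by (simp add: F1_def)
    show "v t + u \<in> convex hull (\<Union>t\<in>F1. subdifferential (f t) x)" if "t \<in> F1" for t
      using Msub[OF that] that by (intro hull_inc) blast
  qed
  moreover have "(\<Sum>t\<in>F. w t) \<in> (\<Sum>t\<in>F. normal_cone_dom (f t) x)"
    unfolding set_sum_alt[OF fin] normal_cone_dom_eq using w by (auto simp: D_def)
  ultimately have "(\<Sum>t\<in>F1. \<alpha> t *\<^sub>R (v t + u)) + (\<Sum>t\<in>F. w t) \<in>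
      convex hull (\<Union>t\<in>F1. subdifferential (f t) x) + (\<Sum>t\<in>F. normal_cone_dom (f t) x)"
    by (rule set_plus_intro)
  moreover have "u = (\<Sum>t\<in>F1. \<alpha> t *\<^sub>R (v t + u)) + (\<Sum>t\<in>F. w t)"
  proof -
    have "(\<Sum>t\<in>F1. \<alpha> t *\<^sub>R (v t + u)) = (\<Sum>t\<in>F. \<alpha> t *\<^sub>R (v t + u))"
      using zero by (intro sum.mono_neutral_left[OF fin F1(2)]) auto
    also have "\<dots> = (\<Sum>t\<in>F. \<alpha> t *\<^sub>R v t) + u"
      using \<alpha>(1) by (simp add: scaleR_add_right sum.distrib scaleR_sum_left[symmetric])
    finally have "(\<Sum>t\<in>F1. \<alpha> t *\<^sub>R (v t + u)) + (\<Sum>t\<in>F. w t) =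
        ((\<Sum>t\<in>F. \<alpha> t *\<^sub>R v t) + (\<Sum>t\<in>F. w t)) + u" by simp
    then show ?thesis unfolding sum by simp
  qed
  ultimately have "u \<in> convex hull (\<Union>t\<in>F1. subdifferential (f t) x) + (\<Sum>t\<in>F. normal_cone_dom (f t) x)"
    by simp
  moreover have "F1 \<noteq> {}" using sum1 by auto
  ultimately show ?thesis using F1(2) Msub by blast
qed

section \<open>Subdifferential of the supremum\<close>

lemma closure_of_weak_starD:
  fixes v :: "'a::real_normed_vector dual"
  assumes "v \<in> weak_star closure_of A" "finite E" "0 < \<delta>"
  obtains a where "a \<in> A" "\<And>e. e \<in> E \<Longrightarrow> \<bar>blinfun_apply a e - v e\<bar> < \<delta>"
proof -
  let ?W = "{u. \<forall>e\<in>E. \<bar>blinfun_apply u e - v e\<bar> < \<delta>}"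
  have "v \<in> ?W" using assms(3) by simp
  with openin_weak_star_finite[OF assms(2), of v \<delta>] have "v \<in> ?W \<and> openin weak_star ?W" by (rule conjI[rotated])
  then have "\<exists>a. a \<in> A \<and> a \<in> ?W"
    using assms(1)[unfolded in_closure_of, THEN conjunct2, THEN spec, of ?W] by (rule rev_mp)
  then show thesis using that by auto
qed

lemma subdifferential_sup_subset_closure:
  fixes T :: "'i set" and f :: "'i \<Rightarrow> 'a::banach \<Rightarrow> ereal" and xbar :: 'a and U :: "'a set"
  assumes f_proper: "\<And>t. t \<in> T \<Longrightarrow> proper_fun (f t)"
    and f_convex: "\<And>t. t \<in> T \<Longrightarrow> convex_fun (f t)"
    and f_lsc: "\<And>t. t \<in> T \<Longrightarrow> lsc_fun (f t)"
    and U_nhd: "xbar \<in> interior U"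
    and compactness: "\<And>x. x \<in> U \<Longrightarrow> \<exists>t0. \<forall>t \<in> T - {t0}. subgrad_compact_at (f t) x"
    and qualification: "\<And>x F w. x \<in> U \<Longrightarrow> finite F \<Longrightarrow> F \<subseteq> T \<Longrightarrow>
          (\<forall>t\<in>F. w t \<in> normal_cone_dom (f t) x) \<Longrightarrow> (\<Sum>t\<in>F. w t) = 0 \<Longrightarrow> (\<forall>t\<in>F. w t = 0)"
    and \<epsilon>: "0 < \<epsilon>"
  shows "subdifferential (pointwise_sup T f) xbar \<subseteq> weak_star closure_of approx_subdiff T f xbar \<epsilon>"
proof
  fix v assume v: "v \<in> subdifferential (pointwise_sup T f) xbar"
  then obtain \<gamma> where \<gamma>: "pointwise_sup T f xbar = ereal \<gamma>"
    by (cases "pointwise_sup T f xbar") (auto simp: subdifferential_def)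
  have sub: "ereal (\<gamma> + v (y - xbar)) \<le> pointwise_sup T f y" for y
    using v by (cases "pointwise_sup T f y") (auto simp: subdifferential_def \<gamma> split: if_splits dest!: spec[of _ y])
  define D where "D t = effective_dom (f t)" for t
  define g where "g t = (\<lambda>x. real_of_ereal (f t x))" for t
  have fg: "f t x = ereal (g t x)" if "t \<in> T" "x \<in> D t" for t x
    using proper_fun_cases(1)[OF f_proper[OF that(1)]] that(2) by (simp add: D_def g_def)
  obtain \<rho> where \<rho>: "0 < \<rho>" "cball xbar \<rho> \<subseteq> U" using U_nhd unfolding mem_interior_cball by blast
  show "v \<in> weak_star closure_of approx_subdiff T f xbar \<epsilon>"
    unfolding in_closure_of strong_operator_topology_topspace
  proof (intro conjI UNIV_I allI impI)
    fix W assume "v \<in> W \<and> openin weak_star W"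
    then have "openin weak_star W" "v \<in> W" by auto
    then obtain E \<delta> where E: "finite E" "0 < \<delta>"
      "\<And>u. (\<And>e. e \<in> E \<Longrightarrow> \<bar>blinfun_apply u e - v e\<bar> < \<delta>) \<Longrightarrow> u \<in> W"
      by (rule weak_star_neighbourhood) blast
    \<comment> \<open>Strictly above the norm of every test direction, so that
      \<open>\<epsilon>' * norm e\<close> stays below \<open>\<delta>\<close>; the 1 keeps it
      positive for empty \<open>E\<close>.\<close>
    define R where "R = (\<Sum>e\<in>E. norm e) + 1"
    have R: "0 < R" unfolding R_def by (intro add_nonneg_pos sum_nonneg) auto
    have ER: "norm e < R" if "e \<in> E" for e
      unfolding R_def using member_le_sum[OF that _ E(1), of norm] by simp
    \<comment> \<open>\<open>\<rho>\<close> keeps the new point in \<open>U\<close>, where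
      compactness and the qualification condition are available.\<close>
    define \<epsilon>' where "\<epsilon>' = min (min \<epsilon> \<rho>) (\<delta> / R)"
    have \<epsilon>': "0 < \<epsilon>'" "\<epsilon>' \<le> \<epsilon>" "\<epsilon>' \<le> \<rho>" "\<epsilon>' \<le> \<delta> / R" using \<epsilon> \<rho>(1) E(2) R by (auto simp: \<epsilon>'_def)
    then have \<epsilon>R: "\<epsilon>' * R \<le> \<delta>" using R by (simp add: field_simps)
    obtain F x u M where F: "finite F" "F \<subseteq> T" "F \<noteq> {}" and x: "norm (x - xbar) \<le> \<epsilon>'"
      and gM: "\<And>t. t \<in> F \<Longrightarrow> x \<in> D t \<and> g t x \<le> M" and att: "\<exists>t\<in>F. g t x = M" and M: "\<bar>M - \<gamma>\<bar> \<le> \<epsilon>'"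
      and u: "\<And>y. (\<And>t. t \<in> F \<Longrightarrow> y \<in> D t) \<Longrightarrow> \<exists>t\<in>F. blinfun_apply u (y - x) \<le> g t y - M"
      and uv: "\<And>e. e \<in> E \<Longrightarrow> \<bar>u e - v e\<bar> \<le> \<epsilon>' * norm e"
    proof (rule finite_max_subgradient[of T D g xbar \<gamma> v E \<epsilon>'])
      show "convex_on (D t) (g t)" if "t \<in> T" for t
        unfolding D_def g_def using f_proper[OF that] f_convex[OF that] by (rule convex_fun_real)
      show "closed {x \<in> D t. g t x \<le> c}" if "t \<in> T" for t c
        unfolding D_def g_def using f_proper[OF that] f_lsc[OF that] by (rule lsc_fun_closed_sublevel)
      show "xbar \<in> D t \<and> g t xbar \<le> \<gamma>" if t: "t \<in> T" for t
      proof -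
        have le: "f t xbar \<le> ereal \<gamma>" unfolding \<gamma>[symmetric] pointwise_sup_def using t by (rule SUP_upper)
        then have "xbar \<in> D t" by (auto simp: D_def effective_dom_def)
        then show ?thesis using le fg[OF t] by simp
      qed
      show "\<exists>t\<in>T. x \<in> D t \<longrightarrow> \<gamma> + v (x - xbar) - a < g t x" if "0 < a" for x a
      proof -
        have "ereal (\<gamma> + v (x - xbar) - a) < ereal (\<gamma> + v (x - xbar))" using that by simp
        also have "\<dots> \<le> (SUP t\<in>T. f t x)" using sub[of x] by (simp add: pointwise_sup_def)
        finally obtain t where t: "t \<in> T" "ereal (\<gamma> + v (x - xbar) - a) < f t x"
          unfolding less_SUP_iff by blast
        then have "x \<in> D t \<longrightarrow> \<gamma> + v (x - xbar) - a < g t x" using fg[OF t(1)] by auto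
        then show ?thesis using t(1) by blast
      qed
    qed (use E(1) \<epsilon>'(1) that in blast)+
    have xU: "x \<in> U" using x \<epsilon>'(3) \<rho>(2) by (auto simp: dist_norm norm_minus_commute subset_iff)
    obtain t0 where t0: "\<And>t. t \<in> T - {t0} \<Longrightarrow> subgrad_compact_at (f t) x"
      using compactness[OF xU] by blast
    have "\<exists>F1\<subseteq>F. F1 \<noteq> {} \<and> (\<forall>t\<in>F1. f t x = ereal M) \<and>
      u \<in> convex hull (\<Union>t\<in>F1. subdifferential (f t) x) + (\<Sum>t\<in>F. normal_cone_dom (f t) x)"
    proof (rule max_subdifferential_decomposition[OF F(1,3)])
      show "f t x \<le> ereal M" if "t \<in> F" for t using gM[OF that] fg[of t x] that F(2) by auto
      show "\<exists>t\<in>F. u (y - x) \<le> real_of_ereal (f t y) - M" if "\<And>t. t \<in> F \<Longrightarrow> y \<in> effective_dom (f t)" for y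
        using u[of y] that by (simp add: D_def g_def)
      show "subgrad_compact_at (f t) x" if "t \<in> F - {t0}" for t using t0 that F(2) by blast
      show "\<forall>t\<in>F. w t = 0" if "\<And>t. t \<in> F \<Longrightarrow> w t \<in> normal_cone_dom (f t) x" "(\<Sum>t\<in>F. w t) = 0" for w
        using qualification[OF xU F(1,2), of w] that by blast
    qed (use F(2) f_proper f_convex f_lsc in blast)+
    then obtain F1 where F1: "F1 \<subseteq> F" "\<And>t. t \<in> F1 \<Longrightarrow> f t x = ereal M"
      and uF1: "u \<in> convex hull (\<Union>t\<in>F1. subdifferential (f t) x) + (\<Sum>t\<in>F. normal_cone_dom (f t) x)"
      by blast
    \<comment> \<open>With \<open>F2 = F\<close>, the maximum over \<open>F1 \<union> F2\<close> is
      the maximum over \<open>F\<close>, which is attained with value \<open>M\<close>.\<close>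
    have Max: "Max ((\<lambda>s. f s x) ` (F1 \<union> F)) = ereal M"
    proof (rule Max_eqI)
      show "finite ((\<lambda>s. f s x) ` (F1 \<union> F))" using F(1) F1(1) finite_subset by blast
      show "y \<le> ereal M" if "y \<in> (\<lambda>s. f s x) ` (F1 \<union> F)" for y
        using that F1(1) gM fg F(2) by (auto simp: subset_iff)
      obtain t where "t \<in> F" "g t x = M" using att by blast
      then show "ereal M \<in> (\<lambda>s. f s x) ` (F1 \<union> F)" using gM fg F(2) by (force simp: image_iff)
    qed
    have "u \<in> approx_subdiff T f xbar \<epsilon>"
      unfolding approx_subdiff_def
    proof (rule UnionI[OF _ uF1], rule CollectI, intro exI conjI refl ballI)
      show "finite F1" "F1 \<subseteq> T" "finite F" "F \<subseteq> T" using F F1(1) finite_subset by auto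
      show "x \<in> cball xbar \<epsilon>" using x \<epsilon>'(2) by (simp add: dist_norm norm_minus_commute)
      fix t assume t: "t \<in> F1"
      show "\<bar>f t x - pointwise_sup T f xbar\<bar> \<le> ereal \<epsilon>" using F1(2)[OF t] M \<epsilon>'(2) by (simp add: \<gamma>)
      show "f t x = Max ((\<lambda>s. f s x) ` (F1 \<union> F))" unfolding Max by (rule F1(2)[OF t])
    qed (rule refl)
    moreover have "u \<in> W"
    proof (rule E(3))
      fix e assume e: "e \<in> E"
      have "\<bar>u e - v e\<bar> \<le> \<epsilon>' * norm e" by (rule uv[OF e])
      also have "\<dots> < \<epsilon>' * R" using ER[OF e] \<epsilon>'(1) by simp
      finally show "\<bar>u e - v e\<bar> < \<delta>" using \<epsilon>R by simp
    qed
    ultimately show "\<exists>y. y \<in> approx_subdiff T f xbar \<epsilon> \<and> y \<in> W" by blast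
  qed
qed

text \<open>Members of the approximate subdifferential are approximate subgradients of the supremum
  with a displaced base point \<open>x\<close>. The hull part loses at most
  \<open>\<epsilon>\<close> because the active value at \<open>x\<close> is at least
  \<open>\<gamma> - \<epsilon>\<close>; the normals contribute nothing positive because a point
  where the supremum is finite lies in all domains.\<close>

lemma approx_subdiffD:
  fixes f :: "'i \<Rightarrow> 'a::real_normed_vector \<Rightarrow> ereal"
  assumes f_proper: "\<And>t. t \<in> T \<Longrightarrow> proper_fun (f t)"
    and a: "a \<in> approx_subdiff T f xbar \<epsilon>"
  obtains x \<gamma> where "norm (x - xbar) \<le> \<epsilon>" "pointwise_sup T f xbar = ereal \<gamma>"
    "\<And>y r. pointwise_sup T f y \<le> ereal r \<Longrightarrow> a (y - x) \<le> r - \<gamma> + \<epsilon>"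
proof -
  obtain F1 F2 x where F: "finite F1" "F1 \<subseteq> T" "finite F2" "F2 \<subseteq> T" and x: "x \<in> cball xbar \<epsilon>"
    and F1: "\<And>t. t \<in> F1 \<Longrightarrow> \<bar>f t x - pointwise_sup T f xbar\<bar> \<le> ereal \<epsilon> \<and> f t x = Max ((\<lambda>s. f s x) ` (F1 \<union> F2))"
    and a12: "a \<in> convex hull (\<Union>t\<in>F1. subdifferential (f t) x) + (\<Sum>t\<in>F2. normal_cone_dom (f t) x)"
    using a unfolding approx_subdiff_def by blast
  obtain c n where c: "c \<in> convex hull (\<Union>t\<in>F1. subdifferential (f t) x)"
    and n: "n \<in> (\<Sum>t\<in>F2. normal_cone_dom (f t) x)" and cn: "a = c + n"
    using a12 by (rule set_plus_elim)
  define m where "m = Max ((\<lambda>s. f s x) ` (F1 \<union> F2))"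
  \<comment> \<open>The hull of an empty union is empty. The common value \<open>m\<close> on a
    nonempty \<open>F1\<close> is not minus infinity, and its distance to the supremum is at most
    \<open>\<epsilon>\<close>; this forces both to be finite.\<close>
  have "F1 \<noteq> {}" using c by auto
  then obtain t1 where t1: "t1 \<in> F1" by blast
  have fm: "f t x = m" if "t \<in> F1" for t using F1[OF that] by (simp add: m_def)
  have m1: "\<bar>m - pointwise_sup T f xbar\<bar> \<le> ereal \<epsilon>" using F1[OF t1] unfolding fm[OF t1] by blast
  have "m \<noteq> - \<infinity>" using fm[OF t1] f_proper[of t1] t1 F(2) by (auto simp: proper_fun_def)
  with m1 obtain M \<gamma> where M: "m = ereal M" and \<gamma>: "pointwise_sup T f xbar = ereal \<gamma>"
    by (cases m; cases "pointwise_sup T f xbar") auto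
  have M\<gamma>: "\<gamma> \<le> M + \<epsilon>" using m1 by (simp add: M \<gamma>)
  show thesis
  proof (rule that[of x \<gamma>])
    show "norm (x - xbar) \<le> \<epsilon>" using x by (simp add: dist_norm norm_minus_commute)
    show "pointwise_sup T f xbar = ereal \<gamma>" by (rule \<gamma>)
    fix y r assume y: "pointwise_sup T f y \<le> ereal r"
    have fy: "f t y \<le> ereal r" if "t \<in> T" for t
      using that y unfolding pointwise_sup_def by (meson SUP_upper order_trans)
    \<comment> \<open>A half-space in the dual: it contains each of the subdifferentials, hence
      their hull.\<close>
    let ?S = "{d :: 'a dual. d (y - x) \<le> r - M}"
    have "convex ?S"
    proof (rule convexI)
      fix d d' and b b' :: real assume "d \<in> ?S" "d' \<in> ?S" and b: "0 \<le> b" "0 \<le> b'" "b + b' = 1"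
      then have "b * d (y - x) + b' * d' (y - x) \<le> b * (r - M) + b' * (r - M)"
        by (intro add_mono mult_left_mono) auto
      also have "\<dots> = r - M" using b(3) by (metis distrib_right mult_1)
      finally show "b *\<^sub>R d + b' *\<^sub>R d' \<in> ?S" by (simp add: blinfun.add_left blinfun.scaleR_left)
    qed
    moreover have "(\<Union>t\<in>F1. subdifferential (f t) x) \<subseteq> ?S"
    proof (intro UN_least subsetI)
      fix t d assume t: "t \<in> F1" and d: "d \<in> subdifferential (f t) x"
      have "ereal (d (y - x)) \<le> f t y - ereal M"
        using d fm[OF t] by (simp add: subdifferential_def M)
      also have "\<dots> \<le> ereal r - ereal M" using fy[of t] t F(2) by (intro ereal_minus_mono) auto
      finally show "d \<in> ?S" by simp
    qed
    ultimately have "c \<in> ?S" using c hull_minimal by blast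
    moreover have "n (y - x) \<le> 0"
    proof -
      obtain w where w: "n = sum w F2" "\<forall>t\<in>F2. w t \<in> normal_cone_dom (f t) x"
        using n unfolding set_sum_alt[OF F(3)] by blast
      have "y \<in> effective_dom (f t)" if "t \<in> F2" for t
        using fy[of t] that F(4) by (auto simp: effective_dom_def)
      then have "w t (y - x) \<le> 0" if "t \<in> F2" for t using w(2) that by (auto simp: normal_cone_dom_def)
      then show ?thesis unfolding w(1) blinfun.sum_left by (rule sum_nonpos)
    qed
    ultimately show "a (y - x) \<le> r - \<gamma> + \<epsilon>" using M\<gamma> by (simp add: cn blinfun.add_left)
  qed
qed

text \<open>\<open>E\<close> is a finite 1/2-net of the compact unit ball. Closeness to
  \<open>v\<close> on the net bounds \<open>a\<close> there by a constant \<open>C\<close>, and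
  passing to the whole ball gives \<open>norm a \<le> C + norm a / 2\<close>.\<close>

lemma finite_span_norm_bound:
  fixes v :: "'a::real_normed_vector dual"
  assumes "finite B" "span B = (UNIV :: 'a set)"
  shows "\<exists>E K. finite E \<and> (\<forall>a :: 'a dual. (\<forall>e\<in>E. \<bar>blinfun_apply a e - v e\<bar> < 1) \<longrightarrow> norm a \<le> K)"
proof -
  have cpt: "compact (cball (0 :: 'a) 1)" using compact_span_Int_cball[OF assms(1), of 1] assms(2) by simp
  have cover: "cball (0 :: 'a) 1 \<subseteq> (\<Union>c\<in>cball 0 1. ball c (1/2))"
  proof
    show "x \<in> (\<Union>c\<in>cball 0 1. ball c (1/2))" if "x \<in> cball 0 1" for x :: 'a
      using that by (intro UN_I[of x]) auto
  qed
  obtain E where E: "finite E" "cball (0 :: 'a) 1 \<subseteq> (\<Union>c\<in>E. ball c (1/2))"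
    by (rule compactE_image[OF cpt _ cover]) simp_all
  define C where "C = (\<Sum>e\<in>E. \<bar>v e\<bar>) + 1"
  have "norm a \<le> 2 * C" if a: "\<And>e. e \<in> E \<Longrightarrow> \<bar>a e - v e\<bar> < 1" for a :: "'a dual"
  proof -
    have "\<bar>a x\<bar> \<le> C + norm a / 2" if x: "norm x \<le> 1" for x
    proof -
      obtain e where e: "e \<in> E" "norm (e - x) < 1/2" using E(2) x by (auto simp: dist_norm subset_iff)
      have "\<bar>v e\<bar> \<le> (\<Sum>e\<in>E. \<bar>v e\<bar>)" using e(1) E(1) by (intro member_le_sum) auto
      then have 1: "\<bar>a e\<bar> \<le> C" using a[OF e(1)] by (simp add: C_def)
      have "\<bar>a (x - e)\<bar> \<le> norm a * norm (x - e)" using norm_blinfun[of a "x - e"] by simp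
      also have "\<dots> \<le> norm a * (1/2)" using e(2) by (intro mult_left_mono) (auto simp: norm_minus_commute)
      finally show ?thesis using 1 unfolding blinfun.diff_right by linarith
    qed
    then have *: "norm (a x) \<le> C + norm a / 2" if "norm x = 1" for x using that by simp
    have "norm (a x) \<le> (C + norm a / 2) * norm x" for x
    proof (cases "x = 0")
      case False
      then show ?thesis using *[of "(1 / norm x) *\<^sub>R x"]
        by (simp add: blinfun.scaleR_right divide_le_eq)
    qed simp
    moreover have "0 \<le> C" unfolding C_def by (intro add_nonneg_nonneg sum_nonneg) auto
    ultimately have "norm a \<le> C + norm a / 2" by (intro norm_blinfun_bound) auto
    then show ?thesis by simp
  qed
  then show ?thesis using E(1) by blast
qed

text \<open>The supremum is bounded above near \<open>x0\<close>, so \<open>approx_subdiffD\<close>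
  bounds \<open>a\<close> from above on a ball around \<open>x0 - x\<close>. Closeness to
  \<open>v\<close> in the single direction \<open>xbar - x0\<close> recentres this ball; the
  displacement from \<open>xbar\<close> to \<open>x\<close> costs half of \<open>norm a\<close>,
  which is absorbed. An \<open>ereal\<close>-valued function can be continuous at a point of value
  infinity, so membership in the domain is a separate assumption.\<close>

lemma continuity_norm_bound:
  fixes f :: "'i \<Rightarrow> 'a::real_normed_vector \<Rightarrow> ereal" and v :: "'a dual"
  assumes f_proper: "\<And>t. t \<in> T \<Longrightarrow> proper_fun (f t)"
    and x0: "x0 \<in> effective_dom (pointwise_sup T f)" and cont: "isCont (pointwise_sup T f) x0"
  obtains K \<epsilon>0 where "0 < \<epsilon>0" "\<And>a \<epsilon>. a \<in> approx_subdiff T f xbar \<epsilon> \<Longrightarrow> \<epsilon> \<le> \<epsilon>0 \<Longrightarrow>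
      \<bar>blinfun_apply a (xbar - x0) - v (xbar - x0)\<bar> < 1 \<Longrightarrow> norm a \<le> K"
proof -
  have "pointwise_sup T f x0 \<noteq> \<infinity>" using x0 by (auto simp: effective_dom_def)
  then obtain N :: real where N: "pointwise_sup T f x0 < ereal N" unfolding less_PInf_Ex_of_nat by blast
  have "\<forall>\<^sub>F y in nhds x0. pointwise_sup T f y < ereal N"
    using cont N unfolding isCont_def by (auto simp: eventually_nhds_conv_at intro: order_tendstoD)
  then obtain r where r: "0 < r" "\<And>y. dist y x0 < r \<Longrightarrow> pointwise_sup T f y < ereal N"
    unfolding eventually_nhds_metric by blast
  define s where "s = r / 2"
  have s: "0 < s" "\<And>h. norm h \<le> s \<Longrightarrow> pointwise_sup T f (x0 + h) \<le> ereal N"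
    using r by (auto simp: s_def dist_norm intro!: less_imp_le)
  \<comment> \<open>The first 1 bounds \<open>\<epsilon>\<close>, the second bounds the difference
    of \<open>a\<close> and \<open>v\<close> at \<open>xbar - x0\<close>.\<close>
  define C where "C = N - real_of_ereal (pointwise_sup T f xbar) + 1 + v (xbar - x0) + 1"
  have "norm a \<le> 2 * \<bar>C\<bar> / s"
    if a: "a \<in> approx_subdiff T f xbar \<epsilon>" and \<epsilon>: "\<epsilon> \<le> min 1 (s / 2)" and va: "\<bar>a (xbar - x0) - v (xbar - x0)\<bar> < 1"
    for a \<epsilon>
  proof -
    obtain x \<gamma> where x: "norm (x - xbar) \<le> \<epsilon>" and \<gamma>: "pointwise_sup T f xbar = ereal \<gamma>"
      and up: "\<And>y r. pointwise_sup T f y \<le> ereal r \<Longrightarrow> a (y - x) \<le> r - \<gamma> + \<epsilon>"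
      by (rule approx_subdiffD[OF f_proper a], assumption) (rule that)
    have "a (x - xbar) \<le> norm a * norm (x - xbar)" using norm_blinfun[of a "x - xbar"] by simp
    also have "\<dots> \<le> norm a * (s / 2)" using x \<epsilon> by (intro mult_left_mono) auto
    finally have ax: "a (x - xbar) \<le> norm a * (s / 2)" .
    have bound: "a h \<le> \<bar>C\<bar> + norm a * (s / 2)" if "norm h \<le> s" for h
    proof -
      have "a (x0 + h - x) \<le> N - \<gamma> + \<epsilon>" using up s(2)[OF that] by blast
      then have "a h \<le> N - \<gamma> + \<epsilon> + a (xbar - x0) + a (x - xbar)"
        by (simp add: blinfun.diff_right blinfun.add_right)
      moreover have "C = N - \<gamma> + 1 + v (xbar - x0) + 1" by (simp add: C_def \<gamma>)
      moreover have "\<epsilon> \<le> 1" using \<epsilon> by simp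
      ultimately show ?thesis using ax va by linarith
    qed
    have "norm (a h) \<le> (\<bar>C\<bar> / s + norm a / 2) * norm h" for h
    proof (cases "h = 0")
      case False
      have "a ((s / norm h) *\<^sub>R h) \<le> \<bar>C\<bar> + norm a * (s / 2)" "a (- ((s / norm h) *\<^sub>R h)) \<le> \<bar>C\<bar> + norm a * (s / 2)"
        using s(1) False by (intro bound; simp)+
      then have "s / norm h * \<bar>a h\<bar> \<le> \<bar>C\<bar> + norm a * (s / 2)"
        by (auto simp: blinfun.scaleR_right blinfun.minus_right abs_if)
      then show ?thesis using s(1) False by (simp add: field_simps)
    qed simp
    then have "norm a \<le> \<bar>C\<bar> / s + norm a / 2" using s(1) by (intro norm_blinfun_bound) auto
    then show ?thesis by simp
  qed
  then show thesis using that[of "min 1 (s / 2)" "2 * \<bar>C\<bar> / s"] s(1) by auto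
qed

text \<open>Approximating functionals have moving base points \<open>x\<close>, and weak* closeness
  says nothing about \<open>a (x - xbar)\<close>. The norm bound \<open>K\<close> makes this term at
  most \<open>K * \<epsilon>\<close>, and then the limit of the subgradient inequalities
  exists.\<close>

lemma closure_subset_subdifferential_sup:
  fixes f :: "'i \<Rightarrow> 'a::real_normed_vector \<Rightarrow> ereal" and v :: "'a dual"
  assumes T_ne: "T \<noteq> {}" and f_proper: "\<And>t. t \<in> T \<Longrightarrow> proper_fun (f t)"
    and v: "\<And>\<epsilon>. 0 < \<epsilon> \<Longrightarrow> v \<in> weak_star closure_of approx_subdiff T f xbar \<epsilon>"
    and E: "finite E" and \<epsilon>0: "0 < \<epsilon>0"
    and bound: "\<And>a \<epsilon>. a \<in> approx_subdiff T f xbar \<epsilon> \<Longrightarrow> \<epsilon> \<le> \<epsilon>0 \<Longrightarrow>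
      (\<And>e. e \<in> E \<Longrightarrow> \<bar>blinfun_apply a e - v e\<bar> < 1) \<Longrightarrow> norm a \<le> K"
  shows "v \<in> subdifferential (pointwise_sup T f) xbar"
proof -
  obtain a where a: "a \<in> approx_subdiff T f xbar 1"
    by (rule closure_of_weak_starD[OF v[OF zero_less_one] E zero_less_one])
  obtain \<gamma> where \<gamma>: "pointwise_sup T f xbar = ereal \<gamma>"
    by (rule approx_subdiffD[OF f_proper a], assumption) (rule that)
  have main: "v (y - xbar) \<le> r - \<gamma>" if y: "pointwise_sup T f y \<le> ereal r" for y r
  proof (rule field_le_epsilon)
    fix \<sigma> :: real assume \<sigma>: "0 < \<sigma>"
    \<comment> \<open>One half of \<open>\<sigma>\<close> covers \<open>\<epsilon>\<close> and the
      displacement of the base point; the other half covers the distance of \<open>a\<close> and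
      \<open>v\<close> at \<open>y - xbar\<close>.\<close>
    define \<epsilon> where "\<epsilon> = min \<epsilon>0 (\<sigma> / (2 * (1 + \<bar>K\<bar>)))"
    have \<epsilon>: "0 < \<epsilon>" "\<epsilon> \<le> \<epsilon>0" using \<epsilon>0 \<sigma> by (auto simp: \<epsilon>_def)
    have "\<epsilon> \<le> \<sigma> / (2 * (1 + \<bar>K\<bar>))" by (simp add: \<epsilon>_def)
    then have \<epsilon>K: "\<epsilon> + \<bar>K\<bar> * \<epsilon> \<le> \<sigma> / 2" by (simp add: field_simps)
    obtain a where a: "a \<in> approx_subdiff T f xbar \<epsilon>"
      and av: "\<And>e. e \<in> insert (y - xbar) E \<Longrightarrow> \<bar>a e - v e\<bar> < min 1 (\<sigma> / 2)"
      by (rule closure_of_weak_starD[OF v[OF \<epsilon>(1)], of "insert (y - xbar) E" "min 1 (\<sigma> / 2)"])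
        (use E \<sigma> in auto)
    have aK: "norm a \<le> \<bar>K\<bar>" using bound[OF a \<epsilon>(2)] av by fastforce
    obtain x where x: "norm (x - xbar) \<le> \<epsilon>" and up: "a (y - x) \<le> r - \<gamma> + \<epsilon>"
      by (rule approx_subdiffD[OF f_proper a]) (use that y \<gamma> in auto)
    have "a (x - xbar) \<le> norm a * norm (x - xbar)" using norm_blinfun[of a "x - xbar"] by simp
    also have "\<dots> \<le> \<bar>K\<bar> * \<epsilon>" using x aK by (intro mult_mono) auto
    finally have "a (y - xbar) \<le> r - \<gamma> + \<epsilon> + \<bar>K\<bar> * \<epsilon>" using up by (simp add: blinfun.diff_right)
    moreover have "\<bar>a (y - xbar) - v (y - xbar)\<bar> < \<sigma> / 2" using av[of "y - xbar"] by simp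
    ultimately show "v (y - xbar) \<le> r - \<gamma> + \<sigma>" using \<epsilon>K by linarith
  qed
  have "ereal (v (y - xbar)) \<le> pointwise_sup T f y - ereal \<gamma>" for y
  proof (cases "pointwise_sup T f y")
    case (real r)
    then show ?thesis using main[of y r] by simp
  next
    \<comment> \<open>Impossible, since the supremum dominates a proper function.\<close>
    case MInf
    obtain t where t: "t \<in> T" using T_ne by blast
    then have "f t y \<le> pointwise_sup T f y" unfolding pointwise_sup_def by (rule SUP_upper)
    then show ?thesis using f_proper[OF t] MInf by (simp add: proper_fun_def)
  qed simp
  then show ?thesis by (simp add: subdifferential_def \<gamma>)
qed

theorem theorem5p1:
  fixes T :: "'i set" and f :: "'i \<Rightarrow> 'a::banach \<Rightarrow> ereal" and xbar :: 'a and U :: "'a set"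
  assumes asplund: "asplund_space TYPE('a)"
    and T_ne: "T \<noteq> {}"
    and f_proper: "\<And>t. t \<in> T \<Longrightarrow> proper_fun (f t)"
    and f_convex: "\<And>t. t \<in> T \<Longrightarrow> convex_fun (f t)"
    and f_lsc: "\<And>t. t \<in> T \<Longrightarrow> lsc_fun (f t)"
    and U_nhd: "xbar \<in> interior U"
    and compactness: "\<And>x. x \<in> U \<Longrightarrow> \<exists>t0. \<forall>t \<in> T - {t0}. subgrad_compact_at (f t) x"
    and qualification: "\<And>x F w. x \<in> U \<Longrightarrow> finite F \<Longrightarrow> F \<subseteq> T \<Longrightarrow>
          (\<forall>t\<in>F. w t \<in> normal_cone_dom (f t) x) \<Longrightarrow> (\<Sum>t\<in>F. w t) = 0 \<Longrightarrow> (\<forall>t\<in>F. w t = 0)"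
  shows "subdifferential (pointwise_sup T f) xbar \<subseteq> (\<Inter>\<epsilon>\<in>{0<..}. weak_star closure_of approx_subdiff T f xbar \<epsilon>)
    \<and> ((\<exists>x0 \<in> effective_dom (pointwise_sup T f). isCont (pointwise_sup T f) x0) \<or> (\<exists>B :: 'a set. finite B \<and> span B = UNIV) \<longrightarrow>
         subdifferential (pointwise_sup T f) xbar = (\<Inter>\<epsilon>\<in>{0<..}. weak_star closure_of approx_subdiff T f xbar \<epsilon>))"
    (is "?S \<subseteq> ?C \<and> (?cont \<or> ?fd \<longrightarrow> ?S = ?C)")
proof (intro conjI impI)
  show sub: "?S \<subseteq> ?C"
  proof (rule INT_greatest)
    fix \<epsilon> :: real assume "\<epsilon> \<in> {0<..}"
    then have "0 < \<epsilon>" by simp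
    from subdifferential_sup_subset_closure[OF f_proper f_convex f_lsc U_nhd compactness qualification this]
    show "?S \<subseteq> weak_star closure_of approx_subdiff T f xbar \<epsilon>" .
  qed
  assume "?cont \<or> ?fd"
  have "v \<in> ?S" if "v \<in> ?C" for v
  proof -
    have vC: "\<And>\<epsilon>. 0 < \<epsilon> \<Longrightarrow> v \<in> weak_star closure_of approx_subdiff T f xbar \<epsilon>" using that by blast
    from \<open>?cont \<or> ?fd\<close> show ?thesis
    proof
      assume ?cont
      then obtain x0 where x0: "x0 \<in> effective_dom (pointwise_sup T f)" "isCont (pointwise_sup T f) x0"
        by blast
      obtain K \<epsilon>0 where
        K: "0 < \<epsilon>0" "\<And>a \<epsilon>. a \<in> approx_subdiff T f xbar \<epsilon> \<Longrightarrow> \<epsilon> \<le> \<epsilon>0 \<Longrightarrow>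
          \<bar>blinfun_apply a (xbar - x0) - v (xbar - x0)\<bar> < 1 \<Longrightarrow> norm a \<le> K"
        by (rule continuity_norm_bound[OF f_proper x0, of xbar v], assumption) (rule that)
      \<comment> \<open>A single test direction is enough here, because the supremum is bounded
        above near \<open>x0\<close>.\<close>
      show ?thesis
        by (rule closure_subset_subdifferential_sup[OF T_ne f_proper vC, of "{xbar - x0}" \<epsilon>0 K])
          (use K in auto)
    next
      assume ?fd
      then obtain B :: "'a set" where "finite B" "span B = UNIV" by blast
      then obtain E K where "finite E"
        "\<forall>a :: 'a dual. (\<forall>e\<in>E. \<bar>blinfun_apply a e - v e\<bar> < 1) \<longrightarrow> norm a \<le> K"
        using finite_span_norm_bound by metis
      \<comment> \<open>This bound holds for all functionals near \<open>v\<close> on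
        \<open>E\<close>, whatever \<open>\<epsilon>\<close> is, so the threshold 1 is an arbitrary
        choice.\<close>
      then show ?thesis
        by (intro closure_subset_subdifferential_sup[OF T_ne f_proper vC, of E 1 K]) auto
    qed
  qed
  with sub show "?S = ?C" by blast
qed

end
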